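(* Let $H$ be a fixed hypergraph with at least one edge and, for each $n$, let $p=p(n)\in(0,1)$. In the homogeneous model $\mathbb H(n,p)$, the following are equivalent (all limits are as $n\to\infty$): 1) $\widetilde Z_H^n$ converges in distribution to the standard normal distribution $\mathcal N(0,1)$; 2) $\min_{F\subseteq H:\,e_F\ge1}p^{e_F}n^{v_F}\to\infty$ and $(1-p)\,n^{\min\{|e|:\,e\in E(H)\}}\to\infty$; 3) $(1-p)\min_{F\subseteq H:\,e_F\ge1}p^{e_F}n^{v_F}\to\infty$; 4) $\mathbf E\big[(\widetilde Z_H^n)^4\big]\to3$.
   Context: A hypergraph $H$ consists of a finite vertex set $V(H)$ and a set $E(H)$ of non-empty subsets of $V(H)$ (edges, of arbitrary sizes; size $1$ is allowed). $v_H=|V(H)|$, $e_H=|E(H)|$, and $|e|$ is the size of the edge $e$. $F\subseteq H$ means $V(F)\subseteq V(H)$ and $E(F)\subseteq E(H)$; $\simeq$ denotes hypergraph isomorphism. $[n]=\{1,\dots,n\}$ and $K_n^*=([n],2^{[n]}\setminus\{\emptyset\})$ is the complete hypergraph on $[n]$. For $p\in(0,1)$ (which may depend on $n$), the homogeneous random hypergraph $\mathbb H(n,p)$ has vertex set $[n]$, and each non-empty $e\subseteq[n]$ is an edge independently with the same probability $p$. $Z_H^n$ is the number of hypergraphs $H'\subseteq K_n^*$ with $H'\simeq H$ and $H'\subseteq\mathbb H(n,p)$, and $\widetilde Z_H^n=(Z_H^n-\mathbf E[Z_H^n])/\sqrt{\mathrm{Var}[Z_H^n]}$ (defined for $n\ge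 v_H$). *)

theory Defs
  imports "HOL-Probability.Probability"
begin

type_synonym 'a hypergraph = "'a set \<times> 'a set set"

abbreviation verts :: "'a hypergraph \<Rightarrow> 'a set" where "verts \<equiv> fst"
abbreviation edges :: "'a hypergraph \<Rightarrow> 'a set set" where "edges \<equiv> snd"

definition hypergraph :: "'a hypergraph \<Rightarrow> bool" where
  "hypergraph H \<longleftrightarrow> finite (verts H) \<and> edges H \<subseteq> Pow (verts H) - {{}}"

definition subhypergraph :: "'a hypergraph \<Rightarrow> 'a hypergraph \<Rightarrow> bool" where
  "subhypergraph F H \<longleftrightarrow> hypergraph F \<and> verts F \<subseteq> verts H \<and> edges F \<subseteq> edges H"

definition hypergraph_iso :: "'a hypergraph \<Rightarrow> 'b hypergraph \<Rightarrow> bool" where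
  "hypergraph_iso H H' \<longleftrightarrow>
     (\<exists>f. bij_betw f (verts H) (verts H') \<and> edges H' = (\<lambda>e. f ` e) ` edges H)"

definition complete_hypergraph :: "nat \<Rightarrow> nat hypergraph" where
  "complete_hypergraph n = ({1..n}, Pow {1..n} - {{}})"

definition random_hypergraph :: "nat \<Rightarrow> real \<Rightarrow> nat hypergraph pmf" where
  "random_hypergraph n p =
     map_pmf (\<lambda>\<omega>. ({1..n}, {e \<in> Pow {1..n} - {{}}. \<omega> e}))
       (Pi_pmf (Pow {1..n} - {{}}) False (\<lambda>_. bernoulli_pmf p))"

text \<open>Copies are counted as subhypergraphs of the complete hypergraph (not as embeddings);
  two copies with the same edges but different vertex sets are distinct.\<close>

definition copy_count :: "'a hypergraph \<Rightarrow> nat \<Rightarrow> nat hypergraph \<Rightarrow> real" where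
  "copy_count H n G =
     real (card {H'. subhypergraph H' (complete_hypergraph n) \<and> hypergraph_iso H' H \<and>
                     subhypergraph H' G})"

text \<open>For \<open>n < card (verts H)\<close> the variance is zero, and the value below is zero by the convention
  \<open>x / 0 = 0\<close>; this does not affect limits.\<close>

definition normalized_copy_count ::
    "'a hypergraph \<Rightarrow> nat \<Rightarrow> real \<Rightarrow> nat hypergraph \<Rightarrow> real" where
  "normalized_copy_count H n p G =
     (copy_count H n G - measure_pmf.expectation (random_hypergraph n p) (copy_count H n)) /
     sqrt (measure_pmf.variance (random_hypergraph n p) (copy_count H n))"

definition min_expected_scale :: "'a hypergraph \<Rightarrow> nat \<Rightarrow> real \<Rightarrow> real" where
  "min_expected_scale H n p =
     Min ((\<lambda>F. p ^ card (edges F) * real n ^ card (verts F)) `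
          {F. subhypergraph F H \<and> card (edges F) \<ge> 1})"

end

theory Submission
  imports Defs
begin

text \<open>A placement is an injection of the vertices of \<open>H\<close> into \<open>{1..n}\<close>. Every copy of \<open>H\<close> arises from
the same number of placements, so the normalised copy count is the normalised sum \<open>Z\<close> of the centred
indicators that the edges of a placement are all present. Write \<open>v\<close> and \<open>e\<close> for the numbers of vertices and
edges of \<open>H\<close>, \<open>q = 1 - p\<close>, \<open>\<Lambda> = n^v p^e\<close>, let \<open>\<Phi>\<close> be the minimum of \<open>p^(e_F) n^(v_F)\<close> over the
subhypergraphs \<open>F\<close> with an edge, and put \<open>\<theta> = q \<Phi>\<close>. The single parameter \<open>\<theta>\<close> controls everything.

The reason is the following count. Indicators of two placements are dependent only if the placements
share an edge. If one more placement is required to meet a given bounded union of edges, then it meets it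
in a copy of some \<open>F\<close>, and this restricts \<open>v_F\<close> of its vertices and spares \<open>e_F\<close> of its edges; hence
it contributes a factor of order at most \<open>\<Lambda> / \<Phi>\<close> instead of \<open>\<Lambda>\<close> (\<open>sum_meeting_le\<close>). Conversely, placements
that agree on the vertices of a minimising \<open>F\<close> realise this order (\<open>twins_share\<close> and the three bounds proved
with it). So sums over connected \<open>m\<close>-tuples of placements, weighted by the probability of their union,
have the exact order \<open>\<Lambda>^m / \<Phi>^(m-1)\<close>. Centring contributes a factor of order \<open>q\<close>.
The variance has the order \<open>q \<Lambda>^2 / \<Phi>\<close>, and the normalised sum of the fourth joint cumulants has at most
the order \<open>\<theta>^(-1)\<close>.

If \<open>\<theta>\<close> tends to infinity, the limit law follows from a differential inequality for the characteristic
function (\<open>char_local_dependence_bound\<close>), whose error is a third-order sum of this kind, and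
the fourth moment converges to 3 because its distance from 3 is the normalised fourth cumulant.

For the converse directions the cumulants are bounded from below (\<open>moment_lower_bounds\<close>). A joint
cumulant of indicators is an alternating sum of powers of \<open>p\<close>. For small \<open>p\<close> the lowest power, which belongs
to the trivial partition, dominates, so all cumulants are nonnegative. For \<open>p\<close> close to 1, the term of first
order in \<open>q\<close> is, up to a sign depending only on \<open>m\<close>, the number of edges common to all the placements, so no
cancellation occurs either. For \<open>p\<close> in between, \<open>\<theta>\<close> is at least of order \<open>n\<close>. This shows that
convergence of the fourth moment to 3 forces \<open>\<theta>\<close> to infinity. If instead the limit law is given, then the
mean absolute value of \<open>Z\<close>, being at most of order \<open>\<theta>^(1/2)\<close>, must not become small, so \<open>\<theta>\<close>
is bounded away from 0. Hence the fourth moments are bounded and the third moments converge to 0, which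
forces \<open>\<theta>\<close> to infinity because the third moment is bounded from below in terms of \<open>\<theta>^(-1/2)\<close>.
The two forms of the condition on \<open>p\<close> are compared by elementary means in \<open>two_conditions_iff\<close>.\<close>

section \<open>Characteristic functions of sums with local dependence\<close>

lemma norm_iexp_diff_le: "cmod (iexp a - iexp b) \<le> \<bar>a - b\<bar>"
proof -
  have "iexp a - iexp b = iexp b * (iexp (a - b) - 1)"
    by (simp add: algebra_simps flip: exp_add)
  then have "cmod (iexp a - iexp b) = cmod (iexp (a - b) - 1)"
    by (simp add: norm_mult)
  also have "\<dots> \<le> \<bar>a - b\<bar>"
    using iexp_approx1[of "a - b" 0] by simp
  finally show ?thesis .
qed

lemma norm_iexp_diff_second_order_le:
  "cmod (iexp a - iexp (a - y) - \<i> * y * iexp a) \<le> y\<^sup>2 / 2"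
proof -
  have "iexp a - iexp (a - y) - \<i> * y * iexp a = - (iexp a * (iexp (-y) - (1 + \<i> * (- y))))"
    by (simp add: algebra_simps flip: exp_add)
  then have "cmod (iexp a - iexp (a - y) - \<i> * y * iexp a) = cmod (iexp (-y) - (1 + \<i> * (- y)))"
    by (simp only: norm_minus_cancel norm_mult) simp
  also have "\<dots> \<le> y\<^sup>2 / 2"
    using iexp_approx1[of "-y" 1] by (simp add: power2_eq_square)
  finally show ?thesis .
qed

text \<open>\<open>N j\<close> is a dependency neighbourhood of \<open>j\<close>. Independence from the variables outside a neighbourhood enters
the characteristic function argument only through products with exponentials of their sum; the two
independence assumptions ask for exactly this, the first one combined with centring.\<close>

locale local_dependence =
  fixes M :: "'w pmf" and J :: "'j set" and X :: "'j \<Rightarrow> 'w \<Rightarrow> real" and N :: "'j \<Rightarrow> 'j set"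
  assumes finite_support: "finite (set_pmf M)"
    and finite_index: "finite J"
    and nbhd_subset: "\<And>j. j \<in> J \<Longrightarrow> N j \<subseteq> J"
    and single_indep: "\<And>j t. j \<in> J \<Longrightarrow>
      measure_pmf.expectation M (\<lambda>w. X j w * iexp (t * (\<Sum>l\<in>J - N j. X l w))) = 0"
    and pair_indep: "\<And>j k t. j \<in> J \<Longrightarrow> k \<in> N j \<Longrightarrow>
      measure_pmf.expectation M (\<lambda>w. (X j w * X k w) * iexp (t * (\<Sum>l\<in>J - (N j \<union> N k). X l w))) =
      measure_pmf.expectation M (\<lambda>w. X j w * X k w) *
      measure_pmf.expectation M (\<lambda>w. iexp (t * (\<Sum>l\<in>J - (N j \<union> N k). X l w)))"
    and unit_variance: "(\<Sum>j\<in>J. \<Sum>k\<in>N j. measure_pmf.expectation M (\<lambda>w. X j w * X k w)) = 1"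
begin

abbreviation ex :: "('w \<Rightarrow> 'b::{banach, second_countable_topology}) \<Rightarrow> 'b" where
  "ex \<equiv> measure_pmf.expectation M"

definition "W w = (\<Sum>j\<in>J. X j w)"

definition "local_error =
  (\<Sum>j\<in>J. \<Sum>k\<in>N j. \<Sum>l\<in>N j \<union> N k.
     ex (\<lambda>w. \<bar>X j w * X k w * X l w\<bar>) + ex (\<lambda>w. \<bar>X j w * X k w\<bar>) * ex (\<lambda>w. \<bar>X l w\<bar>))"

lemma integrable_finite [simp]:
  "integrable M (f :: 'w \<Rightarrow> 'b::{banach, second_countable_topology})"
  by (rule integrable_measure_pmf_finite[OF finite_support])

lemma finite_nbhd: "j \<in> J \<Longrightarrow> finite (N j)"
  using finite_subset nbhd_subset finite_index by blast

lemma nbhd_split: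
  assumes "A \<subseteq> J" shows "(\<Sum>l\<in>J - A. X l w) = W w - (\<Sum>l\<in>A. X l w)"
  unfolding W_def using assms finite_index by (simp add: sum_diff)

text \<open>Deleting the neighbourhood of \<open>j\<close> from the exponent makes the expectation vanish. What remains is the
increment of the exponential, which is expanded to first order.\<close>

lemma single_expansion:
  assumes j: "j \<in> J"
  shows "cmod (ex (\<lambda>w. X j w * iexp (t * W w))
      - \<i> * t * (\<Sum>k\<in>N j. ex (\<lambda>w. (X j w * X k w) * iexp (t * W w))))
    \<le> t\<^sup>2 / 2 * ex (\<lambda>w. \<bar>X j w\<bar> * (\<Sum>k\<in>N j. X k w)\<^sup>2)"
proof -
  let ?Y = "\<lambda>w. \<Sum>k\<in>N j. X k w"
  let ?D = "\<lambda>w. X j w * (iexp (t * W w) - iexp (t * W w - t * ?Y w) - \<i> * (t * ?Y w) * iexp (t * W w))"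
  have 0: "ex (\<lambda>w. X j w * iexp (t * W w - t * ?Y w)) = 0"
    using single_indep[OF j, of t] unfolding nbhd_split[OF nbhd_subset[OF j]] right_diff_distrib .
  have "ex ?D = ex (\<lambda>w. X j w * iexp (t * W w) - X j w * iexp (t * W w - t * ?Y w)
       - \<i> * t * (\<Sum>k\<in>N j. (X j w * X k w) * iexp (t * W w)))"
    by (intro arg_cong[where f=ex] ext) (simp add: algebra_simps sum_distrib_left sum_distrib_right)
  also have "\<dots> = ex (\<lambda>w. X j w * iexp (t * W w)) 
       - \<i> * t * (\<Sum>k\<in>N j. ex (\<lambda>w. (X j w * X k w) * iexp (t * W w)))"
    using 0 by (simp add: Bochner_Integration.integral_sum)
  finally have eq: "ex (\<lambda>w. X j w * iexp (t * W w)) 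
       - \<i> * t * (\<Sum>k\<in>N j. ex (\<lambda>w. (X j w * X k w) * iexp (t * W w))) = ex ?D" ..
  have "cmod (ex ?D) \<le> ex (\<lambda>w. cmod (?D w))" by (rule integral_norm_bound)
  also have "\<dots> \<le> ex (\<lambda>w. t\<^sup>2 / 2 * (\<bar>X j w\<bar> * (?Y w)\<^sup>2))"
  proof (rule integral_mono)
    fix w
    have "cmod (?D w) \<le> \<bar>X j w\<bar> * ((t * ?Y w)\<^sup>2 / 2)"
      unfolding norm_mult norm_of_real
      using norm_iexp_diff_second_order_le[of "t * W w" "t * ?Y w"] by (intro mult_left_mono) auto
    then show "cmod (?D w) \<le> t\<^sup>2 / 2 * (\<bar>X j w\<bar> * (?Y w)\<^sup>2)"
      by (simp add: power_mult_distrib algebra_simps)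
  qed simp_all
  finally show ?thesis unfolding eq by simp
qed

text \<open>Deleting both neighbourhoods from the exponent makes it independent of \<open>X j * X k\<close>. The deletion is made
in the joint expectation and undone in the second factor of the product; the cost of both changes is linear in
the deleted part of the exponent.\<close>

lemma pair_decoupling:
  assumes j: "j \<in> J" and k: "k \<in> N j"
  shows "cmod (ex (\<lambda>w. (X j w * X k w) * iexp (t * W w))
      - ex (\<lambda>w. X j w * X k w) * ex (\<lambda>w. iexp (t * W w)))
    \<le> \<bar>t\<bar> * (\<Sum>l\<in>N j \<union> N k.
       ex (\<lambda>w. \<bar>X j w * X k w * X l w\<bar>) + ex (\<lambda>w. \<bar>X j w * X k w\<bar>) * ex (\<lambda>w. \<bar>X l w\<bar>))"
proof -
  let ?A = "N j \<union> N k"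
  let ?V = "\<lambda>w. \<Sum>l\<in>J - ?A. X l w"
  let ?P = "\<lambda>w. X j w * X k w"
  have sub: "?A \<subseteq> J" and fin: "finite ?A"
    using j k nbhd_subset finite_nbhd by auto
  have close: "cmod (iexp (t * W w) - iexp (t * ?V w)) \<le> \<bar>t\<bar> * (\<Sum>l\<in>?A. \<bar>X l w\<bar>)" for w
  proof -
    have "cmod (iexp (t * W w) - iexp (t * ?V w)) \<le> \<bar>t * (\<Sum>l\<in>?A. X l w)\<bar>"
      using norm_iexp_diff_le[of "t * W w" "t * ?V w"]
      by (simp only: nbhd_split[OF sub]) (simp add: algebra_simps)
    also have "\<dots> \<le> \<bar>t\<bar> * (\<Sum>l\<in>?A. \<bar>X l w\<bar>)"
      by (simp add: abs_mult mult_left_mono sum_abs)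
    finally show ?thesis .
  qed
  have 1: "cmod (ex (\<lambda>w. ?P w * iexp (t * W w)) - ex (\<lambda>w. ?P w * iexp (t * ?V w)))
     \<le> \<bar>t\<bar> * (\<Sum>l\<in>?A. ex (\<lambda>w. \<bar>?P w * X l w\<bar>))"
  proof -
    have "cmod (ex (\<lambda>w. ?P w * iexp (t * W w)) - ex (\<lambda>w. ?P w * iexp (t * ?V w)))
       = cmod (ex (\<lambda>w. ?P w * (iexp (t * W w) - iexp (t * ?V w))))"
      by (simp add: right_diff_distrib)
    also have "\<dots> \<le> ex (\<lambda>w. cmod (?P w * (iexp (t * W w) - iexp (t * ?V w))))"
      by (rule integral_norm_bound)
    also have "\<dots> \<le> ex (\<lambda>w. \<bar>t\<bar> * (\<Sum>l\<in>?A. \<bar>?P w * X l w\<bar>))"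
    proof (rule integral_mono)
      fix w
      have "cmod (?P w * (iexp (t * W w) - iexp (t * ?V w))) \<le> \<bar>?P w\<bar> * (\<bar>t\<bar> * (\<Sum>l\<in>?A. \<bar>X l w\<bar>))"
        unfolding norm_mult norm_of_real abs_mult
        by (intro mult_left_mono close) auto
      then show "cmod (?P w * (iexp (t * W w) - iexp (t * ?V w))) \<le> \<bar>t\<bar> * (\<Sum>l\<in>?A. \<bar>?P w * X l w\<bar>)"
        by (simp add: abs_mult sum_distrib_left mult_ac)
    qed simp_all
    finally show ?thesis by (simp add: Bochner_Integration.integral_sum)
  qed
  have 2: "cmod (ex (\<lambda>w. iexp (t * ?V w)) - ex (\<lambda>w. iexp (t * W w)))
     \<le> \<bar>t\<bar> * (\<Sum>l\<in>?A. ex (\<lambda>w. \<bar>X l w\<bar>))"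
  proof -
    have "cmod (ex (\<lambda>w. iexp (t * ?V w)) - ex (\<lambda>w. iexp (t * W w)))
       = cmod (ex (\<lambda>w. iexp (t * ?V w) - iexp (t * W w)))" by simp
    also have "\<dots> \<le> ex (\<lambda>w. cmod (iexp (t * ?V w) - iexp (t * W w)))"
      by (rule integral_norm_bound)
    also have "\<dots> \<le> ex (\<lambda>w. \<bar>t\<bar> * (\<Sum>l\<in>?A. \<bar>X l w\<bar>))"
      using close by (intro integral_mono) (simp_all add: norm_minus_commute)
    finally show ?thesis by (simp add: Bochner_Integration.integral_sum)
  qed
  have "cmod (ex (\<lambda>w. ?P w * iexp (t * W w)) - ex ?P * ex (\<lambda>w. iexp (t * W w)))
     = cmod ((ex (\<lambda>w. ?P w * iexp (t * W w)) - ex (\<lambda>w. ?P w * iexp (t * ?V w)))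
         + ex ?P * (ex (\<lambda>w. iexp (t * ?V w)) - ex (\<lambda>w. iexp (t * W w))))"
    using pair_indep[OF j k, of t] by (simp add: algebra_simps)
  also have "\<dots> \<le> cmod (ex (\<lambda>w. ?P w * iexp (t * W w)) - ex (\<lambda>w. ?P w * iexp (t * ?V w)))
         + \<bar>ex ?P\<bar> * cmod (ex (\<lambda>w. iexp (t * ?V w)) - ex (\<lambda>w. iexp (t * W w)))"
    by (rule order_trans[OF norm_triangle_ineq]) (simp only: norm_mult norm_of_real order_refl)
  also have "\<dots> \<le> \<bar>t\<bar> * (\<Sum>l\<in>?A. ex (\<lambda>w. \<bar>?P w * X l w\<bar>))
         + ex (\<lambda>w. \<bar>?P w\<bar>) * (\<bar>t\<bar> * (\<Sum>l\<in>?A. ex (\<lambda>w. \<bar>X l w\<bar>)))"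
    by (intro add_mono mult_mono 1 2 integral_abs_bound) auto
  also have "\<dots> = \<bar>t\<bar> * (\<Sum>l\<in>?A. ex (\<lambda>w. \<bar>?P w * X l w\<bar>) + ex (\<lambda>w. \<bar>?P w\<bar>) * ex (\<lambda>w. \<bar>X l w\<bar>))"
    by (simp add: sum.distrib algebra_simps sum_distrib_left)
  finally show ?thesis .
qed

lemma second_order_error:
  assumes j: "j \<in> J"
  shows "ex (\<lambda>w. \<bar>X j w\<bar> * (\<Sum>k\<in>N j. X k w)\<^sup>2)
    \<le> (\<Sum>k\<in>N j. \<Sum>l\<in>N j \<union> N k.
       ex (\<lambda>w. \<bar>X j w * X k w * X l w\<bar>) + ex (\<lambda>w. \<bar>X j w * X k w\<bar>) * ex (\<lambda>w. \<bar>X l w\<bar>))"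
proof -
  have "ex (\<lambda>w. \<bar>X j w\<bar> * (\<Sum>k\<in>N j. X k w)\<^sup>2) \<le> ex (\<lambda>w. \<Sum>k\<in>N j. \<Sum>l\<in>N j. \<bar>X j w * X k w * X l w\<bar>)"
  proof (rule integral_mono)
    fix w
    have "(\<Sum>k\<in>N j. X k w)\<^sup>2 \<le> (\<Sum>k\<in>N j. \<bar>X k w\<bar>)\<^sup>2"
      by (rule abs_le_square_iff[THEN iffD1]) (metis abs_ge_self order_trans sum_abs)
    then have "\<bar>X j w\<bar> * (\<Sum>k\<in>N j. X k w)\<^sup>2 \<le> \<bar>X j w\<bar> * (\<Sum>k\<in>N j. \<bar>X k w\<bar>)\<^sup>2"
      by (intro mult_left_mono) auto
    also have "\<dots> = (\<Sum>k\<in>N j. \<Sum>l\<in>N j. \<bar>X j w * X k w * X l w\<bar>)"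
      by (simp add: power2_eq_square sum_product sum_distrib_left abs_mult mult_ac)
    finally show "\<bar>X j w\<bar> * (\<Sum>k\<in>N j. X k w)\<^sup>2 \<le> (\<Sum>k\<in>N j. \<Sum>l\<in>N j. \<bar>X j w * X k w * X l w\<bar>)" .
  qed simp_all
  also have "\<dots> = (\<Sum>k\<in>N j. \<Sum>l\<in>N j. ex (\<lambda>w. \<bar>X j w * X k w * X l w\<bar>))"
    by (simp add: Bochner_Integration.integral_sum)
  also have "\<dots> \<le> (\<Sum>k\<in>N j. \<Sum>l\<in>N j \<union> N k.
       ex (\<lambda>w. \<bar>X j w * X k w * X l w\<bar>) + ex (\<lambda>w. \<bar>X j w * X k w\<bar>) * ex (\<lambda>w. \<bar>X l w\<bar>))"
  proof (rule sum_mono)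
    fix k assume k: "k \<in> N j"
    then have fin: "finite (N j \<union> N k)" using j nbhd_subset finite_nbhd by auto
    have "(\<Sum>l\<in>N j. ex (\<lambda>w. \<bar>X j w * X k w * X l w\<bar>)) \<le> (\<Sum>l\<in>N j \<union> N k. ex (\<lambda>w. \<bar>X j w * X k w * X l w\<bar>))"
      using fin by (intro sum_mono2) auto
    also have "\<dots> \<le> (\<Sum>l\<in>N j \<union> N k.
       ex (\<lambda>w. \<bar>X j w * X k w * X l w\<bar>) + ex (\<lambda>w. \<bar>X j w * X k w\<bar>) * ex (\<lambda>w. \<bar>X l w\<bar>))"
      by (intro sum_mono) simp
    finally show "(\<Sum>l\<in>N j. ex (\<lambda>w. \<bar>X j w * X k w * X l w\<bar>)) \<le> (\<Sum>l\<in>N j \<union> N k.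
       ex (\<lambda>w. \<bar>X j w * X k w * X l w\<bar>) + ex (\<lambda>w. \<bar>X j w * X k w\<bar>) * ex (\<lambda>w. \<bar>X l w\<bar>))" .
  qed
  finally show ?thesis .
qed

lemma local_error_nonneg: "local_error \<ge> 0"
  unfolding local_error_def by (intro sum_nonneg add_nonneg_nonneg mult_nonneg_nonneg) auto

text \<open>The first sum, with its factor \<open>\<i>\<close>, is the derivative of the characteristic function \<open>\<phi>\<close> of the
sum. Up to an error, \<open>\<phi>\<close> therefore solves the equation \<open>\<phi>'(t) = - t \<phi>(t)\<close> of the Gaussian
characteristic function.\<close>

lemma almost_gaussian_ode:
  "cmod (\<i> * (\<Sum>j\<in>J. ex (\<lambda>w. X j w * iexp (t * W w))) + t * ex (\<lambda>w. iexp (t * W w)))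
    \<le> 2 * t\<^sup>2 * local_error"
proof -
  let ?e = "\<lambda>j k. ex (\<lambda>w. (X j w * X k w) * iexp (t * W w))"
  let ?c = "\<lambda>j k. ex (\<lambda>w. X j w * X k w)"
  let ?ph = "ex (\<lambda>w. iexp (t * W w))"
  let ?r = "\<lambda>j k. (\<Sum>l\<in>N j \<union> N k.
       ex (\<lambda>w. \<bar>X j w * X k w * X l w\<bar>) + ex (\<lambda>w. \<bar>X j w * X k w\<bar>) * ex (\<lambda>w. \<bar>X l w\<bar>))"
  let ?s = "\<lambda>j. ex (\<lambda>w. X j w * iexp (t * W w)) - \<i> * t * (\<Sum>k\<in>N j. ?e j k)"
  let ?d = "\<lambda>j k. ?e j k - ?c j k * ?ph"
  have "(\<Sum>j\<in>J. \<Sum>k\<in>N j. complex_of_real (?c j k)) = 1"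
    using arg_cong[OF unit_variance, of complex_of_real] by simp
  then have "(\<Sum>j\<in>J. \<Sum>k\<in>N j. ?c j k * ?ph) = ?ph"
    by (simp flip: sum_distrib_right)
  then have "\<i> * (\<Sum>j\<in>J. ex (\<lambda>w. X j w * iexp (t * W w))) + t * ?ph
     = \<i> * (\<Sum>j\<in>J. ?s j) - t * (\<Sum>j\<in>J. \<Sum>k\<in>N j. ?d j k)"
    by (simp add: sum_subtractf algebra_simps flip: sum_distrib_left)
  then have "cmod (\<i> * (\<Sum>j\<in>J. ex (\<lambda>w. X j w * iexp (t * W w))) + t * ?ph)
     \<le> cmod (\<i> * (\<Sum>j\<in>J. ?s j)) + cmod (t * (\<Sum>j\<in>J. \<Sum>k\<in>N j. ?d j k))"
    by (simp only: norm_triangle_ineq4)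
  also have "\<dots> = cmod (\<Sum>j\<in>J. ?s j) + \<bar>t\<bar> * cmod (\<Sum>j\<in>J. \<Sum>k\<in>N j. ?d j k)"
    by (simp add: norm_mult)
  also have "\<dots> \<le> (\<Sum>j\<in>J. t\<^sup>2 / 2 * (\<Sum>k\<in>N j. ?r j k)) + \<bar>t\<bar> * (\<Sum>j\<in>J. \<Sum>k\<in>N j. \<bar>t\<bar> * ?r j k)"
  proof (intro add_mono mult_left_mono sum_norm_le)
    fix j assume j: "j \<in> J"
    show "cmod (?s j) \<le> t\<^sup>2 / 2 * (\<Sum>k\<in>N j. ?r j k)"
      by (rule order_trans[OF single_expansion[OF j]], rule mult_left_mono[OF second_order_error[OF j]]) simp
    fix k assume k: "k \<in> N j"
    show "cmod (?d j k) \<le> \<bar>t\<bar> * ?r j k" by (rule pair_decoupling[OF j k])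
  qed auto
  also have "\<dots> = (t\<^sup>2 / 2) * local_error + t\<^sup>2 * local_error"
    unfolding local_error_def by (simp add: sum_distrib_left power2_eq_square abs_mult_self_eq flip: mult.assoc)
  also have "\<dots> \<le> 2 * t\<^sup>2 * local_error"
    using local_error_nonneg by (simp add: algebra_simps)
  finally show ?thesis .
qed

text \<open>The function \<open>\<psi>(t) = \<phi>(t) exp(t^2/2)\<close> has \<open>\<psi>(0) = 1\<close> and, by the approximate differential
equation, a small derivative; the mean value inequality on \<open>[-\<bar>t\<bar>, \<bar>t\<bar>]\<close> bounds \<open>\<psi> - 1\<close>.\<close>

theorem char_local_dependence_bound:
  "cmod (ex (\<lambda>w. iexp (t * W w)) - complex_of_real (exp (- (t\<^sup>2 / 2)))) \<le> 2 * local_error * \<bar>t\<bar> ^ 3"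
proof -
  let ?ph = "\<lambda>t::real. ex (\<lambda>w. iexp (t * W w))"
  let ?dph = "\<lambda>t::real. \<i> * (\<Sum>j\<in>J. ex (\<lambda>w. X j w * iexp (t * W w)))"
  let ?psi = "\<lambda>t::real. ?ph t * complex_of_real (exp (t\<^sup>2 / 2))"
  have ph_sum: "?ph = (\<lambda>t. \<Sum>w\<in>set_pmf M. pmf M w *\<^sub>R iexp (t * W w))"
    by (intro ext integral_measure_pmf[OF finite_support])
  have dph_sum: "?dph t = (\<Sum>w\<in>set_pmf M. pmf M w *\<^sub>R (W w *\<^sub>R (\<i> * iexp (t * W w))))" for t
  proof -
    have "?dph t = ex (\<lambda>w. \<i> * (\<Sum>j\<in>J. X j w * iexp (t * W w)))"
      by (simp add: Bochner_Integration.integral_sum)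
    also have "\<dots> = ex (\<lambda>w. W w *\<^sub>R (\<i> * iexp (t * W w)))"
      by (intro arg_cong[where f=ex] ext)
         (simp add: W_def scaleR_conv_of_real sum_distrib_right mult_ac flip: sum_distrib_left)
    also have "\<dots> = (\<Sum>w\<in>set_pmf M. pmf M w *\<^sub>R (W w *\<^sub>R (\<i> * iexp (t * W w))))"
      by (intro integral_measure_pmf[OF finite_support])
    finally show ?thesis .
  qed
  have ph_deriv: "(?ph has_vector_derivative ?dph t) (at t within S)" for t S
  proof -
    have "((\<lambda>t. iexp (t * c)) has_vector_derivative c *\<^sub>R (\<i> * iexp (t * c))) (at t within S)" for c
    proof -
      have "((\<lambda>t. t * c) has_vector_derivative c) (at t within S)"
        by (auto intro!: derivative_eq_intros)
      moreover have "(iexp has_vector_derivative \<i> * iexp (t * c)) (at (t * c) within (\<lambda>t. t * c) ` S)"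
        by (rule has_vector_derivative_iexp)
      ultimately show ?thesis
        using vector_diff_chain_within[of "\<lambda>t. t * c" c t S iexp] by (simp add: o_def)
    qed
    then show ?thesis unfolding ph_sum dph_sum
      by (intro has_vector_derivative_sum has_vector_derivative_scaleR[OF DERIV_const, simplified])
         auto
  qed
  have psi_deriv: "(?psi has_vector_derivative ((?dph t + t * ?ph t) * complex_of_real (exp (t\<^sup>2 / 2)))) (at t within S)" for t S
  proof -
    have "((\<lambda>t. complex_of_real (exp (t\<^sup>2 / 2))) has_vector_derivative complex_of_real (t * exp (t\<^sup>2 / 2))) (at t within S)"
      by (intro has_vector_derivative_of_real) (auto intro!: derivative_eq_intros simp: has_real_derivative_iff_has_vector_derivative[symmetric])
    from has_vector_derivative_mult[OF ph_deriv[of t S] this] show ?thesis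
      by (simp add: algebra_simps)
  qed
  \<comment> \<open>the derivative bound increases with \<open>\<bar>s\<bar>\<close>, so its value at \<open>T\<close> serves for the whole interval\<close>
  define T where "T = \<bar>t\<bar>"
  have bound: "cmod (?psi t - ?psi 0) \<le> (2 * T\<^sup>2 * local_error * exp (T\<^sup>2 / 2)) * cmod (complex_of_real (t - 0))"
  proof -
    have "norm (?psi t - ?psi 0) \<le> (2 * T\<^sup>2 * local_error * exp (T\<^sup>2 / 2)) * norm (t - 0)"
    proof (rule differentiable_bound[where S="{-T..T}" and f'="\<lambda>s x. x *\<^sub>R ((?dph s + s * ?ph s) * complex_of_real (exp (s\<^sup>2 / 2)))"])
      fix s assume s: "s \<in> {-T..T}"
      show "(?psi has_derivative (\<lambda>x. x *\<^sub>R ((?dph s + s * ?ph s) * complex_of_real (exp (s\<^sup>2 / 2))))) (at s within {-T..T})"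
        using psi_deriv[of s "{-T..T}"] by (simp add: has_vector_derivative_def)
      have sT: "s\<^sup>2 \<le> T\<^sup>2" using s T_def by (intro abs_le_square_iff[THEN iffD1]) auto
      have "cmod ((?dph s + s * ?ph s) * complex_of_real (exp (s\<^sup>2 / 2))) \<le> (2 * s\<^sup>2 * local_error) * exp (s\<^sup>2 / 2)"
        unfolding norm_mult norm_of_real abs_exp_cancel
        by (intro mult_right_mono almost_gaussian_ode) auto
      also have "\<dots> \<le> 2 * T\<^sup>2 * local_error * exp (T\<^sup>2 / 2)"
        using sT local_error_nonneg by (intro mult_mono) auto
      finally have le: "cmod ((?dph s + s * ?ph s) * complex_of_real (exp (s\<^sup>2 / 2))) \<le> 2 * T\<^sup>2 * local_error * exp (T\<^sup>2 / 2)" .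
      show "onorm (\<lambda>x. x *\<^sub>R ((?dph s + s * ?ph s) * complex_of_real (exp (s\<^sup>2 / 2)))) \<le> 2 * T\<^sup>2 * local_error * exp (T\<^sup>2 / 2)"
        using mult_right_mono[OF le abs_ge_zero] by (intro onorm_le) (simp only: norm_scaleR real_norm_def mult.commute)
    qed (auto simp: T_def)
    then show ?thesis by simp
  qed
  have "cmod (?ph t - complex_of_real (exp (- (t\<^sup>2 / 2)))) = cmod (complex_of_real (exp (- (t\<^sup>2/2))) * (?psi t - ?psi 0))"
  proof -
    have "complex_of_real (exp (- (t\<^sup>2/2))) * complex_of_real (exp (t\<^sup>2/2)) = 1"
      by (simp add: exp_minus del: of_real_exp flip: of_real_mult)
    moreover have "c * (a * b - 1) = a - c" if "c * b = 1" for a b c :: complex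
    proof -
      have "c * (a * b - 1) = a * (c * b) - c" by (simp add: algebra_simps)
      with that show ?thesis by simp
    qed
    moreover have "?psi 0 = 1" by simp
    ultimately have "complex_of_real (exp (- (t\<^sup>2/2))) * (?psi t - ?psi 0) = ?ph t - complex_of_real (exp (- (t\<^sup>2/2)))"
      by (simp only:)
    then show ?thesis by simp
  qed
  also have "\<dots> = exp (- (t\<^sup>2/2)) * cmod (?psi t - ?psi 0)"
    by (simp only: norm_mult norm_of_real abs_exp_cancel)
  also have "\<dots> \<le> exp (- (t\<^sup>2/2)) * ((2 * T\<^sup>2 * local_error * exp (T\<^sup>2 / 2)) * \<bar>t\<bar>)"
    using bound by (intro mult_left_mono) auto
  also have "\<dots> = 2 * local_error * \<bar>t\<bar> ^ 3"
    by (simp add: T_def exp_minus field_simps power2_eq_square power3_eq_cube)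
  finally show ?thesis .
qed

end

section \<open>Joint cumulants of products of independent coins\<close>

lemma power_one_minus_le:
  fixes q :: real assumes "0 \<le> q" "q \<le> 1"
  shows "(1 - q) ^ s \<le> 1 - real s * q + (real s)\<^sup>2 * q\<^sup>2"
proof (induction s)
  case (Suc s)
  have "(1 - q) ^ Suc s \<le> (1 - real s * q + (real s)\<^sup>2 * q\<^sup>2) * (1 - q)"
    using Suc assms by (simp add: mult.commute mult_left_mono)
  also have "\<dots> = 1 - (real s + 1) * q + ((real s)\<^sup>2 + s) * q\<^sup>2 - (real s)\<^sup>2 * q ^ 3"
    by (simp add: algebra_simps power2_eq_square power3_eq_cube)
  also have "\<dots> \<le> 1 - (real s + 1) * q + (real (Suc s))\<^sup>2 * q\<^sup>2"
  proof -
    have "(real s)\<^sup>2 + s \<le> (real (Suc s))\<^sup>2" by (simp add: power2_eq_square algebra_simps)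
    then have "((real s)\<^sup>2 + s) * q\<^sup>2 \<le> (real (Suc s))\<^sup>2 * q\<^sup>2" by (rule mult_right_mono) simp
    moreover have "0 \<le> (real s)\<^sup>2 * q ^ 3" using assms by simp
    ultimately show ?thesis by linarith
  qed
  finally show ?case by (simp add: add.commute)
qed simp

lemma power_one_minus_taylor:
  fixes q :: real and N :: nat assumes "0 \<le> q" "q \<le> 1" "s \<le> N"
  shows "\<bar>(1 - q) ^ s - (1 - s * q)\<bar> \<le> (real N)\<^sup>2 * q\<^sup>2"
proof -
  have "1 - s * q \<le> (1 - q) ^ s"
    using Bernoulli_inequality[of "-q" s] assms by simp
  moreover have "(real s)\<^sup>2 * q\<^sup>2 \<le> (real N)\<^sup>2 * q\<^sup>2"
    using assms by (intro mult_right_mono power_mono) auto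
  ultimately show ?thesis using power_one_minus_le[OF assms(1,2), of s] by linarith
qed

lemma power_diff_bound:
  fixes p :: real and N :: nat assumes "0 \<le> p" "p \<le> 1" "u \<le> s" "s \<le> N"
  shows "\<bar>p ^ s - p ^ u\<bar> \<le> real N * (1 - p) * p ^ u"
proof -
  have "p ^ u - p ^ s = p ^ u * (1 - p ^ (s - u))"
    using assms by (simp add: algebra_simps flip: power_add)
  also have "\<dots> \<le> p ^ u * (real (s - u) * (1 - p))"
    using Bernoulli_inequality[of "p - 1" "s - u"] assms by (intro mult_left_mono) (simp_all add: algebra_simps)
  also have "\<dots> \<le> p ^ u * (real N * (1 - p))"
    using assms by (intro mult_left_mono mult_right_mono) auto
  finally show ?thesis
    using power_decreasing[OF assms(3), of p] assms(1,2) by (simp add: mult_ac)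
qed

text \<open>The probability that all coins in \<open>A\<close> show heads, for independent coins of bias \<open>p\<close>.\<close>

definition pw :: "real \<Rightarrow> 'b set \<Rightarrow> real" where "pw p A = p ^ card A"

text \<open>The joint cumulant of the three indicators that all coins in \<open>A\<close>, in \<open>B\<close>, in \<open>C\<close> show heads: a sum over set
partitions, in which a partition into \<open>k\<close> blocks has the coefficient \<open>(-1)^(k-1) (k-1)!\<close>.\<close>

definition kappa3 :: "real \<Rightarrow> 'b set \<Rightarrow> 'b set \<Rightarrow> 'b set \<Rightarrow> real" where
  "kappa3 p A B C = pw p (A \<union> B \<union> C)
     - pw p (A \<union> B) * pw p C - pw p (A \<union> C) * pw p B - pw p (B \<union> C) * pw p A
     + 2 * (pw p A * pw p B * pw p C)"

definition kappa4 :: "real \<Rightarrow> 'b set \<Rightarrow> 'b set \<Rightarrow> 'b set \<Rightarrow> 'b set \<Rightarrow> real" where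
  "kappa4 p A B C D = pw p (A \<union> B \<union> C \<union> D)
     - pw p (A \<union> B \<union> C) * pw p D - pw p (A \<union> B \<union> D) * pw p C
     - pw p (A \<union> C \<union> D) * pw p B - pw p (B \<union> C \<union> D) * pw p A
     - pw p (A \<union> B) * pw p (C \<union> D) - pw p (A \<union> C) * pw p (B \<union> D) - pw p (A \<union> D) * pw p (B \<union> C)
     + 2 * (pw p (A \<union> B) * pw p C * pw p D + pw p (A \<union> C) * pw p B * pw p D + pw p (A \<union> D) * pw p B * pw p C
          + pw p (B \<union> C) * pw p A * pw p D + pw p (B \<union> D) * pw p A * pw p C + pw p (C \<union> D) * pw p A * pw p B)
     - 6 * (pw p A * pw p B * pw p C * pw p D)"

text \<open>The indicators cannot be divided into two groups that use disjoint sets of coins.\<close>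

definition linked3 :: "'b set \<Rightarrow> 'b set \<Rightarrow> 'b set \<Rightarrow> bool" where
  "linked3 A B C \<longleftrightarrow> A \<inter> (B \<union> C) \<noteq> {} \<and> B \<inter> (A \<union> C) \<noteq> {} \<and> C \<inter> (A \<union> B) \<noteq> {}"

definition linked4 :: "'b set \<Rightarrow> 'b set \<Rightarrow> 'b set \<Rightarrow> 'b set \<Rightarrow> bool" where
  "linked4 A B C D \<longleftrightarrow>
     A \<inter> (B \<union> C \<union> D) \<noteq> {} \<and> B \<inter> (A \<union> C \<union> D) \<noteq> {} \<and> C \<inter> (A \<union> B \<union> D) \<noteq> {} \<and> D \<inter> (A \<union> B \<union> C) \<noteq> {} \<and>
     (A \<union> B) \<inter> (C \<union> D) \<noteq> {} \<and> (A \<union> C) \<inter> (B \<union> D) \<noteq> {} \<and> (A \<union> D) \<inter> (B \<union> C) \<noteq> {}"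

lemma pw_disjoint: "finite A \<Longrightarrow> finite B \<Longrightarrow> A \<inter> B = {} \<Longrightarrow> pw p (A \<union> B) = pw p A * pw p B"
  by (simp add: pw_def card_Un_disjoint power_add)

lemma kappa3_isolated:
  assumes "finite A" "finite B" "finite C" "C \<inter> (A \<union> B) = {}"
  shows "kappa3 p A B C = 0"
proof -
  have "A \<inter> C = {}" "B \<inter> C = {}" "(A \<union> B) \<inter> C = {}" using assms by auto
  then have "pw p (A \<union> B \<union> C) = pw p (A \<union> B) * pw p C" "pw p (A \<union> C) = pw p A * pw p C"
    "pw p (B \<union> C) = pw p B * pw p C" using assms by (simp_all only: pw_disjoint finite_Un)
  then show ?thesis by (simp add: kappa3_def algebra_simps)
qed

lemma kappa3_not_linked:
  assumes fin: "finite A" "finite B" "finite C" and "\<not> linked3 A B C"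
  shows "kappa3 p A B C = 0"
proof -
  have "kappa3 p A B C = kappa3 p B C A" "kappa3 p A B C = kappa3 p A C B"
    by (simp_all add: kappa3_def Un_ac mult_ac)
  then show ?thesis
    using assms kappa3_isolated[of A B C p] kappa3_isolated[of B C A p] kappa3_isolated[of A C B p]
    unfolding linked3_def by auto
qed

lemma kappa4_isolated:
  assumes "finite A" "finite B" "finite C" "finite D" "D \<inter> (A \<union> B \<union> C) = {}"
  shows "kappa4 p A B C D = 0"
proof -
  have "A \<inter> D = {}" "B \<inter> D = {}" "C \<inter> D = {}" "(A \<union> B) \<inter> D = {}" "(A \<union> C) \<inter> D = {}" "(B \<union> C) \<inter> D = {}"
    "(A \<union> B \<union> C) \<inter> D = {}" using assms by auto
  then have "pw p (A \<union> B \<union> C \<union> D) = pw p (A \<union> B \<union> C) * pw p D"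
    "pw p (A \<union> B \<union> D) = pw p (A \<union> B) * pw p D" "pw p (A \<union> C \<union> D) = pw p (A \<union> C) * pw p D"
    "pw p (B \<union> C \<union> D) = pw p (B \<union> C) * pw p D" "pw p (A \<union> D) = pw p A * pw p D"
    "pw p (B \<union> D) = pw p B * pw p D" "pw p (C \<union> D) = pw p C * pw p D"
    using assms by (simp_all only: pw_disjoint finite_Un)
  then show ?thesis by (simp add: kappa4_def algebra_simps)
qed

lemma kappa4_pairs:
  assumes "finite A" "finite B" "finite C" "finite D" "(A \<union> B) \<inter> (C \<union> D) = {}"
  shows "kappa4 p A B C D = 0"
proof -
  have "A \<inter> C = {}" "A \<inter> D = {}" "B \<inter> C = {}" "B \<inter> D = {}" "(A \<union> B) \<inter> C = {}" "(A \<union> B) \<inter> D = {}"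
    "A \<inter> (C \<union> D) = {}" "B \<inter> (C \<union> D) = {}" using assms by auto
  then have "pw p ((A \<union> B) \<union> (C \<union> D)) = pw p (A \<union> B) * pw p (C \<union> D)"
    "pw p (A \<union> B \<union> C) = pw p (A \<union> B) * pw p C" "pw p (A \<union> B \<union> D) = pw p (A \<union> B) * pw p D"
    "pw p (A \<union> (C \<union> D)) = pw p A * pw p (C \<union> D)" "pw p (B \<union> (C \<union> D)) = pw p B * pw p (C \<union> D)"
    "pw p (A \<union> C) = pw p A * pw p C" "pw p (A \<union> D) = pw p A * pw p D"
    "pw p (B \<union> C) = pw p B * pw p C" "pw p (B \<union> D) = pw p B * pw p D"
    using assms by (simp_all only: pw_disjoint finite_Un)
  then show ?thesis by (simp add: kappa4_def algebra_simps Un_assoc)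
qed

text \<open>Joint cumulants vanish as soon as the variables split into two independent groups; the possible splits are one
set against three and two against two.\<close>

lemma kappa4_not_linked:
  assumes fin: "finite A" "finite B" "finite C" "finite D" and "\<not> linked4 A B C D"
  shows "kappa4 p A B C D = 0"
proof -
  have "kappa4 p A B C D = kappa4 p B C D A" "kappa4 p A B C D = kappa4 p A C D B" "kappa4 p A B C D = kappa4 p A B D C"
    "kappa4 p A B C D = kappa4 p A C B D" "kappa4 p A B C D = kappa4 p A D B C"
    by (simp_all add: kappa4_def Un_ac mult_ac)
  then show ?thesis
    using assms kappa4_isolated[of A B C D p] kappa4_isolated[of B C D A p] kappa4_isolated[of A C D B p]
      kappa4_isolated[of A B D C p] kappa4_pairs[of A B C D p] kappa4_pairs[of A C B D p] kappa4_pairs[of A D B C p]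
    unfolding linked4_def by (auto simp: Un_commute)
qed

lemma pw_mult: "pw p A * pw p B = p ^ (card A + card B)"
  by (simp add: pw_def power_add)

lemma card_Un_less:
  assumes "finite A" "finite B" "A \<inter> B \<noteq> {}" shows "card (A \<union> B) < card A + card B"
proof -
  have "card (A \<inter> B) > 0" using assms by (simp add: card_gt_0_iff)
  then show ?thesis using card_Un_Int[OF assms(1,2)] by linarith
qed

lemma pw_pos: "0 < p \<Longrightarrow> pw p A > 0" by (simp add: pw_def)
lemma pw_le_1: "0 < p \<Longrightarrow> p < 1 \<Longrightarrow> pw p A \<le> 1" by (simp add: pw_def power_le_one)

lemma pw_Un_le_mult:
  assumes "0 < p" "p < 1" shows "pw p A * pw p B \<le> pw p (A \<union> B)"
  unfolding pw_mult unfolding pw_def using assms card_Un_le by (intro power_decreasing) auto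

lemma pw_split_le:
  assumes "0 < p" "p < 1" "finite A" "finite B" "A \<inter> B \<noteq> {}"
  shows "pw p A * pw p B \<le> p * pw p (A \<union> B)"
  unfolding pw_mult unfolding pw_def power_Suc[symmetric]
  using assms card_Un_less[of A B] by (intro power_decreasing) auto

lemma kappa3_ge_small_p:
  assumes p: "0 < p" "p < 1" and fin: "finite A" "finite B" "finite C" and l: "linked3 A B C"
  shows "kappa3 p A B C \<ge> pw p (A \<union> B \<union> C) * (1 - 3 * p)"
proof -
  let ?U = "A \<union> B \<union> C"
  have U: "A \<union> C \<union> B = ?U" "B \<union> C \<union> A = ?U" by auto
  have "pw p (A \<union> B) * pw p C \<le> p * pw p ?U" "pw p (A \<union> C) * pw p B \<le> p * pw p ?U"
    "pw p (B \<union> C) * pw p A \<le> p * pw p ?U"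
    using pw_split_le[OF p, of "A \<union> B" C] pw_split_le[OF p, of "A \<union> C" B] pw_split_le[OF p, of "B \<union> C" A] l fin
    by (auto simp only: U linked3_def Int_commute finite_Un)
  moreover have "0 \<le> pw p A * pw p B * pw p C" using p by (simp add: pw_def)
  ultimately have "kappa3 p A B C \<ge> pw p ?U - 3 * (p * pw p ?U)"
    unfolding kappa3_def by linarith
  then show ?thesis by (simp add: algebra_simps)
qed

text \<open>Every term but the first belongs to a proper partition. As the sets are linked, splitting their union repeats
at least one coin and costs a factor \<open>p\<close>. The constant is \<open>13 = 4 + 3 + 6\<close>, the sum of the absolute
values of the negative coefficients.\<close>

lemma kappa4_ge_small_p:
  assumes p: "0 < p" "p < 1" and fin: "finite A" "finite B" "finite C" "finite D" and l: "linked4 A B C D"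
  shows "kappa4 p A B C D \<ge> pw p (A \<union> B \<union> C \<union> D) * (1 - 13 * p)"
proof -
  let ?U = "A \<union> B \<union> C \<union> D"
  let ?b = "p * pw p ?U"
  have U: "A \<union> B \<union> D \<union> C = ?U" "A \<union> C \<union> D \<union> B = ?U" "B \<union> C \<union> D \<union> A = ?U"
    "(A \<union> B) \<union> (C \<union> D) = ?U" "(A \<union> C) \<union> (B \<union> D) = ?U" "(A \<union> D) \<union> (B \<union> C) = ?U" by auto
  have 1: "pw p (A \<union> B \<union> C) * pw p D \<le> ?b" "pw p (A \<union> B \<union> D) * pw p C \<le> ?b"
    "pw p (A \<union> C \<union> D) * pw p B \<le> ?b" "pw p (B \<union> C \<union> D) * pw p A \<le> ?b"
    "pw p (A \<union> B) * pw p (C \<union> D) \<le> ?b" "pw p (A \<union> C) * pw p (B \<union> D) \<le> ?b" "pw p (A \<union> D) * pw p (B \<union> C) \<le> ?b"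
    using pw_split_le[OF p, of "A \<union> B \<union> C" D] pw_split_le[OF p, of "A \<union> B \<union> D" C] 
      pw_split_le[OF p, of "A \<union> C \<union> D" B] pw_split_le[OF p, of "B \<union> C \<union> D" A] 
      pw_split_le[OF p, of "A \<union> B" "C \<union> D"] pw_split_le[OF p, of "A \<union> C" "B \<union> D"] pw_split_le[OF p, of "A \<union> D" "B \<union> C"] l fin
    by (simp_all only: U linked4_def Int_commute finite_Un HOL.simp_thms)
  have "pw p A * pw p B * pw p C * pw p D \<le> pw p (A \<union> B) * pw p C * pw p D"
    using pw_Un_le_mult[OF p, of A B] p by (intro mult_right_mono) (auto simp: pw_def)
  also have "\<dots> \<le> pw p (A \<union> B \<union> C) * pw p D"
    using pw_Un_le_mult[OF p, of "A \<union> B" C] p by (intro mult_right_mono) (auto simp: pw_def)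
  finally have 2: "pw p A * pw p B * pw p C * pw p D \<le> ?b" using 1(1) by linarith
  have 3: "0 \<le> pw p (A \<union> B) * pw p C * pw p D + pw p (A \<union> C) * pw p B * pw p D + pw p (A \<union> D) * pw p B * pw p C
          + pw p (B \<union> C) * pw p A * pw p D + pw p (B \<union> D) * pw p A * pw p C + pw p (C \<union> D) * pw p A * pw p B"
    using p by (intro add_nonneg_nonneg) (auto simp: pw_def)
  have "kappa4 p A B C D \<ge> pw p ?U - 13 * ?b"
    unfolding kappa4_def distrib_left using 1 2 3 by linarith
  then show ?thesis by (simp add: algebra_simps)
qed

lemma card_Un3_le: "card (A \<union> B \<union> C) \<le> card A + card B + card C"
  using card_Un_le[of "A \<union> B" C] card_Un_le[of A B] by linarith

lemma card_Un4_le: "card (A \<union> B \<union> C \<union> D) \<le> card A + card B + card C + card D"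
  using card_Un_le[of "A \<union> B \<union> C" D] card_Un3_le[of A B C] by linarith

text \<open>The coefficients of all partitions add up to 0, so that \<open>p^(card (A \<union> B \<union> C \<union> D))\<close> may be subtracted from every
power; the difference of two powers provides the factor \<open>1 - p\<close>. The absolute values of the
coefficients of the proper partitions add up to 25.\<close>

lemma abs_kappa4_le:
  fixes p :: real and N :: nat
  assumes p: "0 < p" "p < 1" and N: "card A + card B + card C + card D \<le> N"
  shows "\<bar>kappa4 p A B C D\<bar> \<le> 25 * real N * (1 - p) * pw p (A \<union> B \<union> C \<union> D)"
proof -
  let ?U = "A \<union> B \<union> C \<union> D"
  define u where "u = p ^ card ?U"
  define b where "b = real N * (1 - p) * u"
  have key: "\<bar>p ^ s - u\<bar> \<le> b" if "card ?U \<le> s" "s \<le> N" for s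
    using power_diff_bound[of p "card ?U" s N] p that by (simp add: u_def b_def)
  have U: "A \<union> B \<union> D \<union> C = ?U" "A \<union> C \<union> D \<union> B = ?U" "B \<union> C \<union> D \<union> A = ?U"
    "(A \<union> B) \<union> (C \<union> D) = ?U" "(A \<union> C) \<union> (B \<union> D) = ?U" "(A \<union> D) \<union> (B \<union> C) = ?U" by auto
  note c2 = card_Un_le[of A B] card_Un_le[of A C] card_Un_le[of A D] card_Un_le[of B C] card_Un_le[of B D] card_Un_le[of C D]
  note c3 = card_Un3_le[of A B C] card_Un3_le[of A B D] card_Un3_le[of A C D] card_Un3_le[of B C D]
  note s3 = card_Un_le[of "A \<union> B \<union> C" D] card_Un_le[of "A \<union> B \<union> D" C, unfolded U]
    card_Un_le[of "A \<union> C \<union> D" B, unfolded U] card_Un_le[of "B \<union> C \<union> D" A, unfolded U]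
  note s2 = card_Un_le[of "A \<union> B" "C \<union> D", unfolded U] card_Un_le[of "A \<union> C" "B \<union> D", unfolded U] card_Un_le[of "A \<union> D" "B \<union> C", unfolded U]
  have k: "\<bar>pw p (A \<union> B \<union> C) * pw p D - u\<bar> \<le> b" "\<bar>pw p (A \<union> B \<union> D) * pw p C - u\<bar> \<le> b"
    "\<bar>pw p (A \<union> C \<union> D) * pw p B - u\<bar> \<le> b" "\<bar>pw p (B \<union> C \<union> D) * pw p A - u\<bar> \<le> b"
    "\<bar>pw p (A \<union> B) * pw p (C \<union> D) - u\<bar> \<le> b" "\<bar>pw p (A \<union> C) * pw p (B \<union> D) - u\<bar> \<le> b" "\<bar>pw p (A \<union> D) * pw p (B \<union> C) - u\<bar> \<le> b"
    "\<bar>pw p (A \<union> B) * pw p C * pw p D - u\<bar> \<le> b" "\<bar>pw p (A \<union> C) * pw p B * pw p D - u\<bar> \<le> b"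
    "\<bar>pw p (A \<union> D) * pw p B * pw p C - u\<bar> \<le> b" "\<bar>pw p (B \<union> C) * pw p A * pw p D - u\<bar> \<le> b"
    "\<bar>pw p (B \<union> D) * pw p A * pw p C - u\<bar> \<le> b" "\<bar>pw p (C \<union> D) * pw p A * pw p B - u\<bar> \<le> b"
    "\<bar>pw p A * pw p B * pw p C * pw p D - u\<bar> \<le> b"
    unfolding pw_def power_add[symmetric]
  proof -
  qed (rule key; use N c2 c3 s3 s2 in linarith)+
  note two_sided = k[unfolded abs_diff_le_iff, THEN conjunct1] k[unfolded abs_diff_le_iff, THEN conjunct2]
  have "pw p ?U = u" by (simp add: pw_def u_def)
  then have "\<bar>kappa4 p A B C D\<bar> \<le> 25 * b"
    unfolding kappa4_def distrib_left by (intro abs_leI; use two_sided in linarith)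
  then show ?thesis by (simp add: b_def u_def pw_def)
qed

lemma incl_excl3:
  assumes "finite A" "finite B" "finite C"
  shows "real (card (A \<inter> B \<inter> C)) =
      real (card (A \<union> B \<union> C)) - real (card (A \<union> B)) - real (card (A \<union> C)) - real (card (B \<union> C))
      + real (card A) + real (card B) + real (card C)"
proof -
  have 1: "(A \<union> B) \<inter> C = (A \<inter> C) \<union> (B \<inter> C)" "(A \<inter> C) \<inter> (B \<inter> C) = A \<inter> B \<inter> C" by auto
  have 2: "card A + card C = card (A \<union> C) + card (A \<inter> C)" "card B + card C = card (B \<union> C) + card (B \<inter> C)"
    "card (A \<union> B) + card C = card (A \<union> B \<union> C) + card ((A \<union> B) \<inter> C)"
    "card (A \<inter> C) + card (B \<inter> C) = card ((A \<union> B) \<inter> C) + card (A \<inter> B \<inter> C)"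
    using card_Un_Int[of A C] card_Un_Int[of B C] card_Un_Int[of "A \<union> B" C] card_Un_Int[of "A \<inter> C" "B \<inter> C"] assms
    unfolding 1 by simp_all
  show ?thesis using 2[THEN arg_cong[of _ _ real]] by (simp only: of_nat_add)
qed

lemma incl_excl4:
  assumes "finite A" "finite B" "finite C" "finite D"
  shows "real (card (A \<inter> B \<inter> C \<inter> D)) =
      - real (card (A \<union> B \<union> C \<union> D)) + real (card (A \<union> B \<union> C)) + real (card (A \<union> B \<union> D))
      + real (card (A \<union> C \<union> D)) + real (card (B \<union> C \<union> D))
      - real (card (A \<union> B)) - real (card (A \<union> C)) - real (card (A \<union> D)) - real (card (B \<union> C))
      - real (card (B \<union> D)) - real (card (C \<union> D))
      + real (card A) + real (card B) + real (card C) + real (card D)"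
proof -
  have 1: "real (card (A \<inter> B \<inter> C)) + real (card D) = real (card ((A \<inter> B \<inter> C) \<union> D)) + real (card (A \<inter> B \<inter> C \<inter> D))"
    using card_Un_Int[of "A \<inter> B \<inter> C" D] assms by (simp flip: of_nat_add)
  have 2: "(A \<inter> B \<inter> C) \<union> D = (A \<union> D) \<inter> (B \<union> D) \<inter> (C \<union> D)" by auto
  have 3: "(A \<union> D) \<union> (B \<union> D) \<union> (C \<union> D) = A \<union> B \<union> C \<union> D" "(A \<union> D) \<union> (B \<union> D) = A \<union> B \<union> D"
    "A \<union> B \<union> D \<union> (C \<union> D) = A \<union> B \<union> C \<union> D"
    "(A \<union> D) \<union> (C \<union> D) = A \<union> C \<union> D" "(B \<union> D) \<union> (C \<union> D) = B \<union> C \<union> D" by auto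
  show ?thesis
    using 1 incl_excl3[OF assms(1-3)] incl_excl3[of "A \<union> D" "B \<union> D" "C \<union> D"] assms unfolding 2 3 by simp
qed

text \<open>After replacing every power \<open>p^s\<close> by \<open>1 - s (1 - p)\<close> the constant terms cancel, and the terms of first order
form an inclusion-exclusion sum, which leaves the common coins. The constant 6 is the sum of the absolute
values of all coefficients, and the error of each replacement is at most \<open>N^2 (1 - p)^2\<close>.\<close>

lemma kappa3_near_1:
  fixes p :: real and N :: nat
  assumes p: "0 < p" "p < 1" and fin: "finite A" "finite B" "finite C" and N: "card A + card B + card C \<le> N"
  shows "\<bar>kappa3 p A B C + (1 - p) * real (card (A \<inter> B \<inter> C))\<bar> \<le> 6 * (real N)\<^sup>2 * (1 - p)\<^sup>2"
proof -
  define b where "b = (real N)\<^sup>2 * (1 - p)\<^sup>2"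
  define t where "t s = 1 - real s * (1 - p)" for s
  have key: "\<bar>p ^ s - t s\<bar> \<le> b" if "s \<le> N" for s
    using power_one_minus_taylor[of "1 - p" s N] p that by (simp add: b_def t_def)
  note c = card_Un_le[of A B] card_Un_le[of A C] card_Un_le[of B C] card_Un3_le[of A B C]
  have k: "\<bar>pw p (A \<union> B \<union> C) - t (card (A \<union> B \<union> C))\<bar> \<le> b"
    "\<bar>pw p (A \<union> B) * pw p C - t (card (A \<union> B) + card C)\<bar> \<le> b"
    "\<bar>pw p (A \<union> C) * pw p B - t (card (A \<union> C) + card B)\<bar> \<le> b"
    "\<bar>pw p (B \<union> C) * pw p A - t (card (B \<union> C) + card A)\<bar> \<le> b"
    "\<bar>pw p A * pw p B * pw p C - t (card A + card B + card C)\<bar> \<le> b"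
    unfolding pw_def power_add[symmetric]
  proof -
  qed (rule key; use N c in linarith)+
  note two_sided = k[unfolded abs_diff_le_iff, THEN conjunct1] k[unfolded abs_diff_le_iff, THEN conjunct2]
  have eq: "(1 - p) * real (card (A \<inter> B \<inter> C)) = - t (card (A \<union> B \<union> C))
     + t (card (A \<union> B) + card C) + t (card (A \<union> C) + card B)
     + t (card (B \<union> C) + card A) - 2 * t (card A + card B + card C)"
    unfolding incl_excl3[OF fin] t_def by (simp add: algebra_simps)
  have "\<bar>kappa3 p A B C + (1 - p) * real (card (A \<inter> B \<inter> C))\<bar> \<le> 6 * b"
    unfolding kappa3_def eq by (rule abs_leI; use two_sided in linarith)
  then show ?thesis by (simp add: b_def)
qed

text \<open>As for three sets, except that the common coins now enter with a positive sign and that the absolute values of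
the coefficients add up to 26.\<close>

lemma kappa4_near_1:
  fixes p :: real and N :: nat
  assumes p: "0 < p" "p < 1" and fin: "finite A" "finite B" "finite C" "finite D"
    and N: "card A + card B + card C + card D \<le> N"
  shows "\<bar>kappa4 p A B C D - (1 - p) * real (card (A \<inter> B \<inter> C \<inter> D))\<bar> \<le> 26 * (real N)\<^sup>2 * (1 - p)\<^sup>2"
proof -
  define b where "b = (real N)\<^sup>2 * (1 - p)\<^sup>2"
  define t where "t s = 1 - real s * (1 - p)" for s
  have key: "\<bar>p ^ s - t s\<bar> \<le> b" if "s \<le> N" for s
    using power_one_minus_taylor[of "1 - p" s N] p that by (simp add: b_def t_def)
  note c2 = card_Un_le[of A B] card_Un_le[of A C] card_Un_le[of A D] card_Un_le[of B C] card_Un_le[of B D] card_Un_le[of C D]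
  note c3 = card_Un3_le[of A B C] card_Un3_le[of A B D] card_Un3_le[of A C D] card_Un3_le[of B C D] card_Un4_le[of A B C D]
  have k: "\<bar>pw p (A \<union> B \<union> C \<union> D) - t (card (A \<union> B \<union> C \<union> D))\<bar> \<le> b"
    "\<bar>pw p (A \<union> B \<union> C) * pw p D - t (card (A \<union> B \<union> C) + card D)\<bar> \<le> b"
    "\<bar>pw p (A \<union> B \<union> D) * pw p C - t (card (A \<union> B \<union> D) + card C)\<bar> \<le> b"
    "\<bar>pw p (A \<union> C \<union> D) * pw p B - t (card (A \<union> C \<union> D) + card B)\<bar> \<le> b"
    "\<bar>pw p (B \<union> C \<union> D) * pw p A - t (card (B \<union> C \<union> D) + card A)\<bar> \<le> b"
    "\<bar>pw p (A \<union> B) * pw p (C \<union> D) - t (card (A \<union> B) + card (C \<union> D))\<bar> \<le> b"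
    "\<bar>pw p (A \<union> C) * pw p (B \<union> D) - t (card (A \<union> C) + card (B \<union> D))\<bar> \<le> b"
    "\<bar>pw p (A \<union> D) * pw p (B \<union> C) - t (card (A \<union> D) + card (B \<union> C))\<bar> \<le> b"
    "\<bar>pw p (A \<union> B) * pw p C * pw p D - t (card (A \<union> B) + card C + card D)\<bar> \<le> b"
    "\<bar>pw p (A \<union> C) * pw p B * pw p D - t (card (A \<union> C) + card B + card D)\<bar> \<le> b"
    "\<bar>pw p (A \<union> D) * pw p B * pw p C - t (card (A \<union> D) + card B + card C)\<bar> \<le> b"
    "\<bar>pw p (B \<union> C) * pw p A * pw p D - t (card (B \<union> C) + card A + card D)\<bar> \<le> b"
    "\<bar>pw p (B \<union> D) * pw p A * pw p C - t (card (B \<union> D) + card A + card C)\<bar> \<le> b"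
    "\<bar>pw p (C \<union> D) * pw p A * pw p B - t (card (C \<union> D) + card A + card B)\<bar> \<le> b"
    "\<bar>pw p A * pw p B * pw p C * pw p D - t (card A + card B + card C + card D)\<bar> \<le> b"
    unfolding pw_def power_add[symmetric]
  proof -
  qed (rule key; use N c2 c3 in linarith)+
  note two_sided = k[unfolded abs_diff_le_iff, THEN conjunct1] k[unfolded abs_diff_le_iff, THEN conjunct2]
  have eq: "(1 - p) * real (card (A \<inter> B \<inter> C \<inter> D)) = t (card (A \<union> B \<union> C \<union> D))
    - t (card (A \<union> B \<union> C) + card D) - t (card (A \<union> B \<union> D) + card C)
    - t (card (A \<union> C \<union> D) + card B) - t (card (B \<union> C \<union> D) + card A)
    - t (card (A \<union> B) + card (C \<union> D)) - t (card (A \<union> C) + card (B \<union> D)) - t (card (A \<union> D) + card (B \<union> C))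
    + 2 * (t (card (A \<union> B) + card C + card D) + t (card (A \<union> C) + card B + card D) + t (card (A \<union> D) + card B + card C)
         + t (card (B \<union> C) + card A + card D) + t (card (B \<union> D) + card A + card C) + t (card (C \<union> D) + card A + card B))
    - 6 * t (card A + card B + card C + card D)"
    unfolding incl_excl4[OF fin] t_def by (simp add: algebra_simps)
  have "\<bar>kappa4 p A B C D - (1 - p) * real (card (A \<inter> B \<inter> C \<inter> D))\<bar> \<le> 26 * b"
    unfolding kappa4_def eq distrib_left by (rule abs_leI; use two_sided in linarith)
  then show ?thesis by (simp add: b_def)
qed

section \<open>Convergence to the normal law from moment bounds in one parameter\<close>

text \<open>A bounded continuous substitute for the cube: weak convergence applies to it, and the error is controlled by the
fourth moment.\<close>

lemma clipped_cube_error: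
  fixes x M :: real assumes "M > 0"
  shows "\<bar>x ^ 3 - (max (- M) (min M x)) ^ 3\<bar> \<le> x ^ 4 / M"
proof (cases "\<bar>x\<bar> \<le> M")
  case True
  then have "max (- M) (min M x) = x" by auto
  then show ?thesis using assms by simp
next
  case False
  have sandwich: "0 \<le> max (- M) (min M x) ^ 3 \<and> max (- M) (min M x) ^ 3 \<le> x ^ 3 \<or>
    x ^ 3 \<le> max (- M) (min M x) ^ 3 \<and> max (- M) (min M x) ^ 3 \<le> 0"
  proof (cases "x > 0")
    case True
    then have "max (- M) (min M x) = M" "M \<le> x" using False assms by auto
    then show ?thesis using assms power_mono[of M x 3] by simp
  next
    case neg: False
    then have "max (- M) (min M x) = - M" "x \<le> - M" using False assms by auto
    then show ?thesis using assms power_mono[of M "- x" 3] by (simp add: power3_eq_cube)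
  qed
  then have "\<bar>x ^ 3 - max (- M) (min M x) ^ 3\<bar> \<le> \<bar>x ^ 3\<bar>" by linarith
  also have "\<bar>x ^ 3\<bar> \<le> x ^ 4 / M"
  proof -
    have "\<bar>x\<bar> ^ 3 * M \<le> \<bar>x\<bar> ^ 3 * \<bar>x\<bar>" using False by (intro mult_left_mono) auto
    also have "\<dots> = x ^ 4" by (simp add: power4_eq_xxxx power3_eq_cube abs_mult_self_eq mult.assoc flip: abs_mult)
    finally show ?thesis using assms by (simp add: power_abs le_divide_eq)
  qed
  finally show ?thesis .
qed

text \<open>Integrated against the standard normal law, the left-hand side gives \<open>1 - 3/4\<close>; this is a cheap proof that
the mean of the bounded continuous function on the right is positive.\<close>

lemma min_abs_one_ge: "x\<^sup>2 - x ^ 4 / 4 \<le> min \<bar>x\<bar> (1 :: real)"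
proof -
  have "0 \<le> (x\<^sup>2 / 2 - 1)\<^sup>2" by simp
  then have 1: "x\<^sup>2 - x ^ 4 / 4 \<le> 1" by (simp add: power2_eq_square power4_eq_xxxx algebra_simps)
  show ?thesis
  proof (cases "\<bar>x\<bar> \<le> 1")
    case True
    have "x\<^sup>2 \<le> \<bar>x\<bar>" using mult_left_mono[OF True, of "\<bar>x\<bar>"] by (simp add: power2_eq_square abs_mult_self_eq)
    moreover have "0 \<le> x ^ 4" by simp
    ultimately have "x\<^sup>2 - x ^ 4 / 4 \<le> \<bar>x\<bar>" by linarith
    with 1 show ?thesis by simp
  qed (use 1 in simp)
qed

lemma filterlim_at_top_if_inverse_small:
  fixes th e :: "nat \<Rightarrow> real"
  assumes "eventually (\<lambda>n. 0 < th n \<and> 1 / th n \<le> e n) sequentially" "e \<longlonglongrightarrow> 0"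
  shows "filterlim th at_top sequentially"
proof -
  have "(\<lambda>n. 1 / th n) \<longlonglongrightarrow> 0"
    by (rule tendsto_sandwich[OF _ _ tendsto_const assms(2)]) (use assms(1) in \<open>auto elim: eventually_mono\<close>)
  then have "filterlim (\<lambda>n. inverse (1 / th n)) at_top sequentially"
    by (rule filterlim_inverse_at_top) (use assms(1) in \<open>auto elim: eventually_mono\<close>)
  then show ?thesis by simp
qed

text \<open>The characteristic functions and the upper bound on the fourth moment give the directions from \<open>th\<close>. From
convergence of the fourth moment, its lower bound gives back \<open>th\<close>. From the limit law, the bound on
the mean absolute value first keeps \<open>th\<close> away from 0, then the fourth moments are bounded, hence the third moments
converge to the third moment 0 of the normal law, and the lower bound on the third moment applies. The alternatives
\<open>C / n\<close> in the lower bounds cover parameters for which \<open>th\<close> is large anyway.\<close>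

lemma normal_limit_iff:
  fixes R :: "nat \<Rightarrow> 'g pmf" and Y :: "nat \<Rightarrow> 'g \<Rightarrow> real" and th :: "nat \<Rightarrow> real" and C :: real
  assumes fin: "\<And>n. finite (set_pmf (R n))" and C: "C > 0"
    and th: "\<And>n. n \<ge> n0 \<Longrightarrow> th n > 0"
    and abs: "\<And>n. n \<ge> n0 \<Longrightarrow> measure_pmf.expectation (R n) (\<lambda>x. \<bar>Y n x\<bar>) \<le> C * sqrt (th n)"
    and fourth: "\<And>n. n \<ge> n0 \<Longrightarrow> \<bar>measure_pmf.expectation (R n) (\<lambda>x. Y n x ^ 4) - 3\<bar> \<le> C / th n"
    and fourth': "\<And>n. n \<ge> n0 \<Longrightarrow> 1 / th n \<le> C * \<bar>measure_pmf.expectation (R n) (\<lambda>x. Y n x ^ 4) - 3\<bar> \<or> 1 / th n \<le> C / n"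
    and third: "\<And>n. n \<ge> n0 \<Longrightarrow> 1 / sqrt (th n) \<le> C * \<bar>measure_pmf.expectation (R n) (\<lambda>x. Y n x ^ 3)\<bar> \<or> 1 / th n \<le> C / n"
    and char: "\<And>n t. n \<ge> n0 \<Longrightarrow> cmod (measure_pmf.expectation (R n) (\<lambda>x. iexp (t * Y n x)) - complex_of_real (exp (- (t\<^sup>2 / 2))))
      \<le> C * \<bar>t\<bar> ^ 3 / sqrt (th n)"
  shows "weak_conv_m (\<lambda>n. distr (measure_pmf (R n)) borel (Y n)) std_normal_distribution \<longleftrightarrow> filterlim th at_top sequentially"
    and "filterlim th at_top sequentially \<longleftrightarrow> (\<lambda>n. measure_pmf.expectation (R n) (\<lambda>x. Y n x ^ 4)) \<longlonglongrightarrow> 3"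
proof -
  let ?E = "\<lambda>n f. measure_pmf.expectation (R n) f"
  let ?D = "\<lambda>n. distr (measure_pmf (R n)) borel (Y n)"
  let ?G = std_normal_distribution
  have int [simp]: "integrable (measure_pmf (R n)) f" for n and f :: "'g \<Rightarrow> real"
    by (rule integrable_measure_pmf_finite[OF fin])
  have real_D: "real_distribution (?D n)" for n
    by (rule prob_space.real_distribution_distr[OF measure_pmf.prob_space_axioms]) simp
  have real_G: "real_distribution ?G" by (rule real_dist_normal_dist)
  have distr_int: "integral\<^sup>L (?D n) f = ?E n (\<lambda>x. f (Y n x))"
    if "f \<in> borel_measurable borel" for n and f :: "real \<Rightarrow> 'b::{banach, second_countable_topology}"
    using that by (intro integral_distr) auto
  have lim_Cn: "(\<lambda>n. C / real n) \<longlonglongrightarrow> 0" by real_asymp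
  have ev: "eventually (\<lambda>n. n \<ge> n0) sequentially" by (rule eventually_ge_at_top)

  have th_conv: "weak_conv_m ?D ?G" if lim: "filterlim th at_top sequentially"
  proof (rule levy_continuity[OF real_D real_G])
    fix t
    have "(\<lambda>n. C * \<bar>t\<bar> ^ 3 / sqrt (th n)) \<longlonglongrightarrow> 0"
      by (intro tendsto_divide_0[OF tendsto_const] filterlim_at_top_imp_at_infinity filterlim_compose[OF sqrt_at_top lim])
    then have "(\<lambda>n. ?E n (\<lambda>x. iexp (t * Y n x)) - complex_of_real (exp (- (t\<^sup>2 / 2)))) \<longlonglongrightarrow> 0"
      by (rule Lim_null_comparison[rotated]) (rule eventually_mono[OF ev], rule char)
    then have "(\<lambda>n. ?E n (\<lambda>x. iexp (t * Y n x))) \<longlonglongrightarrow> complex_of_real (exp (- (t\<^sup>2 / 2)))"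
      by (rule LIM_zero_cancel)
    moreover have "char (?D n) t = ?E n (\<lambda>x. iexp (t * Y n x))" for n
      unfolding char_def by (rule distr_int) simp
    ultimately show "(\<lambda>n. char (?D n) t) \<longlonglongrightarrow> char ?G t"
      by (simp add: char_std_normal_distribution)
  qed

  have th_fourth: "(\<lambda>n. ?E n (\<lambda>x. Y n x ^ 4)) \<longlonglongrightarrow> 3" if lim: "filterlim th at_top sequentially"
  proof -
    have "(\<lambda>n. C / th n) \<longlonglongrightarrow> 0"
      by (intro tendsto_divide_0[OF tendsto_const] filterlim_at_top_imp_at_infinity lim)
    then have "(\<lambda>n. ?E n (\<lambda>x. Y n x ^ 4) - 3) \<longlonglongrightarrow> 0"
      by (rule Lim_null_comparison[rotated]) (rule eventually_mono[OF ev], unfold real_norm_def, rule fourth)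
    then show ?thesis by (rule LIM_zero_cancel)
  qed

  have fourth_th: "filterlim th at_top sequentially" if lim: "(\<lambda>n. ?E n (\<lambda>x. Y n x ^ 4)) \<longlonglongrightarrow> 3"
  proof (rule filterlim_at_top_if_inverse_small)
    show "eventually (\<lambda>n. 0 < th n \<and> 1 / th n \<le> C * \<bar>?E n (\<lambda>x. Y n x ^ 4) - 3\<bar> + C / n) sequentially"
      using ev
    proof eventually_elim
      case (elim n)
      have "0 \<le> C * \<bar>?E n (\<lambda>x. Y n x ^ 4) - 3\<bar>" "0 \<le> C / n" using C by auto
      with th[OF elim] fourth'[OF elim] show ?case by linarith
    qed
    have "(\<lambda>n. C * \<bar>?E n (\<lambda>x. Y n x ^ 4) - 3\<bar> + C / n) \<longlonglongrightarrow> C * \<bar>3 - 3\<bar> + 0"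
      by (intro tendsto_intros lim lim_Cn)
    then show "(\<lambda>n. C * \<bar>?E n (\<lambda>x. Y n x ^ 4) - 3\<bar> + C / n) \<longlonglongrightarrow> 0" by simp
  qed

  have conv_th: "filterlim th at_top sequentially" if conv: "weak_conv_m ?D ?G"
  proof -
    note test = weak_conv_imp_integral_bdd_continuous_conv[OF real_D real_G conv]
    have int_G [simp]: "integrable ?G (\<lambda>x. x ^ k)" for k by (rule integrable_std_normal_distribution_moment)
    interpret G: real_distribution ?G by (rule real_G)
    have G2: "integral\<^sup>L ?G (\<lambda>x. x\<^sup>2) = 1" and G4: "integral\<^sup>L ?G (\<lambda>x. x ^ 4) = 3" and G3: "integral\<^sup>L ?G (\<lambda>x. x ^ 3) = 0"
      using std_normal_distribution_even_moments(1)[of 1] std_normal_distribution_even_moments(1)[of 2]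
        integral_std_normal_distribution_moment_odd[of 3]
      by (simp_all add: fact_numeral)
    define c where "c = integral\<^sup>L ?G (\<lambda>x. min \<bar>x\<bar> 1)"
    have c: "c \<ge> 1 / 4"
    proof -
      have "1 / 4 = integral\<^sup>L ?G (\<lambda>x. x\<^sup>2 - x ^ 4 / 4)" by (simp add: G2 G4)
      also have "\<dots> \<le> c" unfolding c_def
      proof (rule integral_mono)
        show "integrable ?G (\<lambda>x. min \<bar>x\<bar> 1)"
          by (rule G.integrable_const_bound[where B=1]) (auto intro!: AE_I2)
      qed (simp, rule min_abs_one_ge)
      finally show ?thesis .
    qed
    have "(\<lambda>n. integral\<^sup>L (?D n) (\<lambda>x. min \<bar>x\<bar> 1)) \<longlonglongrightarrow> c"
      unfolding c_def by (rule test[where B=1]) (auto intro!: continuous_intros)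
    then have "(\<lambda>n. ?E n (\<lambda>x. min \<bar>Y n x\<bar> 1)) \<longlonglongrightarrow> c"
      by (subst (asm) distr_int) auto
    then have ev_c: "eventually (\<lambda>n. ?E n (\<lambda>x. min \<bar>Y n x\<bar> 1) > 1 / 8) sequentially"
      by (rule order_tendstoD) (use c in linarith)
    \<comment> \<open>mean absolute values above 1/8 force \<open>1 / th n \<le> (8 * C)^2\<close>\<close>
    define B where "B = 3 + C * (8 * C)\<^sup>2"
    have bdd: "eventually (\<lambda>n. ?E n (\<lambda>x. Y n x ^ 4) \<le> B) sequentially"
      using ev ev_c
    proof eventually_elim
      case (elim n)
      have "1 / 8 < ?E n (\<lambda>x. \<bar>Y n x\<bar>)"
        using elim(2) by (rule less_le_trans) (intro integral_mono, auto)
      also have "\<dots> \<le> C * sqrt (th n)" by (rule abs[OF elim(1)])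
      finally have "1 / (8 * C) \<le> sqrt (th n)" using C by (simp add: field_simps)
      then have "1 / sqrt (th n) \<le> 8 * C" using C th[OF elim(1)] by (simp add: field_simps)
      then have "(1 / sqrt (th n))\<^sup>2 \<le> (8 * C)\<^sup>2" by (rule power_mono) (use th[OF elim(1)] in simp)
      then have "1 / th n \<le> (8 * C)\<^sup>2" using th[OF elim(1)] by (simp add: power_divide)
      then have "C * (1 / th n) \<le> C * (8 * C)\<^sup>2" using C by (intro mult_left_mono) auto
      then show ?case using fourth[OF elim(1)] unfolding B_def by (simp add: abs_le_iff)
    qed
    have third_lim: "(\<lambda>n. ?E n (\<lambda>x. Y n x ^ 3)) \<longlonglongrightarrow> 0"
    proof (rule LIMSEQ_I)
      fix r :: real assume r: "r > 0"
      \<comment> \<open>the clipping errors \<open>B / M\<close> of \<open>Y\<close> and \<open>3 / M\<close> of the normal law together stay below \<open>r / 2\<close>\<close>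
      define M where "M = (B + 4) * 2 / r"
      have "B > 3" using C by (simp add: B_def)
      then have M: "M > 0" "(B + 3) / M < r / 2" using r by (simp_all add: M_def field_simps)
      let ?g = "\<lambda>x::real. (max (- M) (min M x)) ^ 3"
      have g_bound: "norm (?g x) \<le> M ^ 3" for x
        unfolding norm_power using M(1) by (intro power_mono) auto
      have g_cont: "isCont ?g x" for x by (intro continuous_intros)
      have g_meas: "?g \<in> borel_measurable borel" by measurable
      have Gg: "\<bar>integral\<^sup>L ?G ?g\<bar> \<le> 3 / M"
      proof -
        have ig: "integrable ?G ?g"
          by (rule G.integrable_const_bound[where B="M ^ 3"]) (use g_bound in \<open>auto intro!: AE_I2\<close>)
        have "\<bar>integral\<^sup>L ?G ?g\<bar> = \<bar>integral\<^sup>L ?G (\<lambda>x. x ^ 3 - ?g x)\<bar>"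
          using ig by (simp add: G3)
        also have "\<dots> \<le> integral\<^sup>L ?G (\<lambda>x. \<bar>x ^ 3 - ?g x\<bar>)" by (rule integral_abs_bound)
        also have "\<dots> \<le> integral\<^sup>L ?G (\<lambda>x. x ^ 4 / M)"
          using ig by (intro integral_mono clipped_cube_error M) auto
        finally show ?thesis by (simp add: G4)
      qed
      have Yg: "\<bar>?E n (\<lambda>x. Y n x ^ 3) - ?E n (\<lambda>x. ?g (Y n x))\<bar> \<le> ?E n (\<lambda>x. Y n x ^ 4) / M" for n
      proof -
        have "\<bar>?E n (\<lambda>x. Y n x ^ 3) - ?E n (\<lambda>x. ?g (Y n x))\<bar> = \<bar>?E n (\<lambda>x. Y n x ^ 3 - ?g (Y n x))\<bar>"
          by simp
        also have "\<dots> \<le> ?E n (\<lambda>x. \<bar>Y n x ^ 3 - ?g (Y n x)\<bar>)" by (rule integral_abs_bound)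
        also have "\<dots> \<le> ?E n (\<lambda>x. Y n x ^ 4 / M)"
          by (intro integral_mono clipped_cube_error M) auto
        finally show ?thesis by simp
      qed
      have "(\<lambda>n. integral\<^sup>L (?D n) ?g) \<longlonglongrightarrow> integral\<^sup>L ?G ?g"
        by (rule test[where B="M ^ 3", OF g_cont g_bound])
      then have "(\<lambda>n. ?E n (\<lambda>x. ?g (Y n x))) \<longlonglongrightarrow> integral\<^sup>L ?G ?g"
        by (simp only: distr_int[OF g_meas])
      from tendstoD[OF this half_gt_zero[OF r]]
      have "eventually (\<lambda>n. \<bar>?E n (\<lambda>x. ?g (Y n x)) - integral\<^sup>L ?G ?g\<bar> < r / 2) sequentially"
        by (simp only: dist_real_def)
      with bdd have "eventually (\<lambda>n. norm (?E n (\<lambda>x. Y n x ^ 3) - 0) < r) sequentially"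
      proof eventually_elim
        case (elim n)
        have "?E n (\<lambda>x. Y n x ^ 4) / M + 3 / M \<le> (B + 3) / M"
          using elim(1) M(1) by (simp add: divide_right_mono flip: add_divide_distrib)
        then show ?case using elim(2) Gg Yg[of n] M(2) unfolding real_norm_def by linarith
      qed
      then show "\<exists>no. \<forall>n\<ge>no. norm (?E n (\<lambda>x. Y n x ^ 3) - 0) < r"
        by (simp add: eventually_sequentially)
    qed
    show ?thesis
    proof (rule filterlim_at_top_if_inverse_small)
      show "eventually (\<lambda>n. 0 < th n \<and> 1 / th n \<le> (C * \<bar>?E n (\<lambda>x. Y n x ^ 3)\<bar>)\<^sup>2 + C / n) sequentially"
        using ev
      proof eventually_elim
        case (elim n)
        have "1 / th n \<le> (C * \<bar>?E n (\<lambda>x. Y n x ^ 3)\<bar>)\<^sup>2" if "1 / sqrt (th n) \<le> C * \<bar>?E n (\<lambda>x. Y n x ^ 3)\<bar>"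
          using power_mono[OF that, of 2] th[OF elim] by (simp add: power_divide)
        moreover have "0 \<le> (C * \<bar>?E n (\<lambda>x. Y n x ^ 3)\<bar>)\<^sup>2" "0 \<le> C / n" using C by auto
        ultimately show ?case using th[OF elim] third[OF elim] by linarith
      qed
      have "(\<lambda>n. (C * \<bar>?E n (\<lambda>x. Y n x ^ 3)\<bar>)\<^sup>2 + C / n) \<longlonglongrightarrow> (C * \<bar>0\<bar>)\<^sup>2 + 0"
        by (intro tendsto_intros third_lim lim_Cn)
      then show "(\<lambda>n. (C * \<bar>?E n (\<lambda>x. Y n x ^ 3)\<bar>)\<^sup>2 + C / n) \<longlonglongrightarrow> 0" by simp
    qed
  qed
  show "weak_conv_m ?D ?G \<longleftrightarrow> filterlim th at_top sequentially"
    using th_conv conv_th by blast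
  show "filterlim th at_top sequentially \<longleftrightarrow> (\<lambda>n. ?E n (\<lambda>x. Y n x ^ 4)) \<longlonglongrightarrow> 3"
    using th_fourth fourth_th by blast
qed

section \<open>Placements of a pattern and their overlaps\<close>

lemma card_injections_ge:
  assumes "finite R" and T: "finite T"
  shows "(card T - card R) ^ card R \<le> card {g \<in> R \<rightarrow>\<^sub>E T. inj_on g R}"
  using assms(1)
proof (induction R rule: finite_induct)
  case empty
  show ?case by simp
next
  case (insert x R)
  let ?I = "\<lambda>R. {g \<in> R \<rightarrow>\<^sub>E T. inj_on g R}"
  let ?P = "SIGMA g:?I R. T - g ` R"
  have fin: "finite (?I A)" if "finite A" for A :: "'a set"
    using that T by (simp add: finite_PiE)
  have "card T - card (insert x R) \<le> card T - card R"
    using insert.hyps by simp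
  then have "(card T - card (insert x R)) ^ card R \<le> (card T - card R) ^ card R"
    by (rule power_mono) simp
  then have "(card T - card (insert x R)) ^ card (insert x R) \<le> (card T - card R) ^ card R * (card T - card R)"
    using insert.hyps \<open>card T - card (insert x R) \<le> card T - card R\<close>
    by (simp add: power_Suc2 mult_mono del: power_Suc)
  also have "\<dots> \<le> card (?I R) * (card T - card R)"
    using insert.IH by (rule mult_right_mono) simp
  also have "\<dots> = (\<Sum>g\<in>?I R. card T - card R)" by simp
  also have "\<dots> = (\<Sum>g\<in>?I R. card (T - g ` R))"
  proof (rule sum.cong[OF refl])
    fix g assume "g \<in> ?I R"
    then have "g ` R \<subseteq> T" "card (g ` R) = card R" by (auto simp: card_image)
    then show "card T - card R = card (T - g ` R)"
      using insert.hyps by (simp add: card_Diff_subset)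
  qed
  also have "\<dots> = card ?P"
    using fin[OF insert.hyps(1)] T by (intro card_SigmaI[symmetric]) auto
  also have "card ?P = card ((\<lambda>(g, y). g(x := y)) ` ?P)"
  proof (rule card_image[symmetric], rule inj_onI, clarify)
    fix g y h z
    assume g: "g \<in> R \<rightarrow>\<^sub>E T" and h: "h \<in> R \<rightarrow>\<^sub>E T" and eq: "g(x := y) = h(x := z)"
    have "g w = h w" if "w \<in> R" for w
      using fun_cong[OF eq, of w] that insert.hyps by (auto split: if_splits)
    then have "g = h" using g h by (intro PiE_ext) auto
    moreover have "y = z" using fun_cong[OF eq, of x] by simp
    ultimately show "g = h \<and> y = z" by simp
  qed
  also have "\<dots> \<le> card (?I (insert x R))"
  proof (rule card_mono[OF fin])
    show "(\<lambda>(g, y). g(x := y)) ` ?P \<subseteq> ?I (insert x R)"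
    proof clarify
      fix g y assume g: "g \<in> R \<rightarrow>\<^sub>E T" "inj_on g R" and y: "y \<in> T" "y \<notin> g ` R"
      have "(g(x := y)) ` R = g ` R" "inj_on (g(x := y)) R"
        using insert.hyps g by (auto simp: inj_on_def)
      then have "inj_on (g(x := y)) (insert x R)" using insert.hyps y by simp
      then show "g(x := y) \<in> insert x R \<rightarrow>\<^sub>E T \<and> inj_on (g(x := y)) (insert x R)"
        using g y by (simp add: PiE_fun_upd)
    qed
  qed (use insert.hyps in simp)
  finally show ?case .
qed

locale pattern =
  fixes V :: "'a set" and E :: "'a set set"
  assumes finite_V: "finite V" and E_subset: "E \<subseteq> Pow V - {{}}" and E_nonempty: "E \<noteq> {}"
begin

text \<open>The number of sets of edges along which a placement can meet a given family, times the number of ways to send the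
vertices of such edges into at most \<open>3 * card V\<close> given vertices (a family met by a fourth placement is
the union of three placements).\<close>

definition overlap_const :: real where "overlap_const = 2 ^ card E * (3 * card V) ^ card V"

lemma finite_E: "finite E"
  using finite_subset[OF E_subset] finite_V by simp

lemma card_E_pos: "card E > 0"
  using finite_E E_nonempty by (simp add: card_gt_0_iff)

lemma V_nonempty: "V \<noteq> {}"
  using E_subset E_nonempty by auto

lemma card_V_pos: "card V > 0"
  using finite_V V_nonempty by (simp add: card_gt_0_iff)

lemma overlap_const_pos: "overlap_const > 0"
  using card_V_pos by (simp add: overlap_const_def)

end

text \<open>The bound on \<open>n\<close> makes every partial placement extend in at least \<open>n/2\<close> ways per missing vertex.\<close>

locale random_pattern = pattern V E for V :: "'a set" and E :: "'a set set" +
  fixes n :: nat and p :: real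
  assumes p_pos: "0 < p" and p_less_1: "p < 1" and n_large: "2 * card V \<le> n"
begin

definition placements :: "('a \<Rightarrow> nat) set" where
  "placements = {f \<in> V \<rightarrow>\<^sub>E {1..n}. inj_on f V}"

definition placed :: "('a \<Rightarrow> nat) \<Rightarrow> nat set set" where
  "placed f = (\<lambda>x. f ` x) ` E"

abbreviation "pw2 a b \<equiv> pw p (placed a \<union> placed b)"
abbreviation "pw3 a b c \<equiv> pw p (placed a \<union> placed b \<union> placed c)"
abbreviation "pw4 a b c d \<equiv> pw p (placed a \<union> placed b \<union> placed c \<union> placed d)"
abbreviation "kap3 a b c \<equiv> kappa3 p (placed a) (placed b) (placed c)"
abbreviation "kap4 a b c d \<equiv> kappa4 p (placed a) (placed b) (placed c) (placed d)"

abbreviation "sum3 F \<equiv> (\<Sum>a\<in>placements. \<Sum>b\<in>placements. \<Sum>c\<in>placements. F a b c :: real)"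
abbreviation "sum4 F \<equiv> (\<Sum>a\<in>placements. \<Sum>b\<in>placements. \<Sum>c\<in>placements. \<Sum>d\<in>placements. F a b c d :: real)"

definition min_scale :: real where "min_scale = min_expected_scale (V, E) n p"

definition mean_order :: real where "mean_order = real n ^ card V * p ^ card E"

definition meeting :: "nat set set \<Rightarrow> ('a \<Rightarrow> nat) set" where
  "meeting U = {f \<in> placements. placed f \<inter> U \<noteq> {}}"

lemma n_pos: "n > 0" using n_large card_V_pos by linarith

lemma mean_order_pos: "mean_order > 0" using n_pos p_pos by (simp add: mean_order_def)

lemma finite_placements [simp]: "finite placements"
  unfolding placements_def using finite_V by (simp add: finite_PiE)

lemma finite_meeting [simp]: "finite (meeting U)"
  by (simp add: meeting_def)

lemma card_placements_le: "card placements \<le> n ^ card V"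
proof -
  have "card placements \<le> card (V \<rightarrow>\<^sub>E {1..n})"
    unfolding placements_def using finite_V by (intro card_mono) (auto simp: finite_PiE)
  then show ?thesis using finite_V by (simp add: card_PiE)
qed

lemma finite_placed [simp]: "finite (placed f)"
  by (simp add: placed_def finite_E)

lemma inj_on_image_edges:
  assumes "f \<in> placements" shows "inj_on (\<lambda>x. f ` x) E"
proof -
  have "inj_on f V" using assms by (simp add: placements_def)
  then show ?thesis using E_subset inj_on_subset[OF inj_on_image_Pow] by blast
qed

lemma card_placed: "f \<in> placements \<Longrightarrow> card (placed f) = card E"
  unfolding placed_def by (rule card_image[OF inj_on_image_edges])

lemma Union_placed: "\<Union>(placed f) \<subseteq> f ` V"
  using E_subset by (auto simp: placed_def)

lemma finite_Union_placed [simp]: "finite (\<Union>(placed f))"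
  using finite_subset[OF Union_placed] finite_V by simp

lemma card_Union_placed: "card (\<Union>(placed f)) \<le> card V"
  using card_mono[OF finite_imageI[OF finite_V] Union_placed, of f] card_image_le[OF finite_V, of f]
  by linarith

lemma placed_subset: "f \<in> placements \<Longrightarrow> placed f \<subseteq> Pow {1..n} - {{}}"
proof
  fix y assume f: "f \<in> placements" and "y \<in> placed f"
  then obtain x where x: "x \<in> E" "y = f ` x" by (auto simp: placed_def)
  have "f ` V \<subseteq> {1..n}" using f by (auto simp: placements_def)
  moreover have "x \<subseteq> V" "x \<noteq> {}" using x E_subset by auto
  ultimately show "y \<in> Pow {1..n} - {{}}" using x by blast
qed

lemma subpattern_scales:
  shows finite_subpattern_scales:
      "finite ((\<lambda>F. p ^ card (edges F) * real n ^ card (verts F)) ` {F. subhypergraph F (V, E) \<and> card (edges F) \<ge> 1})"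
    and subpattern_scale_mem: "\<And>S D. S \<subseteq> E \<Longrightarrow> S \<noteq> {} \<Longrightarrow> \<Union>S \<subseteq> D \<Longrightarrow> D \<subseteq> V \<Longrightarrow>
      p ^ card S * real n ^ card D \<in> (\<lambda>F. p ^ card (edges F) * real n ^ card (verts F)) ` {F. subhypergraph F (V, E) \<and> card (edges F) \<ge> 1}"
proof -
  have "{F. subhypergraph F (V, E) \<and> card (edges F) \<ge> 1} \<subseteq> Pow V \<times> Pow E"
    by (auto simp: subhypergraph_def)
  then show "finite ((\<lambda>F. p ^ card (edges F) * real n ^ card (verts F)) ` {F. subhypergraph F (V, E) \<and> card (edges F) \<ge> 1})"
    by (rule finite_imageI[OF finite_subset]) (simp add: finite_V finite_E)
next
  fix S D assume S: "S \<subseteq> E" "S \<noteq> {}" "\<Union>S \<subseteq> D" "D \<subseteq> V"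
  have "subhypergraph (D, S) (V, E)"
    using S E_subset finite_V finite_subset by (auto simp: subhypergraph_def hypergraph_def)
  moreover have "card S \<ge> 1" using S finite_E finite_subset card_gt_0_iff[of S] by force
  ultimately show "p ^ card S * real n ^ card D \<in> (\<lambda>F. p ^ card (edges F) * real n ^ card (verts F)) ` {F. subhypergraph F (V, E) \<and> card (edges F) \<ge> 1}"
    by (intro image_eqI[of _ _ "(D, S)"]) auto
qed

lemma min_scale_le:
  assumes "S \<subseteq> E" "S \<noteq> {}" "\<Union>S \<subseteq> D" "D \<subseteq> V"
  shows "min_scale \<le> p ^ card S * real n ^ card D"
  unfolding min_scale_def min_expected_scale_def
  using subpattern_scale_mem[OF assms] finite_subpattern_scales by (intro Min_le)

lemma min_scale_attained:
  obtains S D where "S \<subseteq> E" "S \<noteq> {}" "\<Union>S \<subseteq> D" "D \<subseteq> V" "min_scale = p ^ card S * real n ^ card D"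
proof -
  have "(\<lambda>F. p ^ card (edges F) * real n ^ card (verts F)) ` {F. subhypergraph F (V, E) \<and> card (edges F) \<ge> 1} \<noteq> {}"
    using subpattern_scale_mem[of E V] E_subset E_nonempty by blast
  from Min_in[OF finite_subpattern_scales this]
  obtain F where "subhypergraph F (V, E)" "card (edges F) \<ge> 1" "min_scale = p ^ card (edges F) * real n ^ card (verts F)"
    by (auto simp: min_scale_def min_expected_scale_def)
  then show ?thesis
    by (intro that[of "edges F" "verts F"]) (auto simp: subhypergraph_def hypergraph_def)
qed

lemma min_scale_pos: "min_scale > 0"
proof -
  obtain S D where "min_scale = p ^ card (S :: 'a set set) * real n ^ card (D :: 'a set)" by (rule min_scale_attained)
  then show ?thesis using p_pos n_pos by simp
qed

text \<open>A placement that sends exactly the edges of \<open>S\<close> into \<open>U\<close> sends all vertices of these edges into \<open>\<Union>U\<close>, which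
leaves a bounded number of choices for them and \<open>n\<close> choices for each of the other vertices.\<close>

lemma card_constrained_placements_le:
  assumes S: "S \<subseteq> E" and fin: "finite (\<Union>U)" and card: "card (\<Union>U) \<le> 3 * card V"
  shows "card {f \<in> placements. {x \<in> E. f ` x \<in> U} = S} \<le> (3 * card V) ^ card V * n ^ (card V - card (\<Union>S))"
proof -
  let ?B = "\<lambda>x. if x \<in> \<Union>S then \<Union>U else {1..n}"
  have SV: "\<Union>S \<subseteq> V" using S E_subset by auto
  have "card {f \<in> placements. {x \<in> E. f ` x \<in> U} = S} \<le> card (PiE V ?B)"
  proof (rule card_mono)
    show "finite (PiE V ?B)" using fin finite_V by (intro finite_PiE) auto
    show "{f \<in> placements. {x \<in> E. f ` x \<in> U} = S} \<subseteq> PiE V ?B"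
    proof
      fix f assume f: "f \<in> {f \<in> placements. {x \<in> E. f ` x \<in> U} = S}"
      have "f y \<in> \<Union>U" if "y \<in> \<Union>S" for y
        using f that by blast
      moreover have "f \<in> V \<rightarrow>\<^sub>E {1..n}" using f by (simp add: placements_def)
      ultimately show "f \<in> PiE V ?B" by (simp add: PiE_iff)
    qed
  qed
  also have "\<dots> = (\<Prod>x\<in>V. card (?B x))" using finite_V by (rule card_PiE)
  also have "\<dots> = (\<Prod>x\<in>V. if x \<in> \<Union>S then card (\<Union>U) else n)" by (intro prod.cong) auto
  also have "\<dots> = card (\<Union>U) ^ card (\<Union>S) * n ^ card (V - \<Union>S)"
  proof -
    have "V \<inter> {x. x \<in> \<Union>S} = \<Union>S" "V \<inter> - {x. x \<in> \<Union>S} = V - \<Union>S" using SV by blast+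
    then show ?thesis using finite_V by (simp only: prod.If_cases[OF finite_V] prod_constant)
  qed
  also have "card (V - \<Union>S) = card V - card (\<Union>S)"
    using SV finite_V finite_subset by (intro card_Diff_subset) auto
  also have "card (\<Union>U) ^ card (\<Union>S) \<le> (3 * card V) ^ card (\<Union>S)"
    using card by (rule power_mono) simp
  also have "\<dots> \<le> (3 * card V) ^ card V"
    using card_V_pos card_mono[OF finite_V SV] by (intro power_increasing) auto
  finally show ?thesis by simp
qed

lemma card_placed_Un:
  assumes f: "f \<in> placements" and fin: "finite U"
  shows "card (placed f \<union> U) = card U + (card E - card {x \<in> E. f ` x \<in> U})"
proof -
  let ?S = "{x \<in> E. f ` x \<in> U}"
  have "placed f \<union> U = U \<union> (\<lambda>x. f ` x) ` (E - ?S)" by (auto simp: placed_def)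
  also have "card \<dots> = card U + card ((\<lambda>x. f ` x) ` (E - ?S))"
    using fin finite_E by (intro card_Un_disjoint) auto
  also have "card ((\<lambda>x. f ` x) ` (E - ?S)) = card (E - ?S)"
    using inj_on_image_edges[OF f] by (intro card_image) (auto simp: inj_on_def)
  also have "\<dots> = card E - card ?S" using finite_E by (intro card_Diff_subset) auto
  finally show ?thesis .
qed

text \<open>Classify the placements that meet \<open>U\<close> by the nonempty set \<open>S\<close> of edges of the pattern that they send into \<open>U\<close>. The
class of \<open>S\<close> loses the factor \<open>n^card (\<Union>S) * p^card S\<close> compared to \<open>mean_order * p^card U\<close>, and this factor is
one of the quantities whose minimum is \<open>min_scale\<close>.\<close>

lemma sum_meeting_le:
  assumes fin: "finite U" "finite (\<Union>U)" and card: "card (\<Union>U) \<le> 3 * card V"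
  shows "(\<Sum>f\<in>meeting U. p ^ card (placed f \<union> U)) \<le> overlap_const * (mean_order / min_scale) * p ^ card U"
proof -
  let ?T = "Pow E - {{}}"
  let ?g = "\<lambda>f. {x \<in> E. f ` x \<in> U}"
  let ?c = "real ((3 * card V) ^ card V)"
  have finT: "finite ?T" using finite_E by simp
  have "(\<Sum>f\<in>meeting U. p ^ card (placed f \<union> U))
      = (\<Sum>S\<in>?T. \<Sum>f\<in>{f \<in> meeting U. ?g f = S}. p ^ card (placed f \<union> U))"
    by (rule sum.group[symmetric, OF _ finT]) (auto simp: meeting_def placed_def)
  also have "\<dots> \<le> (\<Sum>S\<in>?T. ?c * (mean_order / min_scale) * p ^ card U)"
  proof (rule sum_mono)
    fix S assume S: "S \<in> ?T"
    let ?A = "{f \<in> meeting U. ?g f = S}"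
    have SV: "\<Union>S \<subseteq> V" using S E_subset by auto
    have cS: "card S \<le> card E" "card (\<Union>S) \<le> card V"
      using S finite_E finite_V SV by (auto intro: card_mono)
    have "(\<Sum>f\<in>?A. p ^ card (placed f \<union> U)) = (\<Sum>f\<in>?A. p ^ (card U + (card E - card S)))"
      using fin by (intro sum.cong) (auto simp: card_placed_Un meeting_def)
    also have "\<dots> = real (card ?A) * p ^ (card U + (card E - card S))" by simp
    also have "\<dots> \<le> real ((3 * card V) ^ card V * n ^ (card V - card (\<Union>S))) * p ^ (card U + (card E - card S))"
    proof (intro mult_right_mono)
      have "card ?A \<le> card {f \<in> placements. ?g f = S}"
        by (intro card_mono) (auto simp: meeting_def)
      also have "\<dots> \<le> (3 * card V) ^ card V * n ^ (card V - card (\<Union>S))"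
        using S by (intro card_constrained_placements_le fin card) auto
      finally show "real (card ?A) \<le> real ((3 * card V) ^ card V * n ^ (card V - card (\<Union>S)))"
        by (simp only: of_nat_le_iff)
    qed (use p_pos in auto)
    also have "\<dots> = ?c * (mean_order / (p ^ card S * real n ^ card (\<Union>S))) * p ^ card U"
    proof -
      have "real n ^ (card V - card (\<Union>S)) = real n ^ card V / real n ^ card (\<Union>S)"
        "p ^ (card E - card S) = p ^ card E / p ^ card S"
        using n_pos p_pos cS by (simp_all add: power_diff)
      then show ?thesis by (simp add: mean_order_def power_add mult_ac)
    qed
    also have "\<dots> \<le> ?c * (mean_order / min_scale) * p ^ card U"
      using S SV p_pos n_pos min_scale_pos mean_order_pos
      by (intro mult_left_mono mult_right_mono divide_left_mono min_scale_le mult_pos_pos) auto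
    finally show "(\<Sum>f\<in>?A. p ^ card (placed f \<union> U)) \<le> ?c * (mean_order / min_scale) * p ^ card U" .
  qed
  also have "\<dots> = real (card ?T) * (?c * (mean_order / min_scale) * p ^ card U)" by simp
  also have "\<dots> \<le> 2 ^ card E * (?c * (mean_order / min_scale) * p ^ card U)"
  proof (rule mult_right_mono)
    have "card ?T \<le> card (Pow E)" using finite_E by (intro card_mono) auto
    also have "\<dots> = 2 ^ card E" using finite_E by (rule card_Pow)
    finally show "real (card ?T) \<le> 2 ^ card E" by (metis of_nat_le_iff of_nat_numeral of_nat_power)
    show "0 \<le> ?c * (mean_order / min_scale) * p ^ card U" using mean_order_pos min_scale_pos p_pos by simp
  qed
  finally show ?thesis by (simp add: overlap_const_def mult_ac)
qed

lemma card_Union_placed2: "card (\<Union>(placed f \<union> placed g)) \<le> 2 * card V"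
  using card_Un_le[of "\<Union>(placed f)" "\<Union>(placed g)"] card_Union_placed[of f] card_Union_placed[of g]
  by (simp add: Union_Un_distrib)

lemma card_Union_placed3: "card (\<Union>(placed f \<union> placed g \<union> placed h)) \<le> 3 * card V"
  using card_Un_le[of "\<Union>(placed f \<union> placed g)" "\<Union>(placed h)"] card_Union_placed[of h] card_Union_placed2[of f g]
  by (simp add: Union_Un_distrib)

text \<open>These sums dominate all sums over dependent tuples. Building the tuple one placement at a time allows one application
of \<open>sum_meeting_le\<close> for each further index.\<close>

definition "overlap_sum2 = (\<Sum>a\<in>placements. \<Sum>b\<in>meeting (placed a). p ^ card (placed a \<union> placed b))"
definition "overlap_sum3 = (\<Sum>a\<in>placements. \<Sum>b\<in>meeting (placed a). \<Sum>c\<in>meeting (placed a \<union> placed b).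
  p ^ card (placed a \<union> placed b \<union> placed c))"
definition "overlap_sum4 = (\<Sum>a\<in>placements. \<Sum>b\<in>meeting (placed a). \<Sum>c\<in>meeting (placed a \<union> placed b).
  \<Sum>d\<in>meeting (placed a \<union> placed b \<union> placed c). p ^ card (placed a \<union> placed b \<union> placed c \<union> placed d))"

lemma S1_le: "(\<Sum>a\<in>placements. p ^ card (placed a)) \<le> mean_order"
proof -
  have "(\<Sum>a\<in>placements. p ^ card (placed a)) = card placements * p ^ card E"
    by (simp add: card_placed)
  also have "\<dots> \<le> real (n ^ card V) * p ^ card E"
    using card_placements_le p_pos by (intro mult_right_mono) (simp_all only: of_nat_le_iff, simp)
  finally show ?thesis by (simp add: mean_order_def)
qed

lemma overlap_sum2_le: "overlap_sum2 \<le> overlap_const * mean_order\<^sup>2 / min_scale"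
proof -
  have "overlap_sum2 \<le> (\<Sum>a\<in>placements. overlap_const * (mean_order / min_scale) * p ^ card (placed a))"
    unfolding overlap_sum2_def
  proof (intro sum_mono)
    fix a
    show "(\<Sum>b\<in>meeting (placed a). p ^ card (placed a \<union> placed b)) \<le> overlap_const * (mean_order / min_scale) * p ^ card (placed a)"
      using card_Union_placed[of a] sum_meeting_le[of "placed a"] by (simp add: Un_commute)
  qed
  also have "\<dots> \<le> overlap_const * (mean_order / min_scale) * mean_order"
    unfolding sum_distrib_left[symmetric] using S1_le overlap_const_pos mean_order_pos min_scale_pos
    by (intro mult_left_mono) auto
  finally show ?thesis by (simp add: power2_eq_square)
qed

lemma overlap_sum3_le: "overlap_sum3 \<le> overlap_const ^ 2 * mean_order ^ 3 / min_scale ^ 2"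
proof -
  have "overlap_sum3 \<le> (\<Sum>a\<in>placements. \<Sum>b\<in>meeting (placed a). overlap_const * (mean_order / min_scale) * p ^ card (placed a \<union> placed b))"
    unfolding overlap_sum3_def
  proof (intro sum_mono)
    fix a b
    show "(\<Sum>c\<in>meeting (placed a \<union> placed b). p ^ card (placed a \<union> placed b \<union> placed c))
      \<le> overlap_const * (mean_order / min_scale) * p ^ card (placed a \<union> placed b)"
      using card_Union_placed2[of a b] sum_meeting_le[of "placed a \<union> placed b"] by (simp add: Un_commute)
  qed
  also have "\<dots> = overlap_const * (mean_order / min_scale) * overlap_sum2"
    by (simp add: overlap_sum2_def sum_distrib_left)
  also have "\<dots> \<le> overlap_const * (mean_order / min_scale) * (overlap_const * mean_order\<^sup>2 / min_scale)"
    using overlap_sum2_le overlap_const_pos mean_order_pos min_scale_pos by (intro mult_left_mono) auto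
  finally show ?thesis by (simp add: power2_eq_square power3_eq_cube mult_ac)
qed

lemma overlap_sum4_le: "overlap_sum4 \<le> overlap_const ^ 3 * mean_order ^ 4 / min_scale ^ 3"
proof -
  have "overlap_sum4 \<le> (\<Sum>a\<in>placements. \<Sum>b\<in>meeting (placed a). \<Sum>c\<in>meeting (placed a \<union> placed b).
     overlap_const * (mean_order / min_scale) * p ^ card (placed a \<union> placed b \<union> placed c))"
    unfolding overlap_sum4_def
  proof (intro sum_mono)
    fix a b c
    show "(\<Sum>d\<in>meeting (placed a \<union> placed b \<union> placed c). p ^ card (placed a \<union> placed b \<union> placed c \<union> placed d))
      \<le> overlap_const * (mean_order / min_scale) * p ^ card (placed a \<union> placed b \<union> placed c)"
      using card_Union_placed3[of a b c] sum_meeting_le[of "placed a \<union> placed b \<union> placed c"] by (simp add: Un_commute)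
  qed
  also have "\<dots> = overlap_const * (mean_order / min_scale) * overlap_sum3"
    by (simp add: overlap_sum3_def sum_distrib_left)
  also have "\<dots> \<le> overlap_const * (mean_order / min_scale) * (overlap_const ^ 2 * mean_order ^ 3 / min_scale ^ 2)"
    using overlap_sum3_le overlap_const_pos mean_order_pos min_scale_pos by (intro mult_left_mono) auto
  finally show ?thesis by (simp add: power2_eq_square power3_eq_cube power4_eq_xxxx mult_ac)
qed

definition agreeing :: "'a set \<Rightarrow> ('a \<Rightarrow> nat) \<Rightarrow> ('a \<Rightarrow> nat) set" where
  "agreeing D a = {b \<in> placements. \<forall>x\<in>D. b x = a x}"

lemma finite_agreeing [simp]: "finite (agreeing D a)"
  by (simp add: agreeing_def)

lemma card_agreeing_ge:
  assumes D: "D \<subseteq> V" and a: "inj_on a D" "a ` D \<subseteq> {1..n}"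
  shows "real (card (agreeing D a)) \<ge> (real n / 2) ^ (card V - card D)"
proof -
  let ?R = "V - D"
  let ?T = "{1..n} - a ` D"
  let ?I = "{g \<in> ?R \<rightarrow>\<^sub>E ?T. inj_on g ?R}"
  let ?glue = "\<lambda>g x. if x \<in> D then a x else g x"
  have finD: "finite D" using D finite_V finite_subset by blast
  have cR: "card ?R = card V - card D" using D finD by (rule card_Diff_subset[rotated])
  have cD: "card D \<le> card V" using D finite_V by (rule card_mono[rotated])
  have cT: "card ?T = n - card D"
    using a finD by (subst card_Diff_subset) (auto simp: card_image)
  have "(real n / 2) ^ (card V - card D) \<le> real (n - card V) ^ (card V - card D)"
    using n_large by (intro power_mono) auto
  also have "\<dots> = real ((card ?T - card ?R) ^ card ?R)"
    using cD n_large unfolding cR cT by (simp add: of_nat_diff)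
  also have "\<dots> \<le> real (card ?I)"
    using finite_V by (simp only: of_nat_le_iff) (intro card_injections_ge, auto)
  also have "card ?I = card (?glue ` ?I)"
  proof (rule card_image[symmetric], rule inj_onI)
    fix g h assume g: "g \<in> ?I" and h: "h \<in> ?I" and eq: "?glue g = ?glue h"
    have "g x = h x" if "x \<in> ?R" for x using fun_cong[OF eq, of x] that by simp
    then show "g = h" using g h by (intro PiE_ext[of g ?R "\<lambda>_. ?T" h]) auto
  qed
  also have "\<dots> \<le> card (agreeing D a)"
  proof (rule card_mono, simp, rule subsetI)
    fix f assume "f \<in> ?glue ` ?I"
    then obtain g where g: "g \<in> ?I" "f = ?glue g" by blast
    have "f \<in> V \<rightarrow>\<^sub>E {1..n}" using g a D by (auto simp: PiE_iff extensional_def)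
    moreover have "inj_on f V"
    proof (rule inj_onI)
      fix x y assume xy: "x \<in> V" "y \<in> V" "f x = f y"
      have "g z \<in> ?T" if "z \<in> ?R" for z using g that by blast
      then show "x = y"
      proof (cases "x \<in> D \<longleftrightarrow> y \<in> D")
        case True
        have "inj_on g ?R" using g by simp
        with True xy show ?thesis
          using inj_onD[OF a(1), of x y] inj_onD[of g ?R x y] by (cases "x \<in> D") (simp_all add: g(2))
      next
        case False
        with xy \<open>\<And>z. z \<in> ?R \<Longrightarrow> g z \<in> ?T\<close>[of x] \<open>\<And>z. z \<in> ?R \<Longrightarrow> g z \<in> ?T\<close>[of y]
        have "f x \<noteq> f y" using imageI[of x D a] imageI[of y D a] by (cases "x \<in> D") (auto simp: g(2))
        with xy show ?thesis by simp
      qed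
    qed
    ultimately show "f \<in> agreeing D a" using g by (auto simp: agreeing_def placements_def)
  qed
  finally show ?thesis by simp
qed

lemma card_agreeing_ge':
  assumes D: "D \<subseteq> V" and a: "a \<in> placements"
  shows "real (card (agreeing D a)) \<ge> real n ^ (card V - card D) / 2 ^ card V"
proof -
  have "real n ^ (card V - card D) / 2 ^ card V \<le> real n ^ (card V - card D) / 2 ^ (card V - card D)"
    by (intro divide_left_mono power_increasing) auto
  also have "\<dots> = (real n / 2) ^ (card V - card D)" by (simp add: power_divide)
  also have "\<dots> \<le> card (agreeing D a)"
    using a D by (intro card_agreeing_ge) (auto simp: placements_def intro: inj_on_subset)
  finally show ?thesis .
qed

lemma card_placements_ge: "real (card placements) \<ge> real n ^ card V / 2 ^ card V"
  using card_agreeing_ge[of "{}" undefined] by (simp add: agreeing_def power_divide)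

lemma placed_agreeing:
  assumes "S \<subseteq> E" "\<Union>S \<subseteq> D" "b \<in> agreeing D a"
  shows "(\<lambda>x. a ` x) ` S \<subseteq> placed b"
proof
  fix y assume "y \<in> (\<lambda>x. a ` x) ` S"
  then obtain x where x: "x \<in> S" "y = a ` x" by blast
  have "y = b ` x" unfolding x(2) using assms x(1) by (intro image_cong) (auto simp: agreeing_def)
  then show "y \<in> placed b" using assms x by (auto simp: placed_def)
qed

lemma self_agreeing: "a \<in> placements \<Longrightarrow> a \<in> agreeing D a"
  by (simp add: agreeing_def)

end

section \<open>The random hypergraph and its centred indicators\<close>

text \<open>Functions of disjoint groups of independent coins are uncorrelated, also for complex values.\<close>

lemma Pi_pmf_expectation_mult:
  fixes g h :: "('k \<Rightarrow> bool) \<Rightarrow> 'b::{real_normed_field, banach, second_countable_topology}"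
  assumes K: "finite K" and A: "A \<subseteq> K"
    and g: "\<And>w w'. (\<And>x. x \<in> A \<Longrightarrow> w x = w' x) \<Longrightarrow> g w = g w'"
    and h: "\<And>w w'. (\<And>x. x \<in> K - A \<Longrightarrow> w x = w' x) \<Longrightarrow> h w = h w'"
  shows "measure_pmf.expectation (Pi_pmf K False B) (\<lambda>w. g w * h w) =
    measure_pmf.expectation (Pi_pmf K False B) g * measure_pmf.expectation (Pi_pmf K False B) h"
proof -
  let ?M = "Pi_pmf A False B" and ?N = "Pi_pmf (K - A) False B"
  let ?merge = "\<lambda>(f, g) x. if x \<in> A then f x else g x"
  have fin: "finite (set_pmf (Pi_pmf F False B))" if "finite F" for F :: "'k set"
    using that by (intro finite_subset[OF set_Pi_pmf_subset'[OF that]] finite_PiE_dflt) auto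
  have finA: "finite A" using A K finite_subset by blast
  have finM: "finite (set_pmf ?M)" and finN: "finite (set_pmf ?N)" using fin finA K by auto
  have eq: "Pi_pmf K False B = map_pmf ?merge (pair_pmf ?M ?N)"
    using Pi_pmf_union[of A "K - A" False B] finA K A by (simp add: Un_absorb1)
  have gm: "g (?merge (a, b)) = g a" for a b by (rule g) simp
  have hm: "h (?merge (a, b)) = h b" for a b by (rule h) simp
  have int: "measure_pmf.expectation (pair_pmf ?M ?N) F =
      (\<Sum>a\<in>set_pmf ?M. \<Sum>b\<in>set_pmf ?N. (pmf ?M a * pmf ?N b) *\<^sub>R F (a, b))"
    for F :: "_ \<Rightarrow> 'b"
  proof -
    have "measure_pmf.expectation (pair_pmf ?M ?N) F
      = (\<Sum>z\<in>set_pmf ?M \<times> set_pmf ?N. pmf (pair_pmf ?M ?N) z *\<^sub>R F z)"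
      using finM finN by (intro integral_measure_pmf) auto
    also have "\<dots> = (\<Sum>a\<in>set_pmf ?M. \<Sum>b\<in>set_pmf ?N. (pmf ?M a * pmf ?N b) *\<^sub>R F (a, b))"
      by (auto simp: sum.cartesian_product pmf_pair intro!: sum.cong)
    finally show ?thesis .
  qed
  have one: "(\<Sum>a\<in>set_pmf ?M. pmf ?M a) = 1" "(\<Sum>b\<in>set_pmf ?N. pmf ?N b) = 1"
    using sum_pmf_eq_1 finM finN by auto
  have E: "measure_pmf.expectation (Pi_pmf K False B) F = (\<Sum>a\<in>set_pmf ?M. \<Sum>b\<in>set_pmf ?N. (pmf ?M a * pmf ?N b) *\<^sub>R F (?merge (a, b)))"
    for F :: "_ \<Rightarrow> 'b" unfolding eq by (simp only: integral_map_pmf int)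
  have Eg: "measure_pmf.expectation (Pi_pmf K False B) g = (\<Sum>a\<in>set_pmf ?M. pmf ?M a *\<^sub>R g a)"
    unfolding E gm using one by (simp flip: scaleR_sum_left sum_distrib_left)
  have Eh: "measure_pmf.expectation (Pi_pmf K False B) h = (\<Sum>b\<in>set_pmf ?N. pmf ?N b *\<^sub>R h b)"
  proof -
    have "measure_pmf.expectation (Pi_pmf K False B) h = (\<Sum>b\<in>set_pmf ?N. \<Sum>a\<in>set_pmf ?M. (pmf ?M a * pmf ?N b) *\<^sub>R h b)"
      unfolding E hm by (rule sum.swap)
    then show ?thesis using one by (simp flip: scaleR_sum_left sum_distrib_right)
  qed
  show ?thesis unfolding Eg Eh sum_product unfolding E gm hm by (simp add: mult.commute)
qed

context random_pattern
begin

definition ground :: "nat set set" where "ground = Pow {1..n} - {{}}"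
definition coins :: "(nat set \<Rightarrow> bool) pmf" where "coins = Pi_pmf ground False (\<lambda>_. bernoulli_pmf p)"

abbreviation expect :: "((nat set \<Rightarrow> bool) \<Rightarrow> 'b::{banach, second_countable_topology}) \<Rightarrow> 'b" where
  "expect \<equiv> measure_pmf.expectation coins"

definition present :: "nat set set \<Rightarrow> (nat set \<Rightarrow> bool) \<Rightarrow> real" where
  "present U w = of_bool (\<forall>x\<in>U. w x)"

definition centred :: "('a \<Rightarrow> nat) \<Rightarrow> (nat set \<Rightarrow> bool) \<Rightarrow> real" where
  "centred f w = present (placed f) w - pw p (placed f)"

definition centred_total :: "(nat set \<Rightarrow> bool) \<Rightarrow> real" where
  "centred_total w = (\<Sum>f\<in>placements. centred f w)"

definition cov :: "('a \<Rightarrow> nat) \<Rightarrow> ('a \<Rightarrow> nat) \<Rightarrow> real" where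
  "cov a b = pw2 a b - pw p (placed a) * pw p (placed b)"

lemma finite_ground: "finite ground" by (simp add: ground_def)

lemma finite_set_coins: "finite (set_pmf coins)"
  unfolding coins_def
  using finite_ground by (intro finite_subset[OF set_Pi_pmf_subset'] finite_PiE_dflt) auto

lemma integrable_coins [simp]:
  "integrable coins (f :: (nat set \<Rightarrow> bool) \<Rightarrow> 'b::{banach, second_countable_topology})"
  by (rule integrable_measure_pmf_finite[OF finite_set_coins])

lemma coins_expectation_mult:
  fixes g h :: "(nat set \<Rightarrow> bool) \<Rightarrow> 'b::{real_normed_field, banach, second_countable_topology}"
  assumes "A \<subseteq> ground"
    and "\<And>w w'. (\<And>x. x \<in> A \<Longrightarrow> w x = w' x) \<Longrightarrow> g w = g w'"
    and "\<And>w w'. (\<And>x. x \<in> ground - A \<Longrightarrow> w x = w' x) \<Longrightarrow> h w = h w'"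
  shows "expect (\<lambda>w. g w * h w) = expect g * expect h"
  unfolding coins_def by (rule Pi_pmf_expectation_mult[OF finite_ground assms])

lemma placed_ground: "f \<in> placements \<Longrightarrow> placed f \<subseteq> ground"
  using placed_subset by (simp add: ground_def)

lemma present_Un: "present (U \<union> U') w = present U w * present U' w"
  by (auto simp: present_def)

lemma expect_present:
  assumes "U \<subseteq> ground" shows "expect (present U) = pw p U"
proof -
  have fin: "finite U" using assms finite_ground finite_subset by blast
  have "expect (present U) = expect (\<lambda>w. \<Prod>x\<in>ground. (if x \<in> U then of_bool (w x) else 1))"
  proof (intro arg_cong[where f=expect] ext)
    fix w
    have "(\<Prod>x\<in>ground. (if x \<in> U then of_bool (w x) else 1 :: real)) = (\<Prod>x\<in>U. of_bool (w x))"
      using assms finite_ground by (simp add: prod.If_cases Int_absorb1)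
    also have "\<dots> = present U w" using fin by (induction U rule: finite_induct) (auto simp: present_def)
    finally show "present U w = (\<Prod>x\<in>ground. (if x \<in> U then of_bool (w x) else 1))" ..
  qed
  also have "\<dots> = (\<Prod>x\<in>ground. measure_pmf.expectation (bernoulli_pmf p) (\<lambda>b. if x \<in> U then of_bool b else 1))"
    unfolding coins_def by (intro expectation_prod_Pi_pmf finite_ground integrable_measure_pmf_finite) auto
  also have "\<dots> = (\<Prod>x\<in>ground. if x \<in> U then p else 1)"
    using p_pos p_less_1 by (intro prod.cong) auto
  also have "\<dots> = pw p U"
    using assms finite_ground by (simp add: prod.If_cases Int_absorb1 pw_def)
  finally show ?thesis .
qed

lemma expect_centred: "a \<in> placements \<Longrightarrow> expect (centred a) = 0"
  unfolding centred_def by (simp add: expect_present placed_ground)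

lemma expect_centred2:
  assumes "a \<in> placements" "b \<in> placements"
  shows "expect (\<lambda>w. centred a w * centred b w) = cov a b"
proof -
  let ?A = "placed a" and ?B = "placed b"
  have "expect (\<lambda>w. centred a w * centred b w)
    = expect (\<lambda>w. present (?A \<union> ?B) w - pw p ?B * present ?A w - pw p ?A * present ?B w + pw p ?A * pw p ?B)"
    by (intro arg_cong[where f=expect] ext) (simp add: centred_def present_Un algebra_simps)
  also have "\<dots> = cov a b"
    using assms by (simp add: expect_present placed_ground cov_def)
  finally show ?thesis .
qed

lemma expect_centred3:
  assumes "a \<in> placements" "b \<in> placements" "c \<in> placements"
  shows "expect (\<lambda>w. centred a w * centred b w * centred c w) = kap3 a b c"
proof -
  let ?A = "placed a" and ?B = "placed b" and ?C = "placed c"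
  have "expect (\<lambda>w. centred a w * centred b w * centred c w)
    = expect (\<lambda>w. present (?A \<union> ?B \<union> ?C) w
        - pw p ?C * present (?A \<union> ?B) w - pw p ?B * present (?A \<union> ?C) w - pw p ?A * present (?B \<union> ?C) w
        + pw p ?B * pw p ?C * present ?A w + pw p ?A * pw p ?C * present ?B w + pw p ?A * pw p ?B * present ?C w
        - pw p ?A * pw p ?B * pw p ?C)"
    by (intro arg_cong[where f=expect] ext) (simp add: centred_def present_Un algebra_simps)
  also have "\<dots> = kappa3 p ?A ?B ?C"
    using assms by (simp add: expect_present placed_ground kappa3_def)
  finally show ?thesis .
qed

lemma expect_centred4:
  assumes "a \<in> placements" "b \<in> placements" "c \<in> placements" "d \<in> placements"
  shows "expect (\<lambda>w. centred a w * centred b w * centred c w * centred d w)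
    = kap4 a b c d
      + cov a b * cov c d + cov a c * cov b d + cov a d * cov b c"
proof -
  let ?A = "placed a" and ?B = "placed b" and ?C = "placed c" and ?D = "placed d"
  let ?a = "pw p ?A" and ?b = "pw p ?B" and ?c = "pw p ?C" and ?d = "pw p ?D"
  have "expect (\<lambda>w. centred a w * centred b w * centred c w * centred d w)
    = expect (\<lambda>w. present (?A \<union> ?B \<union> ?C \<union> ?D) w
        - ?d * present (?A \<union> ?B \<union> ?C) w - ?c * present (?A \<union> ?B \<union> ?D) w
        - ?b * present (?A \<union> ?C \<union> ?D) w - ?a * present (?B \<union> ?C \<union> ?D) w
        + ?c * ?d * present (?A \<union> ?B) w + ?b * ?d * present (?A \<union> ?C) w + ?b * ?c * present (?A \<union> ?D) w
        + ?a * ?d * present (?B \<union> ?C) w + ?a * ?c * present (?B \<union> ?D) w + ?a * ?b * present (?C \<union> ?D) w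
        - ?b * ?c * ?d * present ?A w - ?a * ?c * ?d * present ?B w
        - ?a * ?b * ?d * present ?C w - ?a * ?b * ?c * present ?D w + ?a * ?b * ?c * ?d)"
    by (intro arg_cong[where f=expect] ext) (simp add: centred_def present_Un algebra_simps)
  also have "\<dots> = kappa4 p ?A ?B ?C ?D + cov a b * cov c d + cov a c * cov b d + cov a d * cov b c"
    using assms by (simp add: expect_present placed_ground kappa4_def cov_def) (simp add: algebra_simps)
  finally show ?thesis .
qed

definition Var :: real where "Var = (\<Sum>a\<in>placements. \<Sum>b\<in>placements. cov a b)"

lemma expect_centred_total: "expect centred_total = 0"
  unfolding centred_total_def by (simp add: expect_centred)

lemma expect_centred_total2: "expect (\<lambda>w. (centred_total w)\<^sup>2) = Var"
proof -
  have "expect (\<lambda>w. (centred_total w)\<^sup>2) = expect (\<lambda>w. \<Sum>a\<in>placements. \<Sum>b\<in>placements. centred a w * centred b w)"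
    by (simp add: centred_total_def power2_eq_square sum_product)
  also have "\<dots> = Var"
    by (simp add: Bochner_Integration.integral_sum Var_def expect_centred2)
  finally show ?thesis .
qed

lemma expect_centred_total3: "expect (\<lambda>w. centred_total w ^ 3) =
  sum3 kap3"
proof -
  have "expect (\<lambda>w. centred_total w ^ 3)
    = expect (\<lambda>w. \<Sum>a\<in>placements. \<Sum>b\<in>placements. \<Sum>c\<in>placements. centred a w * centred b w * centred c w)"
    by (simp add: centred_total_def power3_eq_cube sum_distrib_left sum_distrib_right mult_ac)
  also have "\<dots> = sum3 kap3"
    by (simp add: Bochner_Integration.integral_sum expect_centred3)
  finally show ?thesis .
qed

lemma expect_centred_total4: "expect (\<lambda>w. centred_total w ^ 4) =
  sum4 kap4
  + 3 * Var\<^sup>2"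
proof -
  let ?P = placements
  let ?s = "\<lambda>F. \<Sum>a\<in>?P. \<Sum>b\<in>?P. \<Sum>c\<in>?P. \<Sum>d\<in>?P. F a b c d :: real"
  have "expect (\<lambda>w. centred_total w ^ 4)
    = expect (\<lambda>w. ?s (\<lambda>a b c d. centred a w * centred b w * centred c w * centred d w))"
    by (simp add: centred_total_def power4_eq_xxxx sum_distrib_left sum_distrib_right mult_ac)
  also have "\<dots> = ?s (\<lambda>a b c d. kap4 a b c d
      + cov a b * cov c d + cov a c * cov b d + cov a d * cov b c)"
    by (simp add: Bochner_Integration.integral_sum expect_centred4)
  also have "\<dots> = ?s kap4
      + ?s (\<lambda>a b c d. cov a b * cov c d) + ?s (\<lambda>a b c d. cov a c * cov b d) + ?s (\<lambda>a b c d. cov a d * cov b c)"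
    by (simp only: sum.distrib)
  also have "?s (\<lambda>a b c d. cov a b * cov c d) = Var\<^sup>2"
    by (simp add: Var_def power2_eq_square flip: sum_distrib_left sum_distrib_right)
  also have "?s (\<lambda>a b c d. cov a c * cov b d) = Var\<^sup>2"
    by (simp add: Var_def power2_eq_square flip: sum_distrib_left sum_distrib_right)
  also have "?s (\<lambda>a b c d. cov a d * cov b c) = Var\<^sup>2"
    by (simp add: Var_def power2_eq_square flip: sum_distrib_left sum_distrib_right)
  finally show ?thesis by simp
qed

lemma meeting_Un: "meeting (U \<union> U') = meeting U \<union> meeting U'"
  by (auto simp: meeting_def)

lemma centred_cong:
  assumes "\<And>x. x \<in> placed f \<Longrightarrow> w x = w' x" shows "centred f w = centred f w'"
  using assms by (simp add: centred_def present_def)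

lemma centred_far_cong:
  assumes "f \<in> placements - meeting U" "\<And>x. x \<in> ground - U \<Longrightarrow> w x = w' x"
  shows "centred f w = centred f w'"
  using assms placed_ground[of f] by (intro centred_cong) (auto simp: meeting_def)

text \<open>The placements that do not meet \<open>U\<close> only use coins outside \<open>U\<close>.\<close>

lemma far_indep:
  assumes U: "U \<subseteq> ground"
    and g: "\<And>w w'. (\<And>x. x \<in> U \<Longrightarrow> w x = w' x) \<Longrightarrow> g w = g w'"
  shows "expect (\<lambda>w. of_real (g w) * iexp (t * (\<Sum>l\<in>placements - meeting U. centred l w / s)))
    = of_real (expect g) * expect (\<lambda>w. iexp (t * (\<Sum>l\<in>placements - meeting U. centred l w / s)))"
proof -
  have "expect (\<lambda>w. complex_of_real (g w) * iexp (t * (\<Sum>l\<in>placements - meeting U. centred l w / s)))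
    = expect (\<lambda>w. complex_of_real (g w)) * expect (\<lambda>w. iexp (t * (\<Sum>l\<in>placements - meeting U. centred l w / s)))"
  proof (rule coins_expectation_mult[OF U])
    fix w w' :: "nat set \<Rightarrow> bool" assume "\<And>x. x \<in> U \<Longrightarrow> w x = w' x"
    then show "complex_of_real (g w) = complex_of_real (g w')" using g[of w w'] by simp
  next
    fix w w' :: "nat set \<Rightarrow> bool" assume *: "\<And>x. x \<in> ground - U \<Longrightarrow> w x = w' x"
    have "(\<Sum>l\<in>placements - meeting U. centred l w / s) = (\<Sum>l\<in>placements - meeting U. centred l w' / s)"
    proof (intro sum.cong refl)
      fix l assume "l \<in> placements - meeting U"
      then have "centred l w = centred l w'" by (rule centred_far_cong) (rule *)
      then show "centred l w / s = centred l w' / s" by simp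
    qed
    then show "iexp (t * (\<Sum>l\<in>placements - meeting U. centred l w / s)) = iexp (t * (\<Sum>l\<in>placements - meeting U. centred l w' / s))"
      by simp
  qed
  then show ?thesis by simp
qed

lemma cov_eq_0: "a \<in> placements \<Longrightarrow> b \<in> placements \<Longrightarrow> b \<notin> meeting (placed a) \<Longrightarrow> cov a b = 0"
  unfolding cov_def meeting_def using pw_disjoint[of "placed a" "placed b" p] by auto

lemma meeting_subset: "meeting U \<subseteq> placements" by (auto simp: meeting_def)

lemma Var_meeting: "Var = (\<Sum>a\<in>placements. \<Sum>b\<in>meeting (placed a). cov a b)"
  unfolding Var_def
  by (intro sum.cong[OF refl] sum.mono_neutral_right) (auto simp: meeting_subset cov_eq_0)

lemma local_dependence_centred:
  assumes "Var > 0"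
  shows "local_dependence coins placements (\<lambda>f w. centred f w / sqrt Var) (\<lambda>f. meeting (placed f))"
proof
  show "finite (set_pmf coins)" by (rule finite_set_coins)
  show "finite placements" by simp
  show "meeting (placed j) \<subseteq> placements" for j by (rule meeting_subset)
next
  fix j t assume j: "j \<in> placements"
  have "expect (\<lambda>w. of_real (centred j w / sqrt Var) * iexp (t * (\<Sum>l\<in>placements - meeting (placed j). centred l w / sqrt Var)))
    = of_real (expect (\<lambda>w. centred j w / sqrt Var)) * expect (\<lambda>w. iexp (t * (\<Sum>l\<in>placements - meeting (placed j). centred l w / sqrt Var)))"
  proof (rule far_indep[OF placed_ground[OF j]])
    fix w w' :: "nat set \<Rightarrow> bool" assume "\<And>x. x \<in> placed j \<Longrightarrow> w x = w' x"
    then have "centred j w = centred j w'" by (rule centred_cong)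
    then show "centred j w / sqrt Var = centred j w' / sqrt Var" by simp
  qed
  then show "expect (\<lambda>w. of_real (centred j w / sqrt Var) * iexp (t * (\<Sum>l\<in>placements - meeting (placed j). centred l w / sqrt Var))) = 0"
    using j by (simp add: expect_centred)
next
  fix j k t assume j: "j \<in> placements" and "k \<in> meeting (placed j)"
  then have k: "k \<in> placements" using meeting_subset by auto
  let ?U = "placed j \<union> placed k"
  show "expect (\<lambda>w. of_real (centred j w / sqrt Var * (centred k w / sqrt Var)) *
       iexp (t * (\<Sum>l\<in>placements - (meeting (placed j) \<union> meeting (placed k)). centred l w / sqrt Var)))
    = of_real (expect (\<lambda>w. centred j w / sqrt Var * (centred k w / sqrt Var))) *
      expect (\<lambda>w. iexp (t * (\<Sum>l\<in>placements - (meeting (placed j) \<union> meeting (placed k)). centred l w / sqrt Var)))"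
    unfolding meeting_Un[symmetric]
  proof (rule far_indep)
    show "?U \<subseteq> ground" using j k placed_ground by auto
    fix w w' :: "nat set \<Rightarrow> bool" assume "\<And>x. x \<in> ?U \<Longrightarrow> w x = w' x"
    then have "centred j w = centred j w'" "centred k w = centred k w'" by (auto intro: centred_cong)
    then show "centred j w / sqrt Var * (centred k w / sqrt Var) = centred j w' / sqrt Var * (centred k w' / sqrt Var)" by simp
  qed
next
  have "expect (\<lambda>w. centred j w / sqrt Var * (centred k w / sqrt Var)) = cov j k / Var"
    if "j \<in> placements" "k \<in> meeting (placed j)" for j k
    using that assms meeting_subset expect_centred2[of j k] by auto
  then have "(\<Sum>j\<in>placements. \<Sum>k\<in>meeting (placed j). expect (\<lambda>w. centred j w / sqrt Var * (centred k w / sqrt Var)))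
     = (\<Sum>j\<in>placements. \<Sum>k\<in>meeting (placed j). cov j k / Var)"
    by (intro sum.cong refl) auto
  also have "\<dots> = 1" using assms by (simp add: Var_meeting flip: sum_divide_distrib)
  finally show "(\<Sum>j\<in>placements. \<Sum>k\<in>meeting (placed j). expect (\<lambda>w. centred j w / sqrt Var * (centred k w / sqrt Var))) = 1" .
qed

lemma pw_placed: "f \<in> placements \<Longrightarrow> pw p (placed f) = p ^ card E"
  by (simp add: pw_def card_placed)

lemma one_minus_pw_le: "f \<in> placements \<Longrightarrow> 1 - pw p (placed f) \<le> card E * (1 - p)"
  using Bernoulli_inequality[of "p - 1" "card E"] p_pos by (simp add: pw_placed algebra_simps)

lemma abs_centred_eq: "\<bar>centred f w\<bar> = present (placed f) w * (1 - pw p (placed f)) + pw p (placed f) * (1 - present (placed f) w)"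
  using pw_pos[OF p_pos, of "placed f"] pw_le_1[OF p_pos p_less_1, of "placed f"]
  by (auto simp: centred_def present_def)

lemma abs_centred_le: "\<bar>centred f w\<bar> \<le> present (placed f) w + pw p (placed f)"
  using pw_pos[OF p_pos, of "placed f"] by (auto simp: centred_def present_def)

text \<open>The gain over the trivial bound is the factor \<open>1 - p\<close>. If the edges of \<open>a\<close> are all present, then \<open>centred a\<close> is
\<open>1 - p^card E\<close>, which is at most of this order; otherwise it has absolute value \<open>p^card E\<close>, and the event that
\<open>U\<close> is present but \<open>a\<close> is not is also small by such a factor.\<close>

lemma expect_abs_centred_present:
  assumes a: "a \<in> placements" and U: "U \<subseteq> ground"
  shows "expect (\<lambda>w. \<bar>centred a w\<bar> * present U w) \<le> 2 * (card E * (1 - p)) * pw p (placed a \<union> U)"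
proof -
  let ?A = "placed a" let ?m = "pw p ?A" let ?e = "card E * (1 - p)"
  have fin: "finite U" using U finite_ground finite_subset by blast
  have m: "0 < ?m" "?m \<le> 1" using pw_pos pw_le_1 p_pos p_less_1 by auto
  have "expect (\<lambda>w. \<bar>centred a w\<bar> * present U w)
    = expect (\<lambda>w. (1 - ?m) * present (?A \<union> U) w + ?m * present U w - ?m * present (?A \<union> U) w)"
    by (intro arg_cong[where f=expect] ext) (simp add: abs_centred_eq present_Un algebra_simps)
  also have "\<dots> = (1 - ?m) * pw p (?A \<union> U) + ?m * (pw p U - pw p (?A \<union> U))"
    using U placed_ground[OF a] by (simp add: expect_present algebra_simps)
  also have "\<dots> \<le> ?e * pw p (?A \<union> U) + ?e * pw p (?A \<union> U)"
  proof (intro add_mono)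
    show "(1 - ?m) * pw p (?A \<union> U) \<le> ?e * pw p (?A \<union> U)"
      using one_minus_pw_le[OF a] pw_pos[OF p_pos, of "?A \<union> U"] by (intro mult_right_mono) auto
    have "pw p U * ?m \<le> pw p (?A \<union> U)"
      using pw_Un_le_mult[OF p_pos p_less_1, of ?A U] by (simp add: mult.commute)
    then have "pw p U - pw p (?A \<union> U) \<le> pw p U * (1 - ?m)"
      by (simp add: algebra_simps)
    then have "?m * (pw p U - pw p (?A \<union> U)) \<le> ?m * (pw p U * (1 - ?m))"
      using m by (intro mult_left_mono) auto
    also have "\<dots> = (1 - ?m) * (pw p U * ?m)" by simp
    also have "\<dots> \<le> ?e * pw p (?A \<union> U)"
      using one_minus_pw_le[OF a] \<open>pw p U * ?m \<le> pw p (?A \<union> U)\<close> m pw_pos[OF p_pos, of U] p_less_1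
      by (intro mult_mono) auto
    finally show "?m * (pw p U - pw p (?A \<union> U)) \<le> ?e * pw p (?A \<union> U)" .
  qed
  finally show ?thesis by (simp add: mult_ac)
qed

lemma present_empty: "present {} w = 1" by (simp add: present_def)

lemma present_nonneg: "0 \<le> present U w" by (simp add: present_def)

lemma expect_abs_centred:
  assumes "a \<in> placements"
  shows "expect (\<lambda>w. \<bar>centred a w\<bar>) \<le> 2 * (card E * (1 - p)) * pw p (placed a)"
  using expect_abs_centred_present[OF assms, of "{}"] by (simp add: present_empty)

lemma expect_abs_centred_trivial:
  assumes "a \<in> placements"
  shows "expect (\<lambda>w. \<bar>centred a w\<bar>) \<le> 2 * pw p (placed a)"
proof -
  have "expect (\<lambda>w. \<bar>centred a w\<bar>) \<le> expect (\<lambda>w. present (placed a) w + pw p (placed a))"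
    by (intro integral_mono abs_centred_le) simp_all
  also have "\<dots> = 2 * pw p (placed a)" using assms by (simp add: expect_present placed_ground)
  finally show ?thesis .
qed

lemma expect_abs_centred2:
  assumes ab: "a \<in> placements" "b \<in> placements"
  shows "expect (\<lambda>w. \<bar>centred a w * centred b w\<bar>) \<le> 4 * (card E * (1 - p)) * pw2 a b"
proof -
  let ?e = "card E * (1 - p)" let ?m = "pw p (placed b)"
  have e: "?e \<ge> 0" using p_less_1 by simp
  have m: "?m > 0" using pw_pos p_pos by auto
  have "expect (\<lambda>w. \<bar>centred a w * centred b w\<bar>) \<le>
    expect (\<lambda>w. \<bar>centred a w\<bar> * present (placed b) w + ?m * \<bar>centred a w\<bar>)"
  proof (intro integral_mono)
    fix w
    show "\<bar>centred a w * centred b w\<bar> \<le> \<bar>centred a w\<bar> * present (placed b) w + ?m * \<bar>centred a w\<bar>"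
      using mult_left_mono[OF abs_centred_le[of b w], of "\<bar>centred a w\<bar>"] by (simp add: abs_mult algebra_simps)
  qed simp_all
  also have "\<dots> = expect (\<lambda>w. \<bar>centred a w\<bar> * present (placed b) w) + ?m * expect (\<lambda>w. \<bar>centred a w\<bar>)" by simp
  also have "\<dots> \<le> 2 * ?e * pw2 a b + ?m * (2 * ?e * pw p (placed a))"
    using ab m by (intro add_mono mult_left_mono expect_abs_centred_present expect_abs_centred placed_ground) auto
  also have "?m * (2 * ?e * pw p (placed a)) = 2 * ?e * (pw p (placed a) * ?m)" by simp
  also have "\<dots> \<le> 2 * ?e * pw2 a b"
    using e by (intro mult_left_mono pw_Un_le_mult p_pos p_less_1) auto
  finally show ?thesis by (simp add: mult_ac)
qed

lemma expect_abs_centred3: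
  assumes abc: "a \<in> placements" "b \<in> placements" "c \<in> placements"
  shows "expect (\<lambda>w. \<bar>centred a w * centred b w * centred c w\<bar>) \<le> 8 * (card E * (1 - p)) * pw3 a b c"
proof -
  let ?e = "card E * (1 - p)" let ?A = "placed a" let ?B = "placed b" let ?C = "placed c"
  let ?u = "pw p (?A \<union> ?B \<union> ?C)"
  have e: "?e \<ge> 0" using p_less_1 by simp
  have pos: "pw p U > 0" for U :: "nat set set" using pw_pos p_pos by auto
  have "expect (\<lambda>w. \<bar>centred a w * centred b w * centred c w\<bar>) \<le>
    expect (\<lambda>w. \<bar>centred a w\<bar> * present (?B \<union> ?C) w + pw p ?C * (\<bar>centred a w\<bar> * present ?B w)
       + pw p ?B * (\<bar>centred a w\<bar> * present ?C w) + pw p ?B * pw p ?C * \<bar>centred a w\<bar>)"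
  proof (intro integral_mono)
    fix w
    have "\<bar>centred b w\<bar> * \<bar>centred c w\<bar> \<le> (present ?B w + pw p ?B) * (present ?C w + pw p ?C)"
      using pos[of ?B] present_nonneg by (intro mult_mono abs_centred_le add_nonneg_nonneg) auto
    from mult_left_mono[OF this, of "\<bar>centred a w\<bar>"]
    show "\<bar>centred a w * centred b w * centred c w\<bar> \<le> \<bar>centred a w\<bar> * present (?B \<union> ?C) w + pw p ?C * (\<bar>centred a w\<bar> * present ?B w)
       + pw p ?B * (\<bar>centred a w\<bar> * present ?C w) + pw p ?B * pw p ?C * \<bar>centred a w\<bar>"
      by (simp add: abs_mult present_Un algebra_simps)
  qed simp_all
  also have "\<dots> = expect (\<lambda>w. \<bar>centred a w\<bar> * present (?B \<union> ?C) w) + pw p ?C * expect (\<lambda>w. \<bar>centred a w\<bar> * present ?B w)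
       + pw p ?B * expect (\<lambda>w. \<bar>centred a w\<bar> * present ?C w) + pw p ?B * pw p ?C * expect (\<lambda>w. \<bar>centred a w\<bar>)"
    by simp
  also have "\<dots> \<le> 2 * ?e * pw p (?A \<union> (?B \<union> ?C)) + pw p ?C * (2 * ?e * pw p (?A \<union> ?B))
       + pw p ?B * (2 * ?e * pw p (?A \<union> ?C)) + pw p ?B * pw p ?C * (2 * ?e * pw p ?A)"
    using abc pos[THEN less_imp_le] placed_ground
    by (intro add_mono mult_left_mono expect_abs_centred_present expect_abs_centred mult_nonneg_nonneg Un_least) auto
  also have "\<dots> = 2 * ?e * ?u + 2 * ?e * (pw p (?A \<union> ?B) * pw p ?C)
       + 2 * ?e * (pw p (?A \<union> ?C) * pw p ?B) + 2 * ?e * (pw p ?A * pw p ?B * pw p ?C)"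
    by (simp add: Un_assoc)
  also have "\<dots> \<le> 2 * ?e * ?u + 2 * ?e * ?u + 2 * ?e * ?u + 2 * ?e * ?u"
  proof (intro add_mono mult_left_mono)
    show 1: "pw p (?A \<union> ?B) * pw p ?C \<le> ?u" by (intro pw_Un_le_mult p_pos p_less_1)
    show "pw p (?A \<union> ?C) * pw p ?B \<le> ?u"
      using pw_Un_le_mult[OF p_pos p_less_1, of "?A \<union> ?C" ?B] by (simp add: Un_ac)
    have "pw p ?A * pw p ?B * pw p ?C \<le> pw p (?A \<union> ?B) * pw p ?C"
      using pos[of ?C] by (intro mult_right_mono pw_Un_le_mult p_pos p_less_1) auto
    with 1 show "pw p ?A * pw p ?B * pw p ?C \<le> ?u" by linarith
  qed (use e in auto)
  finally show ?thesis by (simp add: mult_ac)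
qed

text \<open>The triples in the error term are exactly those in which each placement meets the union of its predecessors,
and a product of moments over a divided triple is not larger than the probability bound for the joint one.\<close>

lemma local_error_le:
  assumes V: "Var > 0"
  shows "local_dependence.local_error coins placements (\<lambda>f w. centred f w / sqrt Var) (\<lambda>f. meeting (placed f))
    \<le> 16 * (card E * (1 - p)) * overlap_sum3 / sqrt Var ^ 3"
proof -
  let ?e = "card E * (1 - p)"
  define s where "s = sqrt Var"
  have s: "s > 0" using V by (simp add: s_def)
  have e: "?e \<ge> 0" using p_less_1 by simp
  have term_le: "expect (\<lambda>w. \<bar>centred a w / s * (centred b w / s) * (centred c w / s)\<bar>)
      + expect (\<lambda>w. \<bar>centred a w / s * (centred b w / s)\<bar>) * expect (\<lambda>w. \<bar>centred c w / s\<bar>)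
    \<le> 16 * ?e * p ^ card (placed a \<union> placed b \<union> placed c) / s ^ 3"
    if abc: "a \<in> placements" "b \<in> placements" "c \<in> placements" for a b c
  proof -
    let ?u = "pw3 a b c"
    have "expect (\<lambda>w. \<bar>centred a w * centred b w\<bar>) * expect (\<lambda>w. \<bar>centred c w\<bar>)
      \<le> (4 * ?e * pw2 a b) * (2 * pw p (placed c))"
      using abc e pw_pos[OF p_pos, of "placed a \<union> placed b"]
      by (intro mult_mono expect_abs_centred2 expect_abs_centred_trivial) auto
    also have "\<dots> = 8 * ?e * (pw2 a b * pw p (placed c))" by simp
    also have "\<dots> \<le> 8 * ?e * ?u" using e by (intro mult_left_mono pw_Un_le_mult p_pos p_less_1) auto
    finally have "expect (\<lambda>w. \<bar>centred a w * centred b w * centred c w\<bar>)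
       + expect (\<lambda>w. \<bar>centred a w * centred b w\<bar>) * expect (\<lambda>w. \<bar>centred c w\<bar>) \<le> 16 * ?e * ?u"
      using expect_abs_centred3[OF abc] by linarith
    then have "(expect (\<lambda>w. \<bar>centred a w * centred b w * centred c w\<bar>)
       + expect (\<lambda>w. \<bar>centred a w * centred b w\<bar>) * expect (\<lambda>w. \<bar>centred c w\<bar>)) / s ^ 3 \<le> 16 * ?e * ?u / s ^ 3"
      using s by (intro divide_right_mono) auto
    moreover have "expect (\<lambda>w. \<bar>centred a w / s * (centred b w / s) * (centred c w / s)\<bar>)
      = expect (\<lambda>w. \<bar>centred a w * centred b w * centred c w\<bar>) / s ^ 3"
      "expect (\<lambda>w. \<bar>centred a w / s * (centred b w / s)\<bar>) = expect (\<lambda>w. \<bar>centred a w * centred b w\<bar>) / s ^ 2"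
      "expect (\<lambda>w. \<bar>centred c w / s\<bar>) = expect (\<lambda>w. \<bar>centred c w\<bar>) / s"
      unfolding integral_divide_zero[symmetric]
      using s by (simp_all add: abs_mult power3_eq_cube power2_eq_square)
    ultimately show ?thesis
      using s by (simp add: pw_def add_divide_distrib power3_eq_cube power2_eq_square abs_mult)
  qed
  have "local_dependence.local_error coins placements (\<lambda>f w. centred f w / sqrt Var) (\<lambda>f. meeting (placed f))
    \<le> (\<Sum>a\<in>placements. \<Sum>b\<in>meeting (placed a). \<Sum>c\<in>meeting (placed a) \<union> meeting (placed b).
       16 * ?e * p ^ card (placed a \<union> placed b \<union> placed c) / s ^ 3)"
    unfolding local_dependence.local_error_def[OF local_dependence_centred[OF V]]
    unfolding s_def[symmetric] using meeting_subset by (intro sum_mono term_le) auto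
  also have "\<dots> = 16 * ?e * overlap_sum3 / s ^ 3"
    unfolding overlap_sum3_def meeting_Un by (simp add: sum_distrib_left sum_divide_distrib)
  finally show ?thesis by (simp only: s_def)
qed

end

section \<open>Sums of covariances and cumulants\<close>

lemma sum_rotate3:
  fixes F :: "'b \<Rightarrow> 'b \<Rightarrow> 'b \<Rightarrow> real"
  shows "(\<Sum>b\<in>P. \<Sum>c\<in>P. \<Sum>d\<in>P. F b d c) = (\<Sum>b\<in>P. \<Sum>c\<in>P. \<Sum>d\<in>P. F b c d)"
    "(\<Sum>b\<in>P. \<Sum>c\<in>P. \<Sum>d\<in>P. F c b d) = (\<Sum>b\<in>P. \<Sum>c\<in>P. \<Sum>d\<in>P. F b c d)"
    "(\<Sum>b\<in>P. \<Sum>c\<in>P. \<Sum>d\<in>P. F c d b) = (\<Sum>b\<in>P. \<Sum>c\<in>P. \<Sum>d\<in>P. F b c d)"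
    "(\<Sum>b\<in>P. \<Sum>c\<in>P. \<Sum>d\<in>P. F d b c) = (\<Sum>b\<in>P. \<Sum>c\<in>P. \<Sum>d\<in>P. F b c d)"
    "(\<Sum>b\<in>P. \<Sum>c\<in>P. \<Sum>d\<in>P. F d c b) = (\<Sum>b\<in>P. \<Sum>c\<in>P. \<Sum>d\<in>P. F b c d)"
proof -
  have inner: "(\<Sum>b\<in>P. \<Sum>c\<in>P. \<Sum>d\<in>P. F b d c) = (\<Sum>b\<in>P. \<Sum>c\<in>P. \<Sum>d\<in>P. F b c d)" for F :: "'b \<Rightarrow> 'b \<Rightarrow> 'b \<Rightarrow> real"
    by (rule sum.cong[OF refl], rule sum.swap)
  have outer: "(\<Sum>b\<in>P. \<Sum>c\<in>P. \<Sum>d\<in>P. F c b d) = (\<Sum>b\<in>P. \<Sum>c\<in>P. \<Sum>d\<in>P. F b c d)" for F :: "'b \<Rightarrow> 'b \<Rightarrow> 'b \<Rightarrow> real"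
    by (rule sum.swap)
  show "(\<Sum>b\<in>P. \<Sum>c\<in>P. \<Sum>d\<in>P. F b d c) = (\<Sum>b\<in>P. \<Sum>c\<in>P. \<Sum>d\<in>P. F b c d)" by (rule inner)
  show "(\<Sum>b\<in>P. \<Sum>c\<in>P. \<Sum>d\<in>P. F c b d) = (\<Sum>b\<in>P. \<Sum>c\<in>P. \<Sum>d\<in>P. F b c d)" by (rule outer)
  show 1: "(\<Sum>b\<in>P. \<Sum>c\<in>P. \<Sum>d\<in>P. F c d b) = (\<Sum>b\<in>P. \<Sum>c\<in>P. \<Sum>d\<in>P. F b c d)"
    using outer[of "\<lambda>c b d. F c d b"] inner[of "\<lambda>c d b. F c d b"] by simp
  show 2: "(\<Sum>b\<in>P. \<Sum>c\<in>P. \<Sum>d\<in>P. F d b c) = (\<Sum>b\<in>P. \<Sum>c\<in>P. \<Sum>d\<in>P. F b c d)"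
    using inner[of "\<lambda>b d c. F d b c"] outer[of "\<lambda>d b c. F d b c"] by simp
  show "(\<Sum>b\<in>P. \<Sum>c\<in>P. \<Sum>d\<in>P. F d c b) = (\<Sum>b\<in>P. \<Sum>c\<in>P. \<Sum>d\<in>P. F b c d)"
    using outer[of "\<lambda>c b d. F d c b"] inner[of "\<lambda>c d b. F d c b"] outer[of "\<lambda>d c b. F d c b"] by simp
qed

lemma card_union_core_le:
  assumes "finite A" "finite B" "C \<subseteq> A" "C \<subseteq> B"
  shows "card (A \<union> B) \<le> card A + (card B - card C)"
proof -
  have "A \<union> B = A \<union> (B - C)" using assms by auto
  then have "card (A \<union> B) \<le> card A + card (B - C)" using card_Un_le[of A "B - C"] by simp
  also have "card (B - C) = card B - card C" using assms finite_subset by (intro card_Diff_subset) auto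
  finally show ?thesis .
qed

context random_pattern
begin

text \<open>A subhypergraph at which \<open>min_scale\<close> is attained. Pairs of placements that agree on its vertices already give
the variance its order of magnitude.\<close>

definition minimiser :: "'a hypergraph" where
  "minimiser = (SOME F. edges F \<subseteq> E \<and> edges F \<noteq> {} \<and> \<Union>(edges F) \<subseteq> verts F \<and> verts F \<subseteq> V \<and>
     min_scale = p ^ card (edges F) * real n ^ card (verts F))"

lemma minimiser:
  "edges minimiser \<subseteq> E" "edges minimiser \<noteq> {}" "\<Union>(edges minimiser) \<subseteq> verts minimiser" "verts minimiser \<subseteq> V"
  "min_scale = p ^ card (edges minimiser) * real n ^ card (verts minimiser)"
proof -
  obtain S D where "S \<subseteq> E" "S \<noteq> {}" "\<Union>S \<subseteq> D" "D \<subseteq> V" "min_scale = p ^ card S * real n ^ card D"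
    by (rule min_scale_attained)
  then have "\<exists>F. edges F \<subseteq> E \<and> edges F \<noteq> {} \<and> \<Union>(edges F) \<subseteq> verts F \<and> verts F \<subseteq> V \<and>
     min_scale = p ^ card (edges F) * real n ^ card (verts F)"
    by (intro exI[of _ "(D, S)"]) simp
  from someI_ex[OF this, folded minimiser_def]
  show "edges minimiser \<subseteq> E" "edges minimiser \<noteq> {}" "\<Union>(edges minimiser) \<subseteq> verts minimiser" "verts minimiser \<subseteq> V"
    "min_scale = p ^ card (edges minimiser) * real n ^ card (verts minimiser)" by auto
qed

abbreviation twins :: "('a \<Rightarrow> nat) \<Rightarrow> ('a \<Rightarrow> nat) set" where
  "twins \<equiv> agreeing (verts minimiser)"

abbreviation "twinsum2 F \<equiv> (\<Sum>a\<in>placements. \<Sum>b\<in>twins a. F a b :: real)"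
abbreviation "twinsum3 F \<equiv> (\<Sum>a\<in>placements. \<Sum>b\<in>twins a. \<Sum>c\<in>twins a. F a b c :: real)"
abbreviation "twinsum4 F \<equiv> (\<Sum>a\<in>placements. \<Sum>b\<in>twins a. \<Sum>c\<in>twins a. \<Sum>d\<in>twins a. F a b c d :: real)"

text \<open>The overlap sums are of the right order already over placements that coincide with the first one on the
vertices of the minimiser: each further one has about \<open>n^(card V - v_F)\<close> choices and at most \<open>card E - e_F\<close>
new edges.\<close>

lemma twins_sums:
  shows twins_share: "a \<in> placements \<Longrightarrow> \<exists>C. C \<noteq> {} \<and> (\<forall>b\<in>twins a. C \<subseteq> placed b)"
    and twin_sum2: "mean_order\<^sup>2 / min_scale / 2 ^ (2 * card V) \<le> twinsum2 pw2"
    and twin_sum3: "mean_order ^ 3 / min_scale ^ 2 / 2 ^ (3 * card V) \<le>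
      twinsum3 pw3"
    and twin_sum4: "mean_order ^ 4 / min_scale ^ 3 / 2 ^ (4 * card V) \<le>
      twinsum4 pw4"
proof -
  let ?S = "edges minimiser" let ?D = "verts minimiser"
  note SD = minimiser(1-4) and min_scale = minimiser(5)
  let ?e = "card E" and ?v = "card V" and ?k = "card E - card ?S"
  \<comment> \<open>\<open>x\<close> bounds the number of twins from below, \<open>y\<close> the probability of the edges that one more twin adds\<close>
  define x where "x = real n ^ (card V - card ?D) / 2 ^ card V"
  define y where "y = p ^ ?k"
  have cS: "card ?S \<le> ?e" "card ?D \<le> ?v" using SD finite_E finite_V by (auto intro: card_mono)
  have x: "x \<ge> 0" by (simp add: x_def)
  have y: "y \<ge> 0" using p_pos by (simp add: y_def)
  have xy: "x * y = mean_order / min_scale / 2 ^ ?v"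
    using n_pos p_pos cS by (simp add: x_def y_def min_scale mean_order_def power_diff)
  have base: "real (card placements) * p ^ ?e \<ge> mean_order / 2 ^ ?v"
    using card_placements_ge mult_right_mono[of _ _ "p ^ ?e"] p_pos by (fastforce simp: mean_order_def)
  have ag: "real (card (twins a)) \<ge> x" if "a \<in> placements" for a
    unfolding x_def by (rule card_agreeing_ge'[OF SD(4) that])
  let ?core = "\<lambda>a. (\<lambda>x. a ` x) ` ?S"
  have core: "?core a \<subseteq> placed b" if "b \<in> twins a" for a b
    by (rule placed_agreeing[OF SD(1,3) that])
  have core_card: "card (?core a) = card ?S" if "a \<in> placements" for a
    using inj_on_image_edges[OF that] SD(1) by (intro card_image) (rule inj_on_subset)
  have ag_pl: "b \<in> placements" if "b \<in> twins a" for a b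
    using that by (simp add: agreeing_def)
  have step: "card (U \<union> placed b) \<le> card U + ?k"
    if "a \<in> placements" "b \<in> twins a" "finite U" "?core a \<subseteq> U" for a b U
    using card_union_core_le[OF that(3) finite_placed that(4) core[OF that(2)]] core_card[OF that(1)] card_placed[OF ag_pl[OF that(2)]]
    by simp
  have c1: "?core a \<subseteq> placed a" if "a \<in> placements" for a
    by (rule core[OF self_agreeing[OF that]])
  have c2: "card (placed a \<union> placed b) \<le> ?e + ?k" if "a \<in> placements" "b \<in> twins a" for a b
    using step[OF that finite_placed c1[OF that(1)]] card_placed[OF that(1)] by simp
  have c3: "card (placed a \<union> placed b \<union> placed c) \<le> ?e + ?k + ?k"
    if "a \<in> placements" "b \<in> twins a" "c \<in> twins a" for a b c
    using step[of a c "placed a \<union> placed b"] c1[OF that(1)] c2[of a b] that by fastforce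
  have c4: "card (placed a \<union> placed b \<union> placed c \<union> placed d) \<le> ?e + ?k + ?k + ?k"
    if "a \<in> placements" "b \<in> twins a" "c \<in> twins a" "d \<in> twins a" for a b c d
    using step[of a d "placed a \<union> placed b \<union> placed c"] c1[OF that(1)] c3[of a b c] that by fastforce
  have pw_ge: "p ^ k \<le> pw p U" if "card U \<le> k" for k and U :: "nat set set"
    unfolding pw_def using that p_pos p_less_1 by (intro power_decreasing) auto
  have const: "z * x \<le> (\<Sum>b\<in>twins a. f b)" if "a \<in> placements" "0 \<le> z" "\<And>b. b \<in> twins a \<Longrightarrow> z \<le> f b" for a z f
  proof -
    have "z * x \<le> z * card (twins a)" using ag[OF that(1)] that(2) by (intro mult_left_mono) auto
    also have "\<dots> = (\<Sum>b\<in>twins a. z)" by simp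
    also have "\<dots> \<le> (\<Sum>b\<in>twins a. f b)" using that(3) by (intro sum_mono)
    finally show ?thesis .
  qed
  have outer: "(mean_order / 2 ^ ?v) * z \<le> (\<Sum>a\<in>placements. f a)" if "0 \<le> z" "\<And>a. a \<in> placements \<Longrightarrow> p ^ ?e * z \<le> f a" for z f
  proof -
    have "(mean_order / 2 ^ ?v) * z \<le> (real (card placements) * p ^ ?e) * z" using base that(1) by (intro mult_right_mono) auto
    also have "\<dots> = (\<Sum>a\<in>placements. p ^ ?e * z)" by simp
    also have "\<dots> \<le> (\<Sum>a\<in>placements. f a)" using that(2) by (intro sum_mono)
    finally show ?thesis .
  qed
  have nn: "0 \<le> p ^ ?e * y" "0 \<le> p ^ ?e * y * y" "0 \<le> p ^ ?e * y * y * y" "0 \<le> x * y" using p_pos x y by auto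
  show "\<exists>C. C \<noteq> {} \<and> (\<forall>b\<in>twins a. C \<subseteq> placed b)" if "a \<in> placements"
    using SD(2) core by (intro exI[of _ "?core a"]) auto
  have "(mean_order / 2 ^ ?v) * (x * y) \<le> twinsum2 pw2"
  proof (rule outer[OF nn(4)])
    fix a assume a: "a \<in> placements"
    show "p ^ ?e * (x * y) \<le> (\<Sum>b\<in>twins a. pw2 a b)"
      using const[OF a nn(1), of "\<lambda>b. pw2 a b"] pw_ge[OF c2[OF a]]
      by (simp add: y_def power_add mult_ac)
  qed
  then show "mean_order\<^sup>2 / min_scale / 2 ^ (2 * card V) \<le> twinsum2 pw2"
    unfolding xy by (simp add: power2_eq_square power_mult mult_ac)
  have "(mean_order / 2 ^ ?v) * (x * y * (x * y)) \<le> twinsum3 pw3"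
  proof (rule outer[OF mult_nonneg_nonneg[OF nn(4) nn(4)]])
    fix a assume a: "a \<in> placements"
    have "p ^ ?e * y * y * x \<le> (\<Sum>c\<in>twins a. pw3 a b c)" if "b \<in> twins a" for b
      using pw_ge[OF c3[OF a that]] by (intro const[OF a nn(2)]) (simp add: y_def power_add mult_ac)
    from const[OF a mult_nonneg_nonneg[OF nn(2) x], of "\<lambda>b. \<Sum>c\<in>twins a. pw3 a b c", OF this]
    show "p ^ ?e * (x * y * (x * y)) \<le> (\<Sum>b\<in>twins a. \<Sum>c\<in>twins a. pw3 a b c)"
      by (simp add: mult_ac)
  qed
  then show "mean_order ^ 3 / min_scale ^ 2 / 2 ^ (3 * card V) \<le>
    twinsum3 pw3"
    unfolding xy by (simp add: power2_eq_square power3_eq_cube power_mult power_mult_distrib mult_ac flip: power_add)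
  have "(mean_order / 2 ^ ?v) * (x * y * (x * y) * (x * y)) \<le>
    twinsum4 pw4"
  proof (rule outer[OF mult_nonneg_nonneg[OF mult_nonneg_nonneg[OF nn(4) nn(4)] nn(4)]])
    fix a assume a: "a \<in> placements"
    have 1: "p ^ ?e * y * y * y * x \<le> (\<Sum>d\<in>twins a. pw4 a b c d)"
      if "b \<in> twins a" "c \<in> twins a" for b c
      using pw_ge[OF c4[OF a that]] by (intro const[OF a nn(3)]) (simp add: y_def power_add mult_ac)
    have 2: "p ^ ?e * y * y * y * x * x \<le> (\<Sum>c\<in>twins a. \<Sum>d\<in>twins a. pw4 a b c d)"
      if "b \<in> twins a" for b
      by (intro const[OF a mult_nonneg_nonneg[OF nn(3) x]] 1 that)
    from const[OF a mult_nonneg_nonneg[OF mult_nonneg_nonneg[OF nn(3) x] x],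
        of "\<lambda>b. \<Sum>c\<in>twins a. \<Sum>d\<in>twins a. pw4 a b c d", OF 2]
    show "p ^ ?e * (x * y * (x * y) * (x * y)) \<le> (\<Sum>b\<in>twins a. \<Sum>c\<in>twins a. \<Sum>d\<in>twins a. pw4 a b c d)"
      by (simp add: mult_ac)
  qed
  then show "mean_order ^ 4 / min_scale ^ 3 / 2 ^ (4 * card V) \<le>
    twinsum4 pw4"
    unfolding xy by (simp add: power3_eq_cube power4_eq_xxxx power_mult power_mult_distrib mult_ac flip: power_add)
qed

lemma agreeing_subset: "agreeing D a \<subseteq> placements" by (auto simp: agreeing_def)

lemma cov_nonneg: "cov a b \<ge> 0"
  using pw_Un_le_mult[OF p_pos p_less_1] by (simp add: cov_def)

lemma Var_ge: "(1 - p) * (mean_order\<^sup>2 / min_scale / 2 ^ (2 * card V)) \<le> Var"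
proof -
  have "(1 - p) * (mean_order\<^sup>2 / min_scale / 2 ^ (2 * card V)) \<le> (1 - p) * twinsum2 pw2"
    using twin_sum2 p_less_1 by (intro mult_left_mono) auto
  also have "\<dots> = twinsum2 (\<lambda>a b. (1 - p) * pw2 a b)"
    by (simp add: sum_distrib_left)
  also have "\<dots> \<le> twinsum2 (\<lambda>a b. cov a b)"
  proof (intro sum_mono)
    fix a b assume ab: "a \<in> placements" "b \<in> twins a"
    then have "placed a \<inter> placed b \<noteq> {}" 
      using twins_share[OF ab(1)] self_agreeing[OF ab(1), of "verts minimiser"] by fastforce
    from pw_split_le[OF p_pos p_less_1 finite_placed finite_placed this]
    show "(1 - p) * pw2 a b \<le> cov a b" by (simp add: cov_def algebra_simps)
  qed
  also have "\<dots> \<le> Var" unfolding Var_def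
    by (intro sum_mono sum_mono2) (auto simp: agreeing_subset cov_nonneg)
  finally show ?thesis .
qed

lemma Var_pos: "Var > 0"
proof -
  have "0 < (1 - p) * (mean_order\<^sup>2 / min_scale / 2 ^ (2 * card V))" using p_less_1 mean_order_pos min_scale_pos by simp
  then show ?thesis using Var_ge by linarith
qed

lemma Var_le: "Var \<le> 2 * card E * (1 - p) * overlap_const * (mean_order\<^sup>2 / min_scale)"
proof -
  have "Var \<le> (\<Sum>a\<in>placements. \<Sum>b\<in>meeting (placed a). real (2 * card E) * (1 - p) * p ^ card (placed a \<union> placed b))"
    unfolding Var_meeting
  proof (intro sum_mono)
    fix a b assume ab: "a \<in> placements" "b \<in> meeting (placed a)"
    then have b: "b \<in> placements" using meeting_subset by auto
    have "card (placed a \<union> placed b) \<le> card (placed a) + card (placed b)" by (rule card_Un_le)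
    then show "cov a b \<le> real (2 * card E) * (1 - p) * p ^ card (placed a \<union> placed b)"
      using power_diff_bound[of p "card (placed a \<union> placed b)" "card (placed a) + card (placed b)" "2 * card E"]
        p_pos p_less_1 card_placed[OF ab(1)] card_placed[OF b]
      by (simp add: cov_def pw_def flip: power_add)
  qed
  also have "\<dots> = real (2 * card E) * (1 - p) * overlap_sum2" by (simp add: overlap_sum2_def sum_distrib_left)
  also have "\<dots> \<le> real (2 * card E) * (1 - p) * (overlap_const * mean_order\<^sup>2 / min_scale)"
    using overlap_sum2_le p_less_1 by (intro mult_left_mono) auto
  finally show ?thesis by (simp add: mult_ac)
qed

text \<open>Every linked triple (quadruple) can be ordered into a chain that starts with its first member; in this way sums
over linked tuples reduce to the overlap sums.\<close>

definition chain3 :: "('a \<Rightarrow> nat) \<Rightarrow> ('a \<Rightarrow> nat) \<Rightarrow> ('a \<Rightarrow> nat) \<Rightarrow> bool" where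
  "chain3 a b c \<longleftrightarrow> b \<in> meeting (placed a) \<and> c \<in> meeting (placed a \<union> placed b)"

definition chain4 :: "('a \<Rightarrow> nat) \<Rightarrow> ('a \<Rightarrow> nat) \<Rightarrow> ('a \<Rightarrow> nat) \<Rightarrow> ('a \<Rightarrow> nat) \<Rightarrow> bool" where
  "chain4 a b c d \<longleftrightarrow> chain3 a b c \<and> d \<in> meeting (placed a \<union> placed b \<union> placed c)"

lemma sum_meeting_conv: "(\<Sum>b\<in>meeting U. f b) = (\<Sum>b\<in>placements. of_bool (b \<in> meeting U) * (f b :: real))"
proof -
  have "(\<Sum>b\<in>placements. of_bool (b \<in> meeting U) * f b) = (\<Sum>b\<in>placements. if b \<in> meeting U then f b else 0)"
    by (intro sum.cong) auto
  also have "\<dots> = (\<Sum>b\<in>placements \<inter> meeting U. f b)" by (simp add: sum.inter_restrict)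
  also have "placements \<inter> meeting U = meeting U" using meeting_subset by auto
  finally show ?thesis ..
qed

lemma overlap_sum3_chain: "overlap_sum3 = sum3 (\<lambda>a b c. of_bool (chain3 a b c) * pw3 a b c)"
  unfolding overlap_sum3_def sum_meeting_conv
  by (simp only: sum_distrib_left chain3_def pw_def of_bool_conj mult.assoc)

lemma overlap_sum4_chain: "overlap_sum4 = sum4 (\<lambda>a b c d. of_bool (chain4 a b c d) * pw4 a b c d)"
  unfolding overlap_sum4_def sum_meeting_conv
  by (simp only: sum_distrib_left chain4_def chain3_def pw_def of_bool_conj mult.assoc)

abbreviation "lnk3 a b c \<equiv> linked3 (placed a) (placed b) (placed c)"
abbreviation "lnk4 a b c d \<equiv> linked4 (placed a) (placed b) (placed c) (placed d)"

lemma linked3_chain: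
  assumes "b \<in> placements" "c \<in> placements" "lnk3 a b c"
  shows "chain3 a b c \<or> chain3 a c b"
  using assms unfolding linked3_def chain3_def meeting_def mem_Collect_eq
  by (simp add: Int_Un_distrib Int_Un_distrib2 Int_commute)

lemma linked4_chain:
  assumes "b \<in> placements" "c \<in> placements" "d \<in> placements" "lnk4 a b c d"
  shows "chain4 a b c d \<or> chain4 a b d c \<or> chain4 a c b d \<or> chain4 a c d b \<or> chain4 a d b c \<or> chain4 a d c b"
  using assms unfolding linked4_def chain4_def chain3_def meeting_def mem_Collect_eq
  by (simp add: Int_Un_distrib Int_Un_distrib2 Int_commute) blast

lemma sum_linked3_le: "sum3 (\<lambda>a b c. of_bool (lnk3 a b c) * pw3 a b c) \<le> 2 * overlap_sum3"
proof -
  let ?P = placements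
  let ?f = "\<lambda>a b c. of_bool (chain3 a b c) * pw3 a b c"
  have "sum3 (\<lambda>a b c. of_bool (lnk3 a b c) * pw3 a b c)
    \<le> sum3 (\<lambda>a b c. ?f a b c + ?f a c b)"
  proof (intro sum_mono)
    fix a b c assume "a \<in> ?P" "b \<in> ?P" "c \<in> ?P"
    then have "of_bool (lnk3 a b c) \<le> (of_bool (chain3 a b c) + of_bool (chain3 a c b) :: real)"
      using linked3_chain[of b c a] by auto
    then have "of_bool (lnk3 a b c) * pw3 a b c
      \<le> (of_bool (chain3 a b c) + of_bool (chain3 a c b)) * pw3 a b c"
      using pw_pos[OF p_pos] by (intro mult_right_mono) (auto intro: less_imp_le)
    then show "of_bool (lnk3 a b c) * pw3 a b c \<le> ?f a b c + ?f a c b"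
      by (simp add: distrib_right Un_ac)
  qed
  also have "\<dots> = overlap_sum3 + sum3 (\<lambda>a b c. ?f a c b)"
    by (simp add: sum.distrib overlap_sum3_chain)
  also have "sum3 (\<lambda>a b c. ?f a c b) = overlap_sum3"
    unfolding overlap_sum3_chain by (rule sum.cong[OF refl], rule sum.swap)
  finally show ?thesis by simp
qed

lemma sum_linked4_le: "sum4 (\<lambda>a b c d. of_bool (lnk4 a b c d) * pw4 a b c d) \<le> 6 * overlap_sum4"
proof -
  let ?P = placements
  define f where "f a b c d = of_bool (chain4 a b c d) * pw4 a b c d" for a b c d
  have "sum4 (\<lambda>a b c d. of_bool (lnk4 a b c d) * pw4 a b c d)
    \<le> sum4 (\<lambda>a b c d. f a b c d + f a b d c + f a c b d + f a c d b + f a d b c + f a d c b)"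
  proof (intro sum_mono)
    fix a b c d assume P: "a \<in> ?P" "b \<in> ?P" "c \<in> ?P" "d \<in> ?P"
    let ?u = "pw4 a b c d"
    have "of_bool (lnk4 a b c d) \<le> (of_bool (chain4 a b c d) + of_bool (chain4 a b d c) + of_bool (chain4 a c b d)
       + of_bool (chain4 a c d b) + of_bool (chain4 a d b c) + of_bool (chain4 a d c b) :: real)"
      using linked4_chain[OF P(2-4), of a] by auto
    then have "of_bool (lnk4 a b c d) * ?u \<le> (of_bool (chain4 a b c d) + of_bool (chain4 a b d c) + of_bool (chain4 a c b d)
       + of_bool (chain4 a c d b) + of_bool (chain4 a d b c) + of_bool (chain4 a d c b)) * ?u"
      by (rule mult_right_mono) (intro less_imp_le pw_pos p_pos)
    then show "of_bool (lnk4 a b c d) * ?u \<le> f a b c d + f a b d c + f a c b d + f a c d b + f a d b c + f a d c b"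
      unfolding f_def by (simp only: distrib_right Un_ac)
  qed
  also have "\<dots> = 6 * sum4 (\<lambda>a b c d. f a b c d)"
    unfolding sum.distrib sum_rotate3[where F="f _"] by simp
  also have "\<dots> = 6 * overlap_sum4" by (simp add: overlap_sum4_chain f_def)
  finally show ?thesis .
qed

definition cum3 :: real where
  "cum3 = sum3 kap3"
definition cum4 :: real where
  "cum4 = sum4 kap4"

lemma abs_cum4_le: "\<bar>cum4\<bar> \<le> 600 * card E * (1 - p) * overlap_const ^ 3 * (mean_order ^ 4 / min_scale ^ 3)"
proof -
  let ?P = placements
  have "\<bar>cum4\<bar> \<le> sum4 (\<lambda>a b c d. \<bar>kap4 a b c d\<bar>)"
    unfolding cum4_def by (rule order_trans[OF sum_abs], intro sum_mono)+ simp
  also have "\<dots> \<le> sum4 (\<lambda>a b c d. 100 * card E * (1 - p) * (of_bool (lnk4 a b c d) * pw4 a b c d))"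
  proof (intro sum_mono)
    fix a b c d assume P: "a \<in> ?P" "b \<in> ?P" "c \<in> ?P" "d \<in> ?P"
    show "\<bar>kap4 a b c d\<bar>
      \<le> 100 * card E * (1 - p) * (of_bool (lnk4 a b c d) * pw4 a b c d)"
    proof (cases "lnk4 a b c d")
      case True
      then show ?thesis
        using abs_kappa4_le[OF p_pos p_less_1, of "placed a" "placed b" "placed c" "placed d" "4 * card E"] P
        by (simp add: card_placed mult_ac)
    qed (simp add: kappa4_not_linked)
  qed
  also have "\<dots> = 100 * card E * (1 - p) * sum4 (\<lambda>a b c d. of_bool (lnk4 a b c d) * pw4 a b c d)"
    by (simp only: sum_distrib_left)
  also have "\<dots> \<le> 100 * card E * (1 - p) * (6 * (overlap_const ^ 3 * mean_order ^ 4 / min_scale ^ 3))"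
    using p_less_1 overlap_sum4_le by (intro mult_left_mono order_trans[OF sum_linked4_le]) auto
  finally show ?thesis by (simp add: mult_ac)
qed

lemma placed_linked:
  assumes "C \<noteq> {}" "\<And>b. b \<in> twins a \<Longrightarrow> C \<subseteq> placed b" "a \<in> placements" "b \<in> twins a" "c \<in> twins a"
  shows "lnk3 a b c" "d \<in> twins a \<Longrightarrow> lnk4 a b c d"
    "card (placed a \<inter> placed b \<inter> placed c) \<ge> 1"
    "d \<in> twins a \<Longrightarrow> card (placed a \<inter> placed b \<inter> placed c \<inter> placed d) \<ge> 1"
proof -
  obtain x where "x \<in> C" using assms(1) by auto
  then have x: "x \<in> placed a" "x \<in> placed b" "x \<in> placed c" "d \<in> twins a \<Longrightarrow> x \<in> placed d"
    using assms(2)[OF self_agreeing[OF assms(3)]] assms(2)[OF assms(4)] assms(2)[OF assms(5)] assms(2)[of d] by auto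
  show "lnk3 a b c" using x(1-3) unfolding linked3_def by blast
  show "lnk4 a b c d" if "d \<in> twins a" using x(1-3) x(4)[OF that] unfolding linked4_def by blast
  have "placed a \<inter> placed b \<inter> placed c \<noteq> {}" using x(1-3) by blast
  then show "card (placed a \<inter> placed b \<inter> placed c) \<ge> 1" using card_gt_0_iff[of "placed a \<inter> placed b \<inter> placed c"] by simp
  show "card (placed a \<inter> placed b \<inter> placed c \<inter> placed d) \<ge> 1" if "d \<in> twins a"
  proof -
    have "placed a \<inter> placed b \<inter> placed c \<inter> placed d \<noteq> {}" using x(1-3) x(4)[OF that] by blast
    then show ?thesis using card_gt_0_iff[of "placed a \<inter> placed b \<inter> placed c \<inter> placed d"] by simp
  qed
qed

text \<open>Triples of twins share the edges of the minimiser, so they are linked and have a common edge; nonnegative sums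
over all triples are bounded below by restricting to them.\<close>

lemma twin_sum3_le:
  assumes fg: "\<And>a b c. a \<in> placements \<Longrightarrow> b \<in> placements \<Longrightarrow> c \<in> placements \<Longrightarrow> lnk3 a b c \<Longrightarrow>
      placed a \<inter> placed b \<inter> placed c \<noteq> {} \<Longrightarrow> g a b c \<le> f a b c"
    and nonneg: "\<And>a b c. a \<in> placements \<Longrightarrow> b \<in> placements \<Longrightarrow> c \<in> placements \<Longrightarrow> 0 \<le> (f a b c :: real)"
  shows "twinsum3 (\<lambda>a b c. g a b c)
    \<le> sum3 (\<lambda>a b c. f a b c)"
proof (rule sum_mono)
  fix a assume a: "a \<in> placements"
  obtain C where C: "C \<noteq> {}" "\<And>b. b \<in> twins a \<Longrightarrow> C \<subseteq> placed b" using twins_share[OF a] by blast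
  have "(\<Sum>b\<in>twins a. \<Sum>c\<in>twins a. g a b c) \<le> (\<Sum>b\<in>twins a. \<Sum>c\<in>twins a. f a b c)"
  proof (intro sum_mono fg a)
    fix b c assume bc: "b \<in> twins a" "c \<in> twins a"
    show "b \<in> placements" "c \<in> placements" using bc agreeing_subset by auto
    show "lnk3 a b c" by (rule placed_linked(1)[OF C a bc])
    show "placed a \<inter> placed b \<inter> placed c \<noteq> {}" using placed_linked(3)[OF C a bc] by auto
  qed
  also have "\<dots> \<le> (\<Sum>b\<in>twins a. \<Sum>c\<in>placements. f a b c)"
    using agreeing_subset a by (intro sum_mono sum_mono2) (auto intro!: nonneg)
  also have "\<dots> \<le> (\<Sum>b\<in>placements. \<Sum>c\<in>placements. f a b c)"
    using agreeing_subset a by (intro sum_mono2 sum_nonneg) (auto intro!: nonneg)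
  finally show "(\<Sum>b\<in>twins a. \<Sum>c\<in>twins a. g a b c) \<le> (\<Sum>b\<in>placements. \<Sum>c\<in>placements. f a b c)" .
qed

lemma twin_sum4_le:
  assumes fg: "\<And>a b c d. a \<in> placements \<Longrightarrow> b \<in> placements \<Longrightarrow> c \<in> placements \<Longrightarrow> d \<in> placements \<Longrightarrow> lnk4 a b c d \<Longrightarrow>
      placed a \<inter> placed b \<inter> placed c \<inter> placed d \<noteq> {} \<Longrightarrow> g a b c d \<le> f a b c d"
    and nonneg: "\<And>a b c d. a \<in> placements \<Longrightarrow> b \<in> placements \<Longrightarrow> c \<in> placements \<Longrightarrow> d \<in> placements \<Longrightarrow> 0 \<le> (f a b c d :: real)"
  shows "twinsum4 (\<lambda>a b c d. g a b c d)
    \<le> sum4 (\<lambda>a b c d. f a b c d)"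
proof (rule sum_mono)
  fix a assume a: "a \<in> placements"
  obtain C where C: "C \<noteq> {}" "\<And>b. b \<in> twins a \<Longrightarrow> C \<subseteq> placed b" using twins_share[OF a] by blast
  have "(\<Sum>b\<in>twins a. \<Sum>c\<in>twins a. \<Sum>d\<in>twins a. g a b c d)
    \<le> (\<Sum>b\<in>twins a. \<Sum>c\<in>twins a. \<Sum>d\<in>twins a. f a b c d)"
  proof (intro sum_mono fg a)
    fix b c d assume bcd: "b \<in> twins a" "c \<in> twins a" "d \<in> twins a"
    show "b \<in> placements" "c \<in> placements" "d \<in> placements" using bcd agreeing_subset by auto
    show "lnk4 a b c d" by (rule placed_linked(2)[OF C a bcd])
    show "placed a \<inter> placed b \<inter> placed c \<inter> placed d \<noteq> {}" using placed_linked(4)[OF C a bcd] by auto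
  qed
  also have "\<dots> \<le> (\<Sum>b\<in>twins a. \<Sum>c\<in>twins a. \<Sum>d\<in>placements. f a b c d)"
    using agreeing_subset a by (intro sum_mono sum_mono2) (auto intro!: nonneg)
  also have "\<dots> \<le> (\<Sum>b\<in>twins a. \<Sum>c\<in>placements. \<Sum>d\<in>placements. f a b c d)"
    using agreeing_subset a by (intro sum_mono sum_mono2 sum_nonneg) (auto intro!: nonneg)
  also have "\<dots> \<le> (\<Sum>b\<in>placements. \<Sum>c\<in>placements. \<Sum>d\<in>placements. f a b c d)"
    using agreeing_subset a by (intro sum_mono2 sum_nonneg) (auto intro!: nonneg)
  finally show "(\<Sum>b\<in>twins a. \<Sum>c\<in>twins a. \<Sum>d\<in>twins a. g a b c d)
    \<le> (\<Sum>b\<in>placements. \<Sum>c\<in>placements. \<Sum>d\<in>placements. f a b c d)" .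
qed

lemma cum3_ge_small_p:
  assumes p: "p \<le> 1 / 26"
  shows "(mean_order ^ 3 / min_scale ^ 2 / 2 ^ (3 * card V)) / 2 \<le> cum3"
proof -
  have ge: "pw3 a b c / 2 \<le> kap3 a b c" if "lnk3 a b c" for a b c
  proof -
    have "pw3 a b c * (1 / 2) \<le> pw3 a b c * (1 - 3 * p)"
      using p pw_pos[OF p_pos, of "placed a \<union> placed b \<union> placed c"] by (intro mult_left_mono) auto
    also have "\<dots> \<le> kap3 a b c" using that by (intro kappa3_ge_small_p p_pos p_less_1) auto
    finally show ?thesis by simp
  qed
  have nonneg: "0 \<le> kap3 a b c" for a b c
    using ge[of a b c] pw_pos[OF p_pos, of "placed a \<union> placed b \<union> placed c"]
    by (cases "lnk3 a b c") (simp_all add: kappa3_not_linked)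
  have "twinsum3 (\<lambda>a b c. pw3 a b c / 2) \<le> cum3"
    unfolding cum3_def by (rule twin_sum3_le[OF ge nonneg])
  then show ?thesis using twin_sum3 by (simp flip: sum_divide_distrib)
qed

lemma cum4_ge_small_p:
  assumes p: "p \<le> 1 / 26"
  shows "(mean_order ^ 4 / min_scale ^ 3 / 2 ^ (4 * card V)) / 2 \<le> cum4"
proof -
  have ge: "pw4 a b c d / 2 \<le> kap4 a b c d"
    if "lnk4 a b c d" for a b c d
  proof -
    have "pw4 a b c d * (1 / 2) \<le> pw4 a b c d * (1 - 13 * p)"
      using p pw_pos[OF p_pos, of "placed a \<union> placed b \<union> placed c \<union> placed d"] by (intro mult_left_mono) auto
    also have "\<dots> \<le> kap4 a b c d" using that by (intro kappa4_ge_small_p p_pos p_less_1) auto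
    finally show ?thesis by simp
  qed
  have nonneg: "0 \<le> kap4 a b c d" for a b c d
    using ge[of a b c d] pw_pos[OF p_pos, of "placed a \<union> placed b \<union> placed c \<union> placed d"]
    by (cases "lnk4 a b c d") (simp_all add: kappa4_not_linked)
  have "twinsum4 (\<lambda>a b c d. pw4 a b c d / 2) \<le> cum4"
    unfolding cum4_def by (rule twin_sum4_le[OF ge nonneg])
  then show ?thesis using twin_sum4 by (simp flip: sum_divide_distrib)
qed

lemma pw_ge_half_power:
  assumes "1 / 2 \<le> p" "card U \<le> k" shows "1 \<le> 2 ^ k * pw p U"
proof -
  have "(1 / 2) ^ k \<le> p ^ k" using assms by (intro power_mono) auto
  also have "\<dots> \<le> pw p U" unfolding pw_def using assms p_pos p_less_1 by (intro power_decreasing) auto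
  finally show ?thesis by (simp add: power_one_over field_simps)
qed

text \<open>The main term counts the common edges of linked triples, at least one for each triple of twins. The
error is quadratic in \<open>1 - p\<close> and is summed over linked triples only; since \<open>p\<close> is at least 1/2, the
number of linked triples is at most \<open>2^(3 * card E)\<close> times their weighted number.\<close>

lemma cum3_le_near_1:
  assumes p: "1 / 2 \<le> p"
  shows "cum3 \<le> (1 - p)\<^sup>2 * (108 * (real (card E))\<^sup>2 * 2 ^ (3 * card E) * overlap_const ^ 2) * (mean_order ^ 3 / min_scale ^ 2)
    - (1 - p) * (mean_order ^ 3 / min_scale ^ 2 / 2 ^ (3 * card V))"
proof -
  let ?P = placements
  let ?q = "1 - p"
  let ?c = "54 * (real (card E))\<^sup>2 * ?q\<^sup>2"
  let ?f = "\<lambda>a b c. of_bool (lnk3 a b c) * (?q * real (card (placed a \<inter> placed b \<inter> placed c)))"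
  let ?g = "\<lambda>a b c. of_bool (lnk3 a b c) * pw3 a b c"
  have q: "?q > 0" using p_less_1 by simp
  have main: "?q * (mean_order ^ 3 / min_scale ^ 2 / 2 ^ (3 * card V)) \<le> sum3 (\<lambda>a b c. ?f a b c)"
  proof -
    have "?q * (mean_order ^ 3 / min_scale ^ 2 / 2 ^ (3 * card V)) \<le>
       twinsum3 (\<lambda>a b c. ?q * pw3 a b c)"
      using mult_left_mono[OF twin_sum3, of ?q] q by (simp add: sum_distrib_left)
    also have "\<dots> \<le> sum3 (\<lambda>a b c. ?f a b c)"
    proof (rule twin_sum3_le)
      fix a b c assume "lnk3 a b c" "placed a \<inter> placed b \<inter> placed c \<noteq> {}"
      then have "card (placed a \<inter> placed b \<inter> placed c) \<ge> 1" "lnk3 a b c"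
        using card_gt_0_iff[of "placed a \<inter> placed b \<inter> placed c"] by auto
      then have "?q * pw3 a b c \<le> ?q * real (card (placed a \<inter> placed b \<inter> placed c))"
        using q pw_le_1[OF p_pos p_less_1, of "placed a \<union> placed b \<union> placed c"]
        by (intro mult_left_mono) auto
      then show "?q * pw3 a b c \<le> ?f a b c" using \<open>lnk3 a b c\<close> by simp
    qed (use q in auto)
    finally show ?thesis .
  qed
  have "cum3 \<le> sum3 (\<lambda>a b c. ?c * 2 ^ (3 * card E) * ?g a b c - ?f a b c)"
    unfolding cum3_def
  proof (intro sum_mono)
    fix a b c assume P: "a \<in> ?P" "b \<in> ?P" "c \<in> ?P"
    show "kap3 a b c \<le> ?c * 2 ^ (3 * card E) * ?g a b c - ?f a b c"
    proof (cases "lnk3 a b c")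
      case True
      have "\<bar>kap3 a b c + ?q * real (card (placed a \<inter> placed b \<inter> placed c))\<bar> \<le> ?c"
        using kappa3_near_1[OF p_pos p_less_1, of "placed a" "placed b" "placed c" "3 * card E"] P
        by (simp add: card_placed power_mult_distrib mult_ac)
      moreover have "?c * 1 \<le> ?c * (2 ^ (3 * card E) * pw3 a b c)"
        using card_Un3_le[of "placed a" "placed b" "placed c"] P
        by (intro mult_left_mono pw_ge_half_power p) (simp_all add: card_placed)
      ultimately show ?thesis using True by (simp add: mult.assoc)
    qed (simp add: kappa3_not_linked)
  qed
  also have "\<dots> = ?c * 2 ^ (3 * card E) * sum3 (\<lambda>a b c. ?g a b c) - sum3 (\<lambda>a b c. ?f a b c)"
    by (simp only: sum_subtractf sum_distrib_left)
  also have "\<dots> \<le> ?c * 2 ^ (3 * card E) * (2 * (overlap_const ^ 2 * mean_order ^ 3 / min_scale ^ 2)) - ?q * (mean_order ^ 3 / min_scale ^ 2 / 2 ^ (3 * card V))"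
    using main overlap_sum3_le by (intro diff_mono mult_left_mono order_trans[OF sum_linked3_le]) auto
  finally show ?thesis by (simp add: mult_ac)
qed

lemma cum4_ge_near_1:
  assumes p: "1 / 2 \<le> p"
  shows "(1 - p) * (mean_order ^ 4 / min_scale ^ 3 / 2 ^ (4 * card V))
    - (1 - p)\<^sup>2 * (2496 * (real (card E))\<^sup>2 * 2 ^ (4 * card E) * overlap_const ^ 3) * (mean_order ^ 4 / min_scale ^ 3) \<le> cum4"
proof -
  let ?P = placements
  let ?q = "1 - p"
  let ?c = "416 * (real (card E))\<^sup>2 * ?q\<^sup>2"
  let ?f = "\<lambda>a b c d. of_bool (lnk4 a b c d) * (?q * real (card (placed a \<inter> placed b \<inter> placed c \<inter> placed d)))"
  let ?g = "\<lambda>a b c d. of_bool (lnk4 a b c d) * pw4 a b c d"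
  have q: "?q > 0" using p_less_1 by simp
  have main: "?q * (mean_order ^ 4 / min_scale ^ 3 / 2 ^ (4 * card V)) \<le> sum4 (\<lambda>a b c d. ?f a b c d)"
  proof -
    have "?q * (mean_order ^ 4 / min_scale ^ 3 / 2 ^ (4 * card V)) \<le>
       twinsum4 (\<lambda>a b c d. ?q * pw4 a b c d)"
      using mult_left_mono[OF twin_sum4, of ?q] q by (simp add: sum_distrib_left)
    also have "\<dots> \<le> sum4 (\<lambda>a b c d. ?f a b c d)"
    proof (rule twin_sum4_le)
      fix a b c d assume l: "lnk4 a b c d" "placed a \<inter> placed b \<inter> placed c \<inter> placed d \<noteq> {}"
      then have "card (placed a \<inter> placed b \<inter> placed c \<inter> placed d) \<ge> 1"
        using card_gt_0_iff[of "placed a \<inter> placed b \<inter> placed c \<inter> placed d"] by auto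
      then have "?q * pw4 a b c d \<le> ?q * real (card (placed a \<inter> placed b \<inter> placed c \<inter> placed d))"
        using q pw_le_1[OF p_pos p_less_1, of "placed a \<union> placed b \<union> placed c \<union> placed d"]
        by (intro mult_left_mono) auto
      then show "?q * pw4 a b c d \<le> ?f a b c d" using l(1) by simp
    qed (use q in auto)
    finally show ?thesis .
  qed
  have "?q * (mean_order ^ 4 / min_scale ^ 3 / 2 ^ (4 * card V)) - ?c * 2 ^ (4 * card E) * (6 * (overlap_const ^ 3 * mean_order ^ 4 / min_scale ^ 3))
     \<le> sum4 (\<lambda>a b c d. ?f a b c d) - ?c * 2 ^ (4 * card E) * sum4 (\<lambda>a b c d. ?g a b c d)"
    using main overlap_sum4_le by (intro diff_mono mult_left_mono order_trans[OF sum_linked4_le]) auto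
  also have "\<dots> = sum4 (\<lambda>a b c d. ?f a b c d - ?c * 2 ^ (4 * card E) * ?g a b c d)"
    by (simp only: sum_subtractf sum_distrib_left)
  also have "\<dots> \<le> cum4"
    unfolding cum4_def
  proof (intro sum_mono)
    fix a b c d assume P: "a \<in> ?P" "b \<in> ?P" "c \<in> ?P" "d \<in> ?P"
    show "?f a b c d - ?c * 2 ^ (4 * card E) * ?g a b c d \<le> kap4 a b c d"
    proof (cases "lnk4 a b c d")
      case True
      have "\<bar>kap4 a b c d - ?q * real (card (placed a \<inter> placed b \<inter> placed c \<inter> placed d))\<bar> \<le> ?c"
        using kappa4_near_1[OF p_pos p_less_1, of "placed a" "placed b" "placed c" "placed d" "4 * card E"] P
        by (simp add: card_placed power_mult_distrib mult_ac)
      moreover have "?c * 1 \<le> ?c * (2 ^ (4 * card E) * pw4 a b c d)"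
        using card_Un4_le[of "placed a" "placed b" "placed c" "placed d"] P
        by (intro mult_left_mono pw_ge_half_power p) (simp_all add: card_placed)
      ultimately show ?thesis using True by (simp add: mult.assoc)
    qed (simp add: kappa4_not_linked)
  qed
  finally show ?thesis by (simp add: mult_ac)
qed

end

section \<open>Moments of the normalised sum\<close>

context pattern
begin

text \<open>For \<open>1 - p\<close> below this threshold the quadratic errors in \<open>cum3_le_near_1\<close> and \<open>cum4_ge_near_1\<close> are at
most half of the linear main terms.\<close>

definition near_one :: real where
  "near_one = min (1 / 2) (min
     (1 / (2 * 2 ^ (3 * card V) * (108 * (real (card E))\<^sup>2 * 2 ^ (3 * card E) * overlap_const ^ 2)))
     (1 / (2 * 2 ^ (4 * card V) * (2496 * (real (card E))\<^sup>2 * 2 ^ (4 * card E) * overlap_const ^ 3))))"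

lemma near_one_pos: "near_one > 0"
  using overlap_const_pos card_E_pos by (simp add: near_one_def)

definition sd_const :: real where "sd_const = sqrt (2 * card E * overlap_const)"

lemma sd_const_pos: "sd_const > 0"
  using overlap_const_pos card_E_pos by (simp add: sd_const_def)

end

context random_pattern
begin

definition theta :: real where "theta = (1 - p) * min_scale"

definition sd_order :: real where "sd_order = mean_order * sqrt ((1 - p) / min_scale)"

definition Z :: "(nat set \<Rightarrow> bool) \<Rightarrow> real" where "Z w = centred_total w / sqrt Var"

lemma theta_pos: "theta > 0" using p_less_1 min_scale_pos by (simp add: theta_def)

lemma sd_order_pos: "sd_order > 0" using p_less_1 min_scale_pos mean_order_pos by (simp add: sd_order_def)

lemma sd_order_identities:
  "(1 - p) * mean_order = sd_order * sqrt theta"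
  "(1 - p) * (mean_order\<^sup>2 / min_scale) = sd_order\<^sup>2"
  "(1 - p) * (mean_order ^ 3 / min_scale ^ 2) = sd_order ^ 3 / sqrt theta"
  "(1 - p) * (mean_order ^ 4 / min_scale ^ 3) = sd_order ^ 4 / theta"
proof -
  \<comment> \<open>with these square roots all quantities become monomials\<close>
  define t where "t = sqrt (1 - p)"
  define f where "f = sqrt min_scale"
  have t: "t > 0" "1 - p = t\<^sup>2" and f: "f > 0" "min_scale = f\<^sup>2"
    using p_less_1 min_scale_pos by (simp_all add: t_def f_def)
  have g: "sd_order = mean_order * (t / f)" using t(1) f(1) by (simp add: sd_order_def t(2) f(2) real_sqrt_divide)
  have th: "theta = (t * f)\<^sup>2" by (simp add: theta_def t(2) f(2) power_mult_distrib)
  have sth: "sqrt theta = t * f" using t f by (simp add: th)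
  show "(1 - p) * mean_order = sd_order * sqrt theta" "(1 - p) * (mean_order\<^sup>2 / min_scale) = sd_order\<^sup>2"
    "(1 - p) * (mean_order ^ 3 / min_scale ^ 2) = sd_order ^ 3 / sqrt theta" "(1 - p) * (mean_order ^ 4 / min_scale ^ 3) = sd_order ^ 4 / theta"
    unfolding sth unfolding th g t(2) f(2) using t(1) f(1)
    by (simp_all add: power2_eq_square power3_eq_cube power4_eq_xxxx mult_ac)
qed

lemma sd_ge: "sd_order / 2 ^ card V \<le> sqrt Var"
proof (rule real_le_rsqrt)
  have "(sd_order / 2 ^ card V)\<^sup>2 = sd_order\<^sup>2 / 2 ^ (2 * card V)"
    by (simp add: power_divide mult.commute flip: power_mult)
  also have "\<dots> = (1 - p) * (mean_order\<^sup>2 / min_scale / 2 ^ (2 * card V))"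
    unfolding sd_order_identities(2)[symmetric] by simp
  finally have "(sd_order / 2 ^ card V)\<^sup>2 = (1 - p) * (mean_order\<^sup>2 / min_scale / 2 ^ (2 * card V))" .
  then show "(sd_order / 2 ^ card V)\<^sup>2 \<le> Var" using Var_ge by simp
qed

lemma sd_le: "sqrt Var \<le> sd_const * sd_order"
proof -
  have "Var \<le> 2 * card E * overlap_const * ((1 - p) * (mean_order\<^sup>2 / min_scale))" using Var_le by (simp add: mult_ac)
  also have "\<dots> = 2 * card E * overlap_const * sd_order\<^sup>2" by (simp only: sd_order_identities)
  finally have "sqrt Var \<le> sqrt (2 * card E * overlap_const * sd_order\<^sup>2)" by (rule real_sqrt_le_mono)
  then show ?thesis using sd_order_pos by (simp add: sd_const_def real_sqrt_mult)
qed

lemma sd_pos: "sqrt Var > 0" using Var_pos by simp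

lemma expect_Z3: "expect (\<lambda>w. Z w ^ 3) = cum3 / sqrt Var ^ 3"
  unfolding Z_def power_divide integral_divide_zero expect_centred_total3 cum3_def ..

lemma expect_Z4: "expect (\<lambda>w. Z w ^ 4) = cum4 / sqrt Var ^ 4 + 3"
proof -
  have "sqrt Var ^ 4 = Var\<^sup>2" using Var_pos by (simp add: power4_eq_xxxx power2_eq_square)
  then show ?thesis using Var_pos
    unfolding Z_def power_divide integral_divide_zero expect_centred_total4 cum4_def by (simp add: add_divide_distrib)
qed

text \<open>The mean absolute value of one centred indicator is at most of order \<open>(1 - p) * p^card E\<close>, so the triangle
inequality suffices; for small \<open>theta\<close> this is much better than what the variance 1 gives.\<close>

lemma expect_abs_Z_le: "expect (\<lambda>w. \<bar>Z w\<bar>) \<le> 2 * card E * 2 ^ card V * sqrt theta"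
proof -
  have "expect (\<lambda>w. \<bar>centred_total w\<bar>) \<le> expect (\<lambda>w. \<Sum>f\<in>placements. \<bar>centred f w\<bar>)"
    unfolding centred_total_def by (intro integral_mono sum_abs) simp_all
  also have "\<dots> = (\<Sum>f\<in>placements. expect (\<lambda>w. \<bar>centred f w\<bar>))" by simp
  also have "\<dots> \<le> (\<Sum>f\<in>placements. 2 * (card E * (1 - p)) * pw p (placed f))"
    by (intro sum_mono expect_abs_centred)
  also have "\<dots> = 2 * (card E * (1 - p)) * (\<Sum>f\<in>placements. p ^ card (placed f))"
    by (simp add: sum_distrib_left pw_def)
  also have "\<dots> \<le> 2 * (card E * (1 - p)) * mean_order"
    using S1_le p_less_1 by (intro mult_left_mono) auto
  also have "\<dots> = 2 * card E * ((1 - p) * mean_order)" by simp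
  also have "\<dots> = 2 * card E * 2 ^ card V * sqrt theta * (sd_order / 2 ^ card V)"
    unfolding sd_order_identities by simp
  also have "\<dots> \<le> 2 * card E * 2 ^ card V * sqrt theta * sqrt Var"
    using sd_ge theta_pos by (intro mult_left_mono) auto
  finally show ?thesis
    using sd_pos by (simp add: Z_def divide_le_eq)
qed

lemma fourth_moment_le: "\<bar>expect (\<lambda>w. Z w ^ 4) - 3\<bar> \<le> 600 * card E * overlap_const ^ 3 * 2 ^ (4 * card V) / theta"
proof -
  have g: "(sd_order / 2 ^ card V) ^ 4 \<le> sqrt Var ^ 4"
    using sd_order_pos by (intro power_mono sd_ge) auto
  have "\<bar>cum4\<bar> \<le> 600 * card E * overlap_const ^ 3 * ((1 - p) * (mean_order ^ 4 / min_scale ^ 3))"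
    using abs_cum4_le by (simp add: mult_ac)
  also have "\<dots> = 600 * card E * overlap_const ^ 3 * 2 ^ (4 * card V) / theta * (sd_order / 2 ^ card V) ^ 4"
    unfolding sd_order_identities by (simp add: power_divide mult.commute flip: power_mult)
  also have "\<dots> \<le> 600 * card E * overlap_const ^ 3 * 2 ^ (4 * card V) / theta * sqrt Var ^ 4"
    using g theta_pos overlap_const_pos by (intro mult_left_mono) auto
  finally show ?thesis
    unfolding expect_Z4 using sd_pos by (simp add: divide_le_eq)
qed

lemma char_Z_le:
  "cmod (expect (\<lambda>w. iexp (t * Z w)) - complex_of_real (exp (- (t\<^sup>2 / 2))))
    \<le> 32 * card E * overlap_const ^ 2 * 2 ^ (3 * card V) * \<bar>t\<bar> ^ 3 / sqrt theta"
proof -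
  interpret ld: local_dependence coins placements "\<lambda>f w. centred f w / sqrt Var" "\<lambda>f. meeting (placed f)"
    by (rule local_dependence_centred[OF Var_pos])
  have W: "ld.W = Z"
    by (simp add: fun_eq_iff ld.W_def Z_def centred_total_def sum_divide_distrib)
  have g: "(sd_order / 2 ^ card V) ^ 3 \<le> sqrt Var ^ 3"
    using sd_order_pos by (intro power_mono sd_ge) auto
  have "(1 - p) * overlap_sum3 \<le> (1 - p) * (overlap_const ^ 2 * mean_order ^ 3 / min_scale ^ 2)"
    using overlap_sum3_le p_less_1 by (intro mult_left_mono) auto
  also have "\<dots> = overlap_const ^ 2 * ((1 - p) * (mean_order ^ 3 / min_scale ^ 2))" by simp
  also have "\<dots> = overlap_const ^ 2 * 2 ^ (3 * card V) / sqrt theta * (sd_order / 2 ^ card V) ^ 3"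
    unfolding sd_order_identities by (simp add: power_divide mult.commute flip: power_mult)
  also have "\<dots> \<le> overlap_const ^ 2 * 2 ^ (3 * card V) / sqrt theta * sqrt Var ^ 3"
    using g theta_pos overlap_const_pos by (intro mult_left_mono) auto
  finally have "(1 - p) * overlap_sum3 / sqrt Var ^ 3 \<le> overlap_const ^ 2 * 2 ^ (3 * card V) / sqrt theta"
    using sd_pos by (simp add: divide_le_eq)
  then have "16 * card E * ((1 - p) * overlap_sum3 / sqrt Var ^ 3) \<le> 16 * card E * (overlap_const ^ 2 * 2 ^ (3 * card V) / sqrt theta)"
    by (rule mult_left_mono) simp
  with local_error_le[OF Var_pos]
  have "ld.local_error \<le> 16 * card E * (overlap_const ^ 2 * 2 ^ (3 * card V) / sqrt theta)"
    by (simp add: mult_ac)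
  then have "2 * ld.local_error * \<bar>t\<bar> ^ 3 \<le> 2 * (16 * card E * (overlap_const ^ 2 * 2 ^ (3 * card V) / sqrt theta)) * \<bar>t\<bar> ^ 3"
    by (intro mult_right_mono mult_left_mono) auto
  with ld.char_local_dependence_bound[of t] show ?thesis
    unfolding W by (simp add: mult_ac)
qed

text \<open>Both extreme regimes lead to the same bounds; only the sign of the third cumulant differs between them.\<close>

lemma cum_extreme:
  assumes "p \<le> 1 / 26 \<or> 1 - p \<le> near_one"
  shows "sd_order ^ 3 / sqrt theta / 2 ^ (3 * card V + 1) \<le> \<bar>cum3\<bar>"
    and "sd_order ^ 4 / theta / 2 ^ (4 * card V + 1) \<le> cum4"
proof -
  let ?q = "1 - p"
  define L3 where "L3 = mean_order ^ 3 / min_scale ^ 2"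
  define L4 where "L4 = mean_order ^ 4 / min_scale ^ 3"
  note folds = L3_def[symmetric] L4_def[symmetric]
  have L: "L3 \<ge> 0" "L4 \<ge> 0" using mean_order_pos min_scale_pos by (auto simp: L3_def L4_def)
  have "?q * L3 / 2 ^ (3 * card V) / 2 \<le> \<bar>cum3\<bar> \<and> ?q * L4 / 2 ^ (4 * card V) / 2 \<le> cum4"
    using assms
  proof
    assume p: "p \<le> 1 / 26"
    have le: "?q * x / 2 ^ k / 2 \<le> x / 2 ^ k / 2" if "x \<ge> 0" for x and k :: nat
      using mult_right_mono[of ?q 1 x] that p_pos by (intro divide_right_mono) auto
    note le[OF L(1), of "3 * card V"] le[OF L(2), of "4 * card V"]
    with cum3_ge_small_p[OF p, unfolded folds] cum4_ge_small_p[OF p, unfolded folds] show ?thesis by linarith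
  next
    assume q: "?q \<le> near_one"
    define C3 where "C3 = 108 * (real (card E))\<^sup>2 * 2 ^ (3 * card E) * overlap_const ^ 2"
    define C4 where "C4 = 2496 * (real (card E))\<^sup>2 * 2 ^ (4 * card E) * overlap_const ^ 3"
    have C: "C3 > 0" "C4 > 0" using overlap_const_pos card_E_pos by (auto simp: C3_def C4_def)
    have "?q \<le> 1 / 2" "?q \<le> 1 / (2 * 2 ^ (3 * card V) * C3)" "?q \<le> 1 / (2 * 2 ^ (4 * card V) * C4)"
      using q unfolding near_one_def C3_def[symmetric] C4_def[symmetric] by auto
    then have p: "1 / 2 \<le> p" and qC: "?q * C3 \<le> 1 / 2 ^ (3 * card V) / 2" "?q * C4 \<le> 1 / 2 ^ (4 * card V) / 2"
      using C by (simp_all add: field_simps)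
    have q2: "?q\<^sup>2 * C * x = (?q * C) * (?q * x)" for C x by (simp add: power2_eq_square)
    have qL: "0 \<le> ?q * L3" "0 \<le> ?q * L4" using L p_less_1 by (intro mult_nonneg_nonneg; simp)+
    have "?q\<^sup>2 * C3 * L3 \<le> (1 / 2 ^ (3 * card V) / 2) * (?q * L3)"
      unfolding q2 by (rule mult_right_mono[OF qC(1) qL(1)])
    then have 3: "cum3 \<le> - (?q * L3 / 2 ^ (3 * card V) / 2)"
      using cum3_le_near_1[OF p, folded C3_def, unfolded folds] by simp
    have "?q\<^sup>2 * C4 * L4 \<le> (1 / 2 ^ (4 * card V) / 2) * (?q * L4)"
      unfolding q2 by (rule mult_right_mono[OF qC(2) qL(2)])
    then have "?q\<^sup>2 * C4 * L4 \<le> ?q * L4 / 2 ^ (4 * card V) / 2" by simp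
    moreover have "?q * L4 / 2 ^ (4 * card V) - ?q\<^sup>2 * C4 * L4 \<le> cum4"
      using cum4_ge_near_1[OF p, folded C4_def, unfolded folds] by simp
    ultimately have 4: "?q * L4 / 2 ^ (4 * card V) / 2 \<le> cum4" by linarith
    show ?thesis using 3 4 by linarith
  qed
  then show "sd_order ^ 3 / sqrt theta / 2 ^ (3 * card V + 1) \<le> \<bar>cum3\<bar>"
    and "sd_order ^ 4 / theta / 2 ^ (4 * card V + 1) \<le> cum4"
    unfolding L3_def L4_def sd_order_identities by (simp_all add: mult.commute)
qed

text \<open>Away from 0 and 1 every power of \<open>p\<close> that occurs is bounded below, and every subhypergraph with an edge has a
vertex.\<close>

lemma theta_moderate:
  assumes "1 / 26 < p" "near_one < 1 - p"
  shows "1 / theta \<le> (26 ^ card E / near_one) / n"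
proof -
  have "card (edges minimiser) \<le> card E" "card (verts minimiser) \<ge> 1"
  proof -
    show "card (edges minimiser) \<le> card E" using minimiser(1) finite_E by (intro card_mono)
    have "verts minimiser \<noteq> {}" using minimiser(1-3) E_subset by fastforce
    then show "card (verts minimiser) \<ge> 1"
      using minimiser(4) finite_V finite_subset card_gt_0_iff[of "verts minimiser"] by fastforce
  qed
  then have "(1 / 26) ^ card E * n \<le> p ^ card (edges minimiser) * real n ^ card (verts minimiser)"
    using assms(1) p_less_1 p_pos n_pos self_le_power[of "real n" "card (verts minimiser)"]
    by (intro mult_mono order_trans[OF power_mono power_decreasing]) auto
  then have "near_one * ((1 / 26) ^ card E * n) \<le> theta"
    unfolding theta_def minimiser(5)[symmetric] using assms(2) near_one_pos p_less_1 by (intro mult_mono) auto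
  then have "1 / theta \<le> 1 / (near_one * ((1 / 26) ^ card E * n))"
    using near_one_pos n_pos theta_pos by (intro divide_left_mono mult_pos_pos) auto
  then show ?thesis by (simp add: power_one_over divide_simps)
qed

text \<open>The standard deviation is at most of order \<open>sd_order\<close>, so dividing the lower bounds on the cumulants by its
powers keeps the order in \<open>theta\<close>.\<close>

lemma moment_lower_bounds:
  "1 / sqrt theta \<le> 2 ^ (3 * card V + 1) * sd_const ^ 3 * \<bar>expect (\<lambda>w. Z w ^ 3)\<bar> \<or> 1 / theta \<le> (26 ^ card E / near_one) / n"
  "1 / theta \<le> 2 ^ (4 * card V + 1) * sd_const ^ 4 * \<bar>expect (\<lambda>w. Z w ^ 4) - 3\<bar> \<or> 1 / theta \<le> (26 ^ card E / near_one) / n"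
proof -
  have "1 / sqrt theta \<le> 2 ^ (3 * card V + 1) * sd_const ^ 3 * \<bar>expect (\<lambda>w. Z w ^ 3)\<bar> \<and>
     1 / theta \<le> 2 ^ (4 * card V + 1) * sd_const ^ 4 * \<bar>expect (\<lambda>w. Z w ^ 4) - 3\<bar>"
    if *: "p \<le> 1 / 26 \<or> 1 - p \<le> near_one"
  proof -
    have s: "sqrt Var ^ k \<le> sd_const ^ k * sd_order ^ k" for k
      using power_mono[OF sd_le, of k] sd_pos by (simp add: power_mult_distrib)
    have s_pos: "sqrt Var ^ k > 0" for k using sd_pos by simp
    have key: "1 / x \<le> y * sd_const ^ k * (c / sqrt Var ^ k)" if "sd_order ^ k / x / y \<le> c" "x > 0" "y > 0" for x y c k
    proof -
      have "sqrt Var ^ k / x \<le> sd_const ^ k * sd_order ^ k / x" using s that(2) by (intro divide_right_mono) auto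
      also have "\<dots> = y * sd_const ^ k * (sd_order ^ k / x / y)" using that(3) by simp
      also have "\<dots> \<le> y * sd_const ^ k * c" using that sd_const_pos by (intro mult_left_mono) auto
      finally show ?thesis using s_pos[of k] by (simp add: field_simps)
    qed
    have "\<bar>expect (\<lambda>w. Z w ^ 3)\<bar> = \<bar>cum3\<bar> / sqrt Var ^ 3"
      using s_pos[of 3] by (simp add: expect_Z3)
    moreover have "cum4 / sqrt Var ^ 4 \<le> \<bar>expect (\<lambda>w. Z w ^ 4) - 3\<bar>"
      unfolding expect_Z4 by linarith
    moreover have "2 ^ (4 * card V + 1) * sd_const ^ 4 * (cum4 / sqrt Var ^ 4) \<le> 2 ^ (4 * card V + 1) * sd_const ^ 4 * \<bar>expect (\<lambda>w. Z w ^ 4) - 3\<bar>"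
      using calculation(2) sd_const_pos by (intro mult_left_mono) auto
    ultimately show ?thesis
      using key[OF cum_extreme(1)[OF *]] key[OF cum_extreme(2)[OF *]] theta_pos by fastforce
  qed
  moreover have "1 / theta \<le> (26 ^ card E / near_one) / n" if "\<not> (p \<le> 1 / 26 \<or> 1 - p \<le> near_one)"
    using that by (intro theta_moderate) auto
  ultimately show
    "1 / sqrt theta \<le> 2 ^ (3 * card V + 1) * sd_const ^ 3 * \<bar>expect (\<lambda>w. Z w ^ 3)\<bar> \<or> 1 / theta \<le> (26 ^ card E / near_one) / n"
    "1 / theta \<le> 2 ^ (4 * card V + 1) * sd_const ^ 4 * \<bar>expect (\<lambda>w. Z w ^ 4) - 3\<bar> \<or> 1 / theta \<le> (26 ^ card E / near_one) / n"
    by blast+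
qed

end

section \<open>Copies and placements\<close>

context random_pattern
begin

definition copies :: "nat hypergraph set" where
  "copies = {H'. subhypergraph H' (complete_hypergraph n) \<and> hypergraph_iso H' (V, E)}"

definition automorphisms :: "('a \<Rightarrow> 'a) set" where
  "automorphisms = {\<alpha> \<in> V \<rightarrow>\<^sub>E V. bij_betw \<alpha> V V \<and> (\<lambda>x. \<alpha> ` x) ` E = E}"

definition copy_at :: "('a \<Rightarrow> nat) \<Rightarrow> nat hypergraph" where
  "copy_at f = (f ` V, placed f)"

lemma edge_subset: "x \<in> E \<Longrightarrow> x \<subseteq> V"
  using E_subset by auto

lemma copy_at_copies:
  assumes f: "f \<in> placements" shows "copy_at f \<in> copies"
proof -
  have inj: "inj_on f V" and fn: "f ` V \<subseteq> {1..n}" using f by (auto simp: placements_def)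
  have "placed f \<subseteq> Pow (f ` V) - {{}}"
    using E_subset by (auto simp: placed_def)
  then have "subhypergraph (copy_at f) (complete_hypergraph n)"
    using fn finite_V placed_subset[OF f]
    by (simp add: copy_at_def subhypergraph_def hypergraph_def complete_hypergraph_def)
  moreover have "hypergraph_iso (copy_at f) (V, E)"
    unfolding hypergraph_iso_def
  proof (intro exI conjI)
    show "bij_betw (inv_into V f) (verts (copy_at f)) (verts (V, E))"
      using inj by (simp add: copy_at_def bij_betw_inv_into inj_on_imp_bij_betw)
    have "inv_into V f ` f ` x = x" if "x \<in> E" for x
      using inj edge_subset[OF that] by (rule inv_into_image_cancel)
    then show "edges (V, E) = (\<lambda>e. inv_into V f ` e) ` edges (copy_at f)"
      by (simp add: copy_at_def placed_def image_image)
  qed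
  ultimately show ?thesis by (simp add: copies_def)
qed

lemma copies_obtain_placement:
  assumes "H' \<in> copies"
  obtains k where "k \<in> placements" "copy_at k = H'"
proof -
  let ?W = "verts H'"
  obtain h where h: "bij_betw h ?W V" and E: "E = (\<lambda>e. h ` e) ` edges H'"
    using assms by (auto simp: copies_def hypergraph_iso_def)
  have W: "?W \<subseteq> {1..n}" and edges: "edges H' \<subseteq> Pow ?W"
    using assms by (auto simp: copies_def subhypergraph_def hypergraph_def complete_hypergraph_def)
  have inj: "inj_on h ?W" and hW: "h ` ?W = V" using h by (auto simp: bij_betw_def)
  define k where "k = restrict (inv_into ?W h) V"
  have bij: "bij_betw (inv_into ?W h) V ?W" using h by (rule bij_betw_inv_into)
  have img: "k ` x = inv_into ?W h ` x" if "x \<subseteq> V" for x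
    using that by (auto simp: k_def intro!: image_cong)
  have "k ` V = ?W" "inj_on k V"
    using bij by (simp_all add: img bij_betw_def) (auto simp: k_def inj_on_def)
  then have "k \<in> placements" using W by (auto simp: placements_def k_def)
  moreover have "k ` h ` e = e" if "e \<in> edges H'" for e
  proof -
    have "e \<subseteq> ?W" "h ` e \<subseteq> V" using that edges hW by auto
    then show ?thesis using inj by (simp add: img inv_into_image_cancel)
  qed
  then have "placed k = edges H'" unfolding placed_def by (subst E) (simp add: image_image)
  ultimately show thesis using \<open>k ` V = ?W\<close> by (intro that[of k]) (auto simp: copy_at_def)
qed

text \<open>The placements with the same copy as \<open>k\<close> are the compositions of \<open>k\<close> with automorphisms.\<close>

lemma card_fibre:
  assumes k: "k \<in> placements"
  shows "card {f \<in> placements. copy_at f = copy_at k} = card automorphisms"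
proof (rule bij_betw_same_card[symmetric])
  let ?F = "{f \<in> placements. copy_at f = copy_at k}"
  let ?k' = "inv_into V k"
  have inj: "inj_on k V" and kn: "k ` V \<subseteq> {1..n}" using k by (auto simp: placements_def)
  have img: "compose V g h ` x = g ` h ` x" if "x \<subseteq> V" for g :: "'x \<Rightarrow> 'y" and h :: "'a \<Rightarrow> 'x" and x
    using that by (auto simp: compose_def intro!: image_cong)
  have imE: "(\<lambda>x. compose V g h ` x) ` E = (\<lambda>x. g ` x) ` (\<lambda>x. h ` x) ` E" for g :: "'x \<Rightarrow> 'y" and h :: "'a \<Rightarrow> 'x"
    using edge_subset by (auto simp: img image_image intro!: image_cong)
  show "bij_betw (compose V k) automorphisms ?F"
  proof (rule bij_betwI)
    show "compose V k \<in> automorphisms \<rightarrow> ?F"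
    proof
      fix \<alpha> assume \<alpha>: "\<alpha> \<in> automorphisms"
      then have b: "\<alpha> ` V = V" "inj_on \<alpha> V" and e: "(\<lambda>x. \<alpha> ` x) ` E = E"
        by (auto simp: automorphisms_def bij_betw_def)
      have "inj_on (compose V k \<alpha>) V"
        using comp_inj_on[of \<alpha> V k] b inj by (auto simp: inj_on_def compose_def)
      moreover have V: "compose V k \<alpha> ` V = k ` V" by (simp add: img b)
      moreover have "compose V k \<alpha> \<in> V \<rightarrow> {1..n}" using V kn by blast
      ultimately have "compose V k \<alpha> \<in> placements"
        by (simp add: placements_def PiE_def)
      moreover have "placed (compose V k \<alpha>) = placed k" by (simp add: placed_def imE e)
      ultimately show "compose V k \<alpha> \<in> ?F" using V by (simp add: copy_at_def)
    qed
    show "compose V ?k' \<in> ?F \<rightarrow> automorphisms"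
    proof
      fix f assume "f \<in> ?F"
      then have f: "f \<in> placements" "f ` V = k ` V" "placed f = placed k" by (auto simp: copy_at_def)
      have V: "compose V ?k' f ` V = V" using f(2) inj by (simp add: img)
      moreover have "(\<lambda>x. compose V ?k' f ` x) ` E = E"
      proof -
        have "(\<lambda>x. compose V ?k' f ` x) ` E = (\<lambda>x. ?k' ` x) ` placed k"
          using f(3) by (simp add: imE placed_def)
        also have "\<dots> = (\<lambda>x. x) ` E"
          unfolding placed_def image_image using inj edge_subset
          by (intro image_cong refl) (simp add: inv_into_image_cancel flip: image_image)
        finally show ?thesis by simp
      qed
      moreover have "inj_on (compose V ?k' f) V"
        using V finite_V by (intro eq_card_imp_inj_on) auto
      ultimately show "compose V ?k' f \<in> automorphisms"
        by (auto simp: automorphisms_def bij_betw_def PiE_iff compose_extensional)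
    qed
    show "compose V ?k' (compose V k \<alpha>) = \<alpha>" if "\<alpha> \<in> automorphisms" for \<alpha>
      using that inj by (intro PiE_ext[of _ V "\<lambda>_. V" \<alpha>])
        (auto simp: automorphisms_def compose_def PiE_iff extensional_def bij_betw_def)
    show "compose V k (compose V ?k' f) = f" if "f \<in> ?F" for f
    proof -
      have f: "f \<in> V \<rightarrow>\<^sub>E {1..n}" "f ` V = k ` V" using that by (auto simp: copy_at_def placements_def)
      have "k (?k' (f x)) = f x" if "x \<in> V" for x
        using f(2) that by (intro f_inv_into_f) auto
      then show ?thesis
        using f(1) by (intro extensionalityI[of _ V]) (auto simp: compose_def PiE_iff extensional_def)
    qed
  qed
qed

lemma card_automorphisms_pos: "card automorphisms > 0"
proof -
  have "restrict id V \<in> automorphisms"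
  proof -
    have "restrict id V ` x = x" if "x \<subseteq> V" for x using that by (auto simp: image_iff)
    then have "(\<lambda>x. restrict id V ` x) ` E = (\<lambda>x. x) ` E" using edge_subset by (intro image_cong) auto
    then show ?thesis by (auto simp: automorphisms_def bij_betw_def inj_on_def)
  qed
  moreover have "finite automorphisms"
    unfolding automorphisms_def using finite_V by (simp add: finite_PiE)
  ultimately show ?thesis by (auto simp: card_gt_0_iff)
qed

lemma copies_image: "copies = copy_at ` placements"
  using copy_at_copies copies_obtain_placement by (auto simp: image_iff) metis

lemma sum_present_copies:
  "(\<Sum>f\<in>placements. present (placed f) w) = card automorphisms * (\<Sum>H'\<in>copies. present (edges H') w)"
proof -
  have fin: "finite copies" by (simp add: copies_image)
  have "(\<Sum>f\<in>placements. present (placed f) w)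
      = (\<Sum>H'\<in>copies. \<Sum>f\<in>{f \<in> placements. copy_at f = H'}. present (placed f) w)"
    by (rule sum.group[symmetric, OF finite_placements fin]) (auto simp: copies_image)
  also have "\<dots> = (\<Sum>H'\<in>copies. card automorphisms * present (edges H') w)"
  proof (rule sum.cong[OF refl])
    fix H' assume "H' \<in> copies"
    then obtain k where k: "k \<in> placements" "copy_at k = H'" by (rule copies_obtain_placement)
    have "(\<Sum>f\<in>{f \<in> placements. copy_at f = H'}. present (placed f) w)
      = (\<Sum>f\<in>{f \<in> placements. copy_at f = H'}. present (edges H') w)"
      by (intro sum.cong) (auto simp: copy_at_def)
    also have "\<dots> = card automorphisms * present (edges H') w"
      using card_fibre[OF k(1)] by (simp add: k(2))
    finally show "(\<Sum>f\<in>{f \<in> placements. copy_at f = H'}. present (placed f) w) = card automorphisms * present (edges H') w" .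
  qed
  finally show ?thesis by (simp add: sum_distrib_left)
qed

definition sample :: "(nat set \<Rightarrow> bool) \<Rightarrow> nat hypergraph" where
  "sample w = ({1..n}, {e \<in> Pow {1..n} - {{}}. w e})"

lemma random_hypergraph_coins: "random_hypergraph n p = map_pmf sample coins"
  by (simp add: random_hypergraph_def coins_def ground_def sample_def[abs_def])

lemma copy_count_sample: "copy_count (V, E) n (sample w) = (\<Sum>H'\<in>copies. present (edges H') w)"
proof -
  have fin: "finite copies" by (simp add: copies_image)
  have "{H'. subhypergraph H' (complete_hypergraph n) \<and> hypergraph_iso H' (V, E) \<and> subhypergraph H' (sample w)}
     = {H' \<in> copies. \<forall>x\<in>edges H'. w x}"
    by (auto simp: copies_def subhypergraph_def complete_hypergraph_def sample_def)
  then have "copy_count (V, E) n (sample w) = real (card {H' \<in> copies. \<forall>x\<in>edges H'. w x})"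
    by (simp only: copy_count_def)
  also have "\<dots> = (\<Sum>H'\<in>copies. present (edges H') w)"
    using fin by (simp add: present_def sum.If_cases of_bool_def Collect_conj_eq Int_commute)
  finally show ?thesis .
qed

text \<open>The copy count is an affine function of \<open>centred_total\<close>, whose slope is the reciprocal of the number of
automorphisms; normalisation removes slope and offset.\<close>

lemma normalized_copy_count_sample: "normalized_copy_count (V, E) n p (sample w) = Z w"
proof -
  define A where "A = real (card automorphisms)"
  define m where "m = (\<Sum>f\<in>placements. pw p (placed f))"
  have A: "A > 0" using card_automorphisms_pos by (simp add: A_def)
  have count: "copy_count (V, E) n (sample w) = (centred_total w + m) / A" for w
    using sum_present_copies[of w] A
    by (simp add: copy_count_sample centred_total_def centred_def sum_subtractf m_def A_def field_simps)
  have mean: "measure_pmf.expectation (random_hypergraph n p) (copy_count (V, E) n) = m / A"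
    unfolding random_hypergraph_coins integral_map_pmf count by (simp add: expect_centred_total)
  have "measure_pmf.variance (random_hypergraph n p) (copy_count (V, E) n) = expect (\<lambda>w. (centred_total w)\<^sup>2 / A\<^sup>2)"
    unfolding mean random_hypergraph_coins integral_map_pmf count
    by (simp add: add_divide_distrib power_divide expect_centred_total)
  then have var: "measure_pmf.variance (random_hypergraph n p) (copy_count (V, E) n) = Var / A\<^sup>2"
    by (simp add: expect_centred_total2)
  show ?thesis
    unfolding normalized_copy_count_def var unfolding mean count using A
    by (simp add: Z_def real_sqrt_divide add_divide_distrib)
qed

lemma expectation_normalized:
  "measure_pmf.expectation (random_hypergraph n p) (\<lambda>G. f (normalized_copy_count (V, E) n p G))
    = expect (\<lambda>w. f (Z w))"
  unfolding random_hypergraph_coins integral_map_pmf normalized_copy_count_sample ..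

end

section \<open>The equivalences\<close>

lemma (in random_pattern) min_scale_le_smallest_edge: "min_scale \<le> p * real n ^ Min (card ` E)"
proof -
  have "Min (card ` E) \<in> card ` E" using finite_E E_nonempty by (intro Min_in) auto
  then obtain x where x: "x \<in> E" "card x = Min (card ` E)" by auto
  then show ?thesis using min_scale_le[of "{x}" x] edge_subset[of x] by auto
qed

lemma (in random_pattern) min_scale_ge_smallest_edge:
  assumes "1 / 2 \<le> p" shows "real n ^ Min (card ` E) / 2 ^ card E \<le> min_scale"
proof -
  obtain x where x: "x \<in> edges minimiser" using minimiser(2) by auto
  then have "Min (card ` E) \<le> card x" using minimiser(1) finite_E by (intro Min_le) auto
  also have "card x \<le> card (verts minimiser)"
    using x minimiser(3,4) finite_V finite_subset by (intro card_mono) auto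
  finally have v: "real n ^ Min (card ` E) \<le> real n ^ card (verts minimiser)"
    using n_pos by (intro power_increasing) auto
  have "card (edges minimiser) \<le> card E" using minimiser(1) finite_E by (intro card_mono)
  then have "p ^ card E \<le> p ^ card (edges minimiser)" using p_pos p_less_1 by (intro power_decreasing) auto
  moreover have "(1 / 2) ^ card E \<le> p ^ card E" using assms by (intro power_mono) auto
  ultimately have e: "(1 / 2) ^ card E \<le> p ^ card (edges minimiser)" by linarith
  have "(1 / 2) ^ card E * real n ^ Min (card ` E) \<le> p ^ card (edges minimiser) * real n ^ card (verts minimiser)"
    using e v p_pos by (intro mult_mono) auto
  then show ?thesis unfolding minimiser(5)[symmetric] by (simp add: power_one_over)
qed

lemma (in pattern) random_pattern_large:
  assumes "0 < p" "p < 1" "2 * card V \<le> n" shows "random_pattern V E n p"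
  using assms by unfold_locales

text \<open>A single edge of minimal size shows that the scale is at most \<open>p n^k\<close>, where \<open>k\<close> is the minimal size. For \<open>p\<close> at
least 1/2 it is also at least a constant times \<open>n^k\<close>, and for smaller \<open>p\<close> the factor \<open>1 - p\<close> is harmless.\<close>

lemma (in pattern) two_conditions_iff:
  fixes p :: "nat \<Rightarrow> real"
  assumes p: "\<And>n. 0 < p n \<and> p n < 1"
  shows "filterlim (\<lambda>n. min_expected_scale (V, E) n (p n)) at_top sequentially \<and>
      filterlim (\<lambda>n. (1 - p n) * real n ^ Min (card ` E)) at_top sequentially \<longleftrightarrow>
    filterlim (\<lambda>n. (1 - p n) * min_expected_scale (V, E) n (p n)) at_top sequentially"
    (is "?A \<and> ?B \<longleftrightarrow> ?C")
proof (intro iffI conjI)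
  have large: "eventually (\<lambda>n. 2 * card V \<le> n) sequentially" by (rule eventually_ge_at_top)
  {
    assume C: ?C
    show ?A
    proof (rule filterlim_at_top_mono[OF C])
      show "eventually (\<lambda>n. (1 - p n) * min_expected_scale (V, E) n (p n) \<le> min_expected_scale (V, E) n (p n)) sequentially"
        using large
      proof eventually_elim
        case (elim n)
        interpret rp: random_pattern V E n "p n" using p elim by (intro random_pattern_large) auto
        show ?case
          using mult_right_mono[of "1 - p n" 1 rp.min_scale] rp.min_scale_pos p[of n] by (simp add: rp.min_scale_def)
      qed
    qed
    show ?B
    proof (rule filterlim_at_top_mono[OF C])
      show "eventually (\<lambda>n. (1 - p n) * min_expected_scale (V, E) n (p n) \<le> (1 - p n) * real n ^ Min (card ` E)) sequentially"
        using large
      proof eventually_elim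
        case (elim n)
        interpret rp: random_pattern V E n "p n" using p elim by (intro random_pattern_large) auto
        have "p n * real n ^ Min (card ` E) \<le> 1 * real n ^ Min (card ` E)"
          using p[of n] by (intro mult_right_mono) auto
        then have "rp.min_scale \<le> real n ^ Min (card ` E)" using rp.min_scale_le_smallest_edge by simp
        then show ?case using p[of n] by (intro mult_left_mono) (auto simp: rp.min_scale_def)
      qed
    qed
  }
  assume AB: "?A \<and> ?B"
  show ?C
    unfolding filterlim_at_top
  proof
    fix r :: real
    have "eventually (\<lambda>n. 2 * r \<le> min_expected_scale (V, E) n (p n)) sequentially"
      "eventually (\<lambda>n. 2 ^ card E * r \<le> (1 - p n) * real n ^ Min (card ` E)) sequentially"
      using AB unfolding filterlim_at_top by auto
    with large show "eventually (\<lambda>n. r \<le> (1 - p n) * min_expected_scale (V, E) n (p n)) sequentially"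
    proof eventually_elim
      case (elim n)
      interpret rp: random_pattern V E n "p n" using p elim(1) by (intro random_pattern_large) auto
      show ?case
      proof (cases "1 / 2 \<le> p n")
        case True
        have "r \<le> (1 - p n) * (real n ^ Min (card ` E) / 2 ^ card E)"
          using elim(3) by (simp add: field_simps)
        also have "\<dots> \<le> (1 - p n) * rp.min_scale"
          using rp.min_scale_ge_smallest_edge[OF True] p[of n] by (intro mult_left_mono) auto
        finally show ?thesis by (simp add: rp.min_scale_def)
      next
        case False
        have "r \<le> (1 / 2) * rp.min_scale" using elim(2) by (simp add: rp.min_scale_def)
        also have "\<dots> \<le> (1 - p n) * rp.min_scale" using False rp.min_scale_pos by (intro mult_right_mono) auto
        finally show ?thesis by (simp add: rp.min_scale_def)
      qed
    qed
  qed
qed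

lemma finite_set_random_hypergraph: "finite (set_pmf (random_hypergraph n p))"
proof -
  have "set_pmf (random_hypergraph n p) \<subseteq> {{1..n}} \<times> Pow (Pow {1..n})"
    by (auto simp: random_hypergraph_def)
  then show ?thesis by (rule finite_subset) simp
qed

lemma le_mult_of_le:
  fixes a c C x :: real assumes "a \<le> c * x" "c \<le> C" "0 \<le> x" shows "a \<le> C * x"
  using assms mult_right_mono[of c C x] by linarith

lemma (in pattern) normal_limit_iff_copy_count:
  fixes p :: "nat \<Rightarrow> real"
  assumes p: "\<And>n. 0 < p n \<and> p n < 1"
  defines "Y \<equiv> \<lambda>n. normalized_copy_count (V, E) n (p n)"
    and "th \<equiv> \<lambda>n. (1 - p n) * min_expected_scale (V, E) n (p n)"
  shows "weak_conv_m (\<lambda>n. distr (measure_pmf (random_hypergraph n (p n))) borel (Y n)) std_normal_distribution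
      \<longleftrightarrow> filterlim th at_top sequentially"
    and "filterlim th at_top sequentially
      \<longleftrightarrow> (\<lambda>n. measure_pmf.expectation (random_hypergraph n (p n)) (\<lambda>G. Y n G ^ 4)) \<longlonglongrightarrow> 3"
proof -
  let ?c1 = "2 * real (card E) * 2 ^ card V"
  let ?c2 = "600 * real (card E) * overlap_const ^ 3 * 2 ^ (4 * card V)"
  let ?c3 = "2 ^ (4 * card V + 1) * sd_const ^ 4"
  let ?c4 = "2 ^ (3 * card V + 1) * sd_const ^ 3"
  let ?c5 = "26 ^ card E / near_one"
  let ?c6 = "32 * real (card E) * overlap_const ^ 2 * 2 ^ (3 * card V)"
  define C where "C = ?c1 + ?c2 + ?c3 + ?c4 + ?c5 + ?c6"
  have pos: "?c1 > 0" "?c2 > 0" "?c3 > 0" "?c4 > 0" "?c5 > 0" "?c6 > 0"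
    using overlap_const_pos card_E_pos sd_const_pos near_one_pos by auto
  have C: "?c1 \<le> C" "?c2 \<le> C" "?c3 \<le> C" "?c4 \<le> C" "?c5 \<le> C" "?c6 \<le> C" "C > 0"
    unfolding C_def using pos by linarith+
  note hyps = finite_set_random_hypergraph C(7)
  have rp: "random_pattern V E n (p n)" if "2 * card V \<le> n" for n
    using p that by (intro random_pattern_large) auto
  have th: "random_pattern.theta V E n (p n) = th n" if "2 * card V \<le> n" for n
    by (simp add: th_def random_pattern.theta_def[OF rp[OF that]] random_pattern.min_scale_def[OF rp[OF that]])
  have ex: "measure_pmf.expectation (random_hypergraph n (p n)) (\<lambda>G. f (Y n G))
      = measure_pmf.expectation (random_pattern.coins n (p n)) (\<lambda>w. f (random_pattern.Z V E n (p n) w))"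
    if "2 * card V \<le> n" for n and f :: "real \<Rightarrow> 'b::{banach, second_countable_topology}"
    unfolding Y_def by (rule random_pattern.expectation_normalized[OF rp[OF that]])
  have th_pos: "th n > 0" if "2 * card V \<le> n" for n
    using random_pattern.theta_pos[OF rp[OF that]] by (simp add: th[OF that])
  have 1: "measure_pmf.expectation (random_hypergraph n (p n)) (\<lambda>G. \<bar>Y n G\<bar>) \<le> C * sqrt (th n)"
    if n: "2 * card V \<le> n" for n
    using random_pattern.expect_abs_Z_le[OF rp[OF n]] th_pos[OF n]
    unfolding ex[OF n, of abs] th[OF n] by (intro le_mult_of_le[OF _ C(1)]) auto
  have 2: "\<bar>measure_pmf.expectation (random_hypergraph n (p n)) (\<lambda>G. Y n G ^ 4) - 3\<bar> \<le> C / th n"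
    if n: "2 * card V \<le> n" for n
    using random_pattern.fourth_moment_le[OF rp[OF n]] th_pos[OF n] divide_right_mono[OF C(2), of "th n"]
    unfolding ex[OF n, of "\<lambda>x. x ^ 4"] th[OF n] by linarith
  have moderate: "1 / th n \<le> C / n" if "1 / th n \<le> ?c5 / n" for n
    using that divide_right_mono[OF C(5), of "real n"] by linarith
  have 3: "1 / th n \<le> C * \<bar>measure_pmf.expectation (random_hypergraph n (p n)) (\<lambda>G. Y n G ^ 4) - 3\<bar> \<or> 1 / th n \<le> C / n"
    if n: "2 * card V \<le> n" for n
    using random_pattern.moment_lower_bounds(2)[OF rp[OF n]] moderate[of n] le_mult_of_le[OF _ C(3)]
    unfolding ex[OF n, of "\<lambda>x. x ^ 4"] th[OF n] by (meson abs_ge_zero)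
  have 4: "1 / sqrt (th n) \<le> C * \<bar>measure_pmf.expectation (random_hypergraph n (p n)) (\<lambda>G. Y n G ^ 3)\<bar> \<or> 1 / th n \<le> C / n"
    if n: "2 * card V \<le> n" for n
    using random_pattern.moment_lower_bounds(1)[OF rp[OF n]] moderate[of n] le_mult_of_le[OF _ C(4)]
    unfolding ex[OF n, of "\<lambda>x. x ^ 3"] th[OF n] by (meson abs_ge_zero)
  have 5: "cmod (measure_pmf.expectation (random_hypergraph n (p n)) (\<lambda>G. iexp (t * Y n G)) - complex_of_real (exp (- (t\<^sup>2 / 2))))
      \<le> C * \<bar>t\<bar> ^ 3 / sqrt (th n)" if n: "2 * card V \<le> n" for n t
  proof -
    have "?c6 * (\<bar>t\<bar> ^ 3 / sqrt (th n)) \<le> C * (\<bar>t\<bar> ^ 3 / sqrt (th n))"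
      using C(6) th_pos[OF n] by (intro mult_right_mono) auto
    then show ?thesis
      using random_pattern.char_Z_le[OF rp[OF n], of t]
      unfolding ex[OF n, of "\<lambda>x. iexp (t * x)"] th[OF n] by simp
  qed
  note iff = normal_limit_iff[OF hyps th_pos 1 2 3 4 5]
  show "weak_conv_m (\<lambda>n. distr (measure_pmf (random_hypergraph n (p n))) borel (Y n)) std_normal_distribution
      \<longleftrightarrow> filterlim th at_top sequentially" by (rule iff(1))
  show "filterlim th at_top sequentially
      \<longleftrightarrow> (\<lambda>n. measure_pmf.expectation (random_hypergraph n (p n)) (\<lambda>G. Y n G ^ 4)) \<longlonglongrightarrow> 3" by (rule iff(2))
qed

theorem theorem3p5:
  fixes H :: "'a hypergraph" and p :: "nat \<Rightarrow> real"
  assumes "hypergraph H"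
    and "edges H \<noteq> {}"
    and "\<And>n. 0 < p n \<and> p n < 1"
  defines "normal_limit \<equiv>
      weak_conv_m
        (\<lambda>n. distr (measure_pmf (random_hypergraph n (p n))) borel (normalized_copy_count H n (p n)))
        std_normal_distribution"
    and "two_conditions \<equiv>
      filterlim (\<lambda>n. min_expected_scale H n (p n)) at_top sequentially \<and>
      filterlim (\<lambda>n. (1 - p n) * real n ^ Min (card ` edges H)) at_top sequentially"
    and "one_condition \<equiv>
      filterlim (\<lambda>n. (1 - p n) * min_expected_scale H n (p n)) at_top sequentially"
    and "fourth_moment \<equiv>
      (\<lambda>n. measure_pmf.expectation (random_hypergraph n (p n))
             (\<lambda>G. normalized_copy_count H n (p n) G ^ 4)) \<longlonglongrightarrow> 3"
  shows "(normal_limit \<longleftrightarrow> two_conditions) \<and> (two_conditions \<longleftrightarrow> one_condition) \<and>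
         (one_condition \<longleftrightarrow> fourth_moment)"
proof -
  interpret pattern "verts H" "edges H"
    using assms(1,2) by unfold_locales (auto simp: hypergraph_def)
  have H: "(verts H, edges H) = H" by simp
  have "normal_limit \<longleftrightarrow> one_condition"
    unfolding normal_limit_def one_condition_def
    using normal_limit_iff_copy_count(1)[OF assms(3)] unfolding H .
  moreover have "one_condition \<longleftrightarrow> fourth_moment"
    unfolding one_condition_def fourth_moment_def
    using normal_limit_iff_copy_count(2)[OF assms(3)] unfolding H .
  moreover have "two_conditions \<longleftrightarrow> one_condition"
    unfolding two_conditions_def one_condition_def
    using two_conditions_iff[OF assms(3)] unfolding H .
  ultimately show ?thesis by blast
qed

end
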